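(* Let $X_t$ be a Lévy process in $\mathbb{R}^d$ whose Lévy measure is absolutely continuous with respect to Lebesgue measure, and let $X_t^*$ be its symmetrization. Let $f_1,\ldots,f_m:\mathbb{R}^d\to[0,\infty)$ be nonnegative continuous functions and let $D_1,\ldots,D_m$ be domains in $\mathbb{R}^d$. Then for all $z\in\mathbb{R}^d$ and all $0\le t_1\le\cdots\le t_m$, $$E^{z}\left[\prod_{i=1}^{m} f_i(X_{t_i})\,\mathbb{I}_{D_i}(X_{t_i})\right]\le E^{0}\left[\prod_{i=1}^{m} f_i^*(X^*_{t_i})\,\mathbb{I}_{D_i^*}(X^*_{t_i})\right].$$
   Context: A domain is an open connected subset $D\subset\mathbb{R}^d$ of finite Lebesgue measure. $D^*$ is the open ball centered at the origin with the same Lebesgue measure as $D$. $\mathbb{I}_A$ is the indicator function of $A$, and $m\{\cdot\}$ below denotes Lebesgue measure. For a nonnegative measurable function $f$ on $\mathbb{R}^d$, the symmetric decreasing rearrangement $f^*:\mathbb{R}^d\to[0,\infty]$ is the unique function with $f^*(x)=f^*(y)$ if $|x|=|y|$, $f^*(x)\le f^*(y)$ if $|x|\ge|y|$, $\lim_{|x|\to|y|^+}f^*(x)=f^*(y)$, and $m\{f>t\}=m\{f^*>t\}$ for all $t\ge0$. Products use the convention $0\cdot\infty=0$. A Lévy process $X_t$ (stationary independent increments, stochastically continuous, càdlàg paths) has a characteristic triple $(b,\mathbb{A},\nu)$, with $b\in\mathbb{R}^d$, $\mathbb{A}$ a symmetric nonnegative definite $d\times d$ matrix, and $\nu$ (the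 Lévy measure) a measure with $\nu(\{0\})=0$ and $\int\frac{|y|^2}{1+|y|^2}d\nu(y)<\infty$, such that $E^x[e^{i\xi\cdot X_t}]=e^{-t\Psi(\xi)+i\xi\cdot x}$, where $$\Psi(\xi)=-i\langle b,\xi\rangle+\tfrac12\langle\mathbb{A}\xi,\xi\rangle+\int_{\mathbb{R}^d}\left[1+i\langle\xi,y\rangle\mathbb{I}_B(y)-e^{i\xi\cdot y}\right]d\nu(y),$$ and $B$ is the unit ball centered at the origin. $P^x,E^x$ refer to the process started at $x$. If $\nu$ has density $\phi$, the symmetrization $X_t^*$ of $X_t$ is the Lévy process with characteristic triple $(0,\mathbb{A}^*,\phi^*(y)\,dy)$, where $\mathbb{A}^*=(\det\mathbb{A})^{1/d}I_d$, $I_d$ is the $d\times d$ identity matrix, and $\phi^*$ is the symmetric decreasing rearrangement of $\phi$. *)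

theory Defs
  imports "HOL-Probability.Probability"
begin

section \<open>Rearrangements\<close>

definition domain :: "(real ^ 'n) set \<Rightarrow> bool" where
  "domain D \<longleftrightarrow> open D \<and> connected D \<and> emeasure lborel D < \<infinity>"

definition ball_rearrangement :: "(real ^ 'n) set \<Rightarrow> (real ^ 'n) set" where
  "ball_rearrangement D =
     (THE B. (\<exists>r\<ge>0. B = ball 0 r) \<and> emeasure lborel B = emeasure lborel D)"

text \<open>The filter \<open>filtercomap norm (at_right (norm y))\<close> is the limit of \<open>|x|\<close> to \<open>|y|\<close> from
  above. For Borel measurable \<open>f\<close> the four conditions determine exactly one function.\<close>

definition decreasing_rearrangement ::
    "(real ^ 'n \<Rightarrow> ennreal) \<Rightarrow> real ^ 'n \<Rightarrow> ennreal" where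
  "decreasing_rearrangement f =
     (THE g. (\<forall>x y. norm x = norm y \<longrightarrow> g x = g y) \<and>
             (\<forall>x y. norm y \<le> norm x \<longrightarrow> g x \<le> g y) \<and>
             (\<forall>y. (g \<longlongrightarrow> g y) (filtercomap norm (at_right (norm y)))) \<and>
             (\<forall>t::real. 0 \<le> t \<longrightarrow>
                emeasure lborel {x. ennreal t < f x} = emeasure lborel {x. ennreal t < g x}))"


section \<open>Levy processes\<close>

definition cadlag :: "(real \<Rightarrow> 'a::topological_space) \<Rightarrow> bool" where
  "cadlag w \<longleftrightarrow>
     (\<forall>t\<ge>0. (w \<longlongrightarrow> w t) (at_right t)) \<and> (\<forall>t>0. \<exists>l. (w \<longlongrightarrow> l) (at_left t))"

text \<open>Time is the half-line \<open>{0..}\<close>; the values of \<open>X\<close> at negative times are irrelevant. The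
  measure \<open>M\<close> plays the role of \<open>P\<^sup>z\<close>, the law under which the process starts at \<open>z\<close>.\<close>

definition levy_process_from ::
    "real ^ 'n \<Rightarrow> 'w measure \<Rightarrow> (real \<Rightarrow> 'w \<Rightarrow> real ^ 'n) \<Rightarrow> bool" where
  "levy_process_from z M X \<longleftrightarrow>
     prob_space M \<and>
     (\<forall>t\<ge>0. X t \<in> borel_measurable M) \<and>
     (AE \<omega> in M. X 0 \<omega> = z) \<and>
     (\<forall>(n::nat) t. 0 \<le> t 0 \<and> (\<forall>i<n. t i \<le> t (Suc i)) \<longrightarrow>
        prob_space.indep_vars M (\<lambda>_. borel) (\<lambda>i \<omega>. X (t (Suc i)) \<omega> - X (t i) \<omega>) {..<n}) \<and>
     (\<forall>s\<ge>0. \<forall>t\<ge>0. distr M borel (\<lambda>\<omega>. X (s + t) \<omega> - X s \<omega>) = distr M borel (\<lambda>\<omega>. X t \<omega> - X 0 \<omega>)) \<and>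
     (\<forall>t\<ge>0. \<forall>\<epsilon>>0.
        ((\<lambda>s. measure M {\<omega> \<in> space M. \<epsilon> < dist (X s \<omega>) (X t \<omega>)}) \<longlongrightarrow> 0) (at t within {0..})) \<and>
     (AE \<omega> in M. cadlag (\<lambda>t. X t \<omega>))"

definition levy_measure :: "(real ^ 'n) measure \<Rightarrow> bool" where
  "levy_measure \<nu> \<longleftrightarrow>
     sets \<nu> = sets borel \<and> emeasure \<nu> {0} = 0 \<and>
     (\<integral>\<^sup>+ y. ennreal ((norm y)\<^sup>2 / (1 + (norm y)\<^sup>2)) \<partial>\<nu>) < \<infinity>"

definition levy_triple :: "real ^ 'n \<Rightarrow> real ^ 'n ^ 'n \<Rightarrow> (real ^ 'n) measure \<Rightarrow> bool" where
  "levy_triple b A \<nu> \<longleftrightarrow>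
     transpose A = A \<and> (\<forall>\<xi>. 0 \<le> (A *v \<xi>) \<bullet> \<xi>) \<and> levy_measure \<nu>"

definition levy_exponent ::
    "real ^ 'n \<Rightarrow> real ^ 'n ^ 'n \<Rightarrow> (real ^ 'n) measure \<Rightarrow> real ^ 'n \<Rightarrow> complex" where
  "levy_exponent b A \<nu> \<xi> =
     - \<i> * of_real (b \<bullet> \<xi>) + of_real (1 / 2 * ((A *v \<xi>) \<bullet> \<xi>)) +
     (LINT y|\<nu>. 1 + \<i> * of_real ((\<xi> \<bullet> y) * indicator (ball 0 1) y) - exp (\<i> * of_real (\<xi> \<bullet> y)))"

definition levy_process_with_triple ::
    "real ^ 'n \<Rightarrow> 'w measure \<Rightarrow> (real \<Rightarrow> 'w \<Rightarrow> real ^ 'n) \<Rightarrow>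
     real ^ 'n \<Rightarrow> real ^ 'n ^ 'n \<Rightarrow> (real ^ 'n) measure \<Rightarrow> bool" where
  "levy_process_with_triple z M X b A \<nu> \<longleftrightarrow>
     levy_process_from z M X \<and> levy_triple b A \<nu> \<and>
     (\<forall>t\<ge>0. \<forall>\<xi>. (LINT \<omega>|M. exp (\<i> * of_real (\<xi> \<bullet> X t \<omega>))) =
        exp (- of_real t * levy_exponent b A \<nu> \<xi> + \<i> * of_real (\<xi> \<bullet> z)))"

definition symmetrized_matrix :: "real ^ 'n ^ 'n \<Rightarrow> real ^ 'n ^ 'n" where
  "symmetrized_matrix A = root CARD('n) (det A) *\<^sub>R mat 1"

text \<open>Meaningful when \<open>\<nu>\<close> is absolutely continuous; a different version of the density has the
  same rearrangement.\<close>

definition symmetrized_levy_measure :: "(real ^ 'n) measure \<Rightarrow> (real ^ 'n) measure" where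
  "symmetrized_levy_measure \<nu> =
     density lborel (decreasing_rearrangement (RN_deriv lborel \<nu>))"

text \<open>\<open>Y\<close>, started at \<open>z\<close> under \<open>N\<close>, is the symmetrization of a process with triple \<open>(b, A, \<nu>)\<close>;
  the drift \<open>b\<close> is discarded.\<close>

definition levy_symmetrization_from ::
    "real ^ 'n \<Rightarrow> 'v measure \<Rightarrow> (real \<Rightarrow> 'v \<Rightarrow> real ^ 'n) \<Rightarrow>
     real ^ 'n \<Rightarrow> real ^ 'n ^ 'n \<Rightarrow> (real ^ 'n) measure \<Rightarrow> bool" where
  "levy_symmetrization_from z N Y b A \<nu> \<longleftrightarrow>
     levy_process_with_triple z N Y 0 (symmetrized_matrix A) (symmetrized_levy_measure \<nu>)"

end

theory Submission
  imports Defs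
begin

text \<open>
  Say that \<open>G\<close> weakly majorizes \<open>g\<close> if the integral of \<open>g\<close> over any set \<open>E\<close> of finite measure is at
  most that of \<open>G\<close> over the centred ball of the same measure, and let \<open>G\<close> be radially decreasing.
  If \<open>\<mu>'\<close> dominates \<open>\<mu>\<close> in the sense of the Riesz rearrangement inequality, then averaging \<open>g\<close>
  over shifts by \<open>\<mu>\<close> and \<open>G\<close> over shifts by \<open>\<mu>'\<close> preserves weak majorization, and so does
  multiplying by \<open>f 1\<^sub>D\<close> and by its rearrangement. By independence of increments the expectation is
  an iteration of these two steps, started at the constant 1. At the end, lower semicontinuity turns
  weak majorization into the inequality between the value at \<open>z\<close> and the value at \<open>0\<close>.

  That the increments of \<open>X\<^sup>*\<close> dominate those of \<open>X\<close> holds because domination survives convolutions,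
  mixtures and weak limits: after truncation of the small jumps, the laws are limits of convolutions
  of a point mass, a Gaussian measure and powers \<open>((1 - p) \<delta>\<^sub>0 + p \<rho>)\<^sup>k\<close> with \<open>\<rho>\<close> absolutely
  continuous. The Riesz inequality itself is proved by Steiner symmetrization along suitable
  directions, starting from the one-dimensional case.
\<close>

section \<open>Radial sets and the layer cake formula\<close>

text \<open>Along a whole path the two sides are multiple integrals. Handing a majorized pair of
  functions from one increment to the next breaks the comparison up into the three-set Riesz
  inequality. For this to iterate, \<open>G\<close> must stay radially decreasing, so that centred
  balls are its best sets; domination therefore also demands, through \<open>unimodal\<close>, that
  averaging over \<open>\<mu>'\<close> keeps functions radially decreasing. Drift causes no loss,
  since the point mass at 0 dominates every law. This matters even if \<open>b\<close> is 0:
  truncating the small jumps leaves a compensating drift that can diverge. The powers are binomial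
  approximations of compound Poisson laws, with characteristic function
  \<open>(1 + t * J / k) ^ k\<close>. Convergence is known only through characteristic functions,
  while domination is tested on overlaps of sets. Adding small Gaussian noise gives every law a
  density that is an integral of its characteristic function, so dominated convergence applies; the
  noise is removed by semicontinuity of an overlap and of its complement.\<close>

text \<open>Balls are indexed by volume, so that \<open>rball (emeasure lborel S)\<close> is the
  rearrangement of \<open>S\<close> for every measurable \<open>S\<close>, with infinite volume
  giving the whole space. The strict inequality makes these sets open.\<close>

definition rball :: "ennreal \<Rightarrow> 'a::euclidean_space set" where
  "rball v = {x. emeasure lborel (ball 0 (norm x) :: 'a set) < v}"

definition radially_decreasing :: "('a::real_normed_vector \<Rightarrow> ennreal) \<Rightarrow> bool" where
  "radially_decreasing G \<longleftrightarrow> (\<forall>x y. norm y \<le> norm x \<longrightarrow> G x \<le> G y)"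

lemma radially_decreasingD: "radially_decreasing G \<Longrightarrow> norm y \<le> norm x \<Longrightarrow> G x \<le> G y"
  by (auto simp: radially_decreasing_def)

lemma emeasure_lborel_ball_mono_iff:
  fixes a b :: real and x y :: "'a::euclidean_space"
  assumes "0 \<le> a" "0 \<le> b"
  shows "emeasure lborel (ball x a) < emeasure lborel (ball y b) \<longleftrightarrow> a < b"
proof -
  have "unit_ball_vol (real DIM('a)) > 0" by simp
  then show ?thesis using assms
    by (simp add: emeasure_ball ennreal_less_iff power_mono_iff not_le[symmetric])
qed

lemma rball_finite:
  assumes "v < \<top>"
  obtains r where "0 \<le> r" "rball v = (ball 0 r :: 'a::euclidean_space set)"
    "v = emeasure lborel (ball 0 r :: 'a set)"
proof -
  define d where "d = DIM('a)"
  have d: "d > 0" by (simp add: d_def)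
  define u where "u = unit_ball_vol (real d)"
  have u: "u > 0" by (simp add: u_def)
  define r where "r = root d (enn2real v / u)"
  have r: "0 \<le> r" using u by (simp add: r_def real_root_ge_zero)
  have "u * r ^ d = enn2real v" using u d by (simp add: r_def)
  then have v: "v = emeasure lborel (ball 0 r :: 'a set)"
    using assms r by (simp add: emeasure_ball u_def d_def)
  have "rball v = (ball 0 r :: 'a set)"
    unfolding rball_def v by (auto simp: emeasure_lborel_ball_mono_iff r)
  with r v that show thesis by blast
qed

lemma rball_top [simp]: "rball \<top> = UNIV"
  using emeasure_lborel_ball_finite by (auto simp: rball_def)

lemma rball_0 [simp]: "rball 0 = {}"
  by (auto simp: rball_def)

lemma open_rball [simp, intro]: "open (rball v :: 'a::euclidean_space set)"
proof (cases "v = \<top>")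
  case False
  then have "v < \<top>" by (simp add: less_top)
  then show ?thesis by (rule rball_finite[where 'a='a]) simp
qed simp

lemma sets_rball [measurable, simp]: "rball v \<in> sets borel"
  by simp

lemma emeasure_rball [simp]: "emeasure lborel (rball v :: 'a::euclidean_space set) = v"
proof (cases "v = \<top>")
  case True then show ?thesis by (simp add: emeasure_lborel_UNIV)
next
  case False
  then have "v < \<top>" by (simp add: less_top)
  then show ?thesis by (rule rball_finite[where 'a='a]) simp
qed

lemma rball_mono: "v \<le> w \<Longrightarrow> rball v \<subseteq> rball w"
  by (auto simp: rball_def)

lemma rball_Int: "rball v \<inter> rball w = rball (min v w)"
  by (auto simp: rball_def)

lemma rball_radial: "(x::'a::euclidean_space)  \<in> rball v \<Longrightarrow> norm (y::'a) \<le> norm x \<Longrightarrow> y \<in> rball v"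
  unfolding rball_def mem_Collect_eq
  by (erule le_less_trans[rotated]) (auto intro!: emeasure_mono)

lemma rball_minus [simp]: "- x \<in> rball v \<longleftrightarrow> x \<in> rball v"
  by (auto simp: rball_def)

lemma rball_minus_commute: "x - y \<in> rball v \<longleftrightarrow> y - x \<in> rball v"
  using rball_minus[of "x - y" v] by simp

lemma rball_emeasure_ball [simp]:
  "0 \<le> r \<Longrightarrow> rball (emeasure lborel (ball 0 r :: 'a set)) = (ball 0 r :: 'a::euclidean_space set)"
  by (auto simp: rball_def emeasure_lborel_ball_mono_iff)

lemma rball_in_ball:
  fixes S :: "'a::euclidean_space set"
  assumes "S \<subseteq> ball 0 R" "0 \<le> R"
  shows "(rball (emeasure lborel S) :: 'a::euclidean_space set) \<subseteq> ball (0::'a) R"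
proof -
  have "emeasure lborel S \<le> emeasure lborel (ball 0 R :: 'a set)"
    by (rule emeasure_mono[OF assms(1)]) simp
  from rball_mono[OF this, where 'a='a] show ?thesis using assms by simp
qed

lemma rball_UN_incseq:
  assumes "incseq v"
  shows "(\<Union>n. rball (v n)) = rball (SUP n. v n)"
  by (auto simp: rball_def less_SUP_iff)

text \<open>If \<open>S\<close> lay inside the open ball of radius \<open>norm x\<close>, its volume
  would be at most that of this ball; hence some point of \<open>S\<close> is at least as far out as
  \<open>x\<close>. The two sets can differ by a boundary sphere, which is a null set.\<close>

lemma radial_set_rball:
  fixes S :: "'a::euclidean_space set"
  assumes [measurable]: "S \<in> sets borel" and S: "\<And>x y. x \<in> S \<Longrightarrow> norm y \<le> norm x \<Longrightarrow> y \<in> S"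
  shows "rball (emeasure lborel S) \<subseteq> S" "emeasure lborel (S - rball (emeasure lborel S)) = 0"
proof -
  show *: "rball (emeasure lborel S) \<subseteq> S"
  proof
    fix x :: 'a assume "x \<in> rball (emeasure lborel S)"
    then have "\<not> S \<subseteq> ball 0 (norm x)"
      using emeasure_mono[of S "ball 0 (norm x)" lborel] unfolding rball_def by (auto simp: not_le[symmetric])
    then obtain p where "p \<in> S" "p \<notin> ball 0 (norm x)" by blast
    then have "norm x \<le> norm p" "p \<in> S" by (auto simp: not_less)
    with S show "x \<in> S" by blast
  qed
  show "emeasure lborel (S - rball (emeasure lborel S)) = 0"
  proof (cases "emeasure lborel S = \<top>")
    case True then show ?thesis by simp
  next
    case False
    then show ?thesis using * by (subst emeasure_Diff) auto
  qed
qed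

text \<open>A superlevel set is the preimage under the norm of its trace on a ray, and that trace is
  an interval.\<close>

lemma radially_decreasing_measurable:
  fixes G :: "'a::euclidean_space \<Rightarrow> ennreal"
  assumes "radially_decreasing G"
  shows "G \<in> borel_measurable borel"
proof (rule borel_measurableI_greater)
  fix y
  let ?S = "{x \<in> space borel. y < G x}"
  have R: "\<And>a b. a \<in> ?S \<Longrightarrow> norm b \<le> norm a \<Longrightarrow> b \<in> ?S"
    using radially_decreasingD[OF assms] less_le_trans by fastforce
  obtain e :: 'a where e: "e \<in> Basis" using nonempty_Basis by blast
  have N: "norm e = 1" using e by simp
  define T where "T = {r. 0 \<le> r \<and> r *\<^sub>R e \<in> ?S}"
  have "is_interval T"
    unfolding is_interval_1
  proof (intro ballI allI impI)
    fix a b x assume "a \<in> T" "b \<in> T" "a \<le> x \<and> x \<le> b"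
    then have "0 \<le> x" "x \<le> b" "b *\<^sub>R e \<in> ?S" "0 \<le> b" by (auto simp: T_def)
    then show "x \<in> T" using R[of "b *\<^sub>R e" "x *\<^sub>R e"] N by (auto simp: T_def)
  qed
  then have "T \<in> sets borel" by (rule real_interval_borel_measurable) 
  then have "norm -` T \<inter> space borel \<in> sets (borel::'a measure)"
    by (intro measurable_sets[of norm borel borel]) auto
  moreover have "norm -` T \<inter> space borel = ?S"
  proof (intro equalityI subsetI)
    fix x :: 'a assume "x \<in> norm -` T \<inter> space borel"
    then show "x \<in> ?S" using R[of "norm x *\<^sub>R e" x] N by (simp add: T_def)
  next
    fix x :: 'a assume "x \<in> ?S"
    then show "x \<in> norm -` T \<inter> space borel" using R[of x "norm x *\<^sub>R e"] N by (simp add: T_def)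
  qed
  ultimately show "?S \<in> sets borel" by simp
qed

text \<open>Lebesgue measure on the positive half-line, the parameter space of layer cake
  decompositions.\<close>

definition levels :: "real measure" where
  "levels = density lborel (indicator {0<..})"

lemma sets_levels [simp, measurable_cong]: "sets levels = sets borel"
  and space_levels [simp]: "space levels = UNIV"
  by (auto simp: levels_def)

interpretation levels: sigma_finite_measure levels
  unfolding levels_def
  by (subst sigma_finite_measure.sigma_finite_iff_density_finite[OF sigma_finite_lborel]) (auto simp: indicator_def)

lemma AE_levels: "AE s in levels. 0 < s"
  unfolding levels_def by (subst AE_density) (auto split: split_indicator)

text \<open>\<open>ennreal\<close> sends all negative levels to 0, so only the restriction of
  \<open>levels\<close> to positive numbers makes the integral equal to \<open>x\<close>.\<close>

lemma nn_integral_levels_indicator: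
  "(\<integral>\<^sup>+ s. indicator {s. ennreal s < x} s \<partial>levels) = x"
proof -
  have [measurable]: "{s. ennreal s < x} \<in> sets borel" by measurable
  have "(\<integral>\<^sup>+ s. indicator {s. ennreal s < x} s \<partial>levels) =
      (\<integral>\<^sup>+ s. indicator {0<..} s * indicator {s. ennreal s < x} s \<partial>lborel)"
    unfolding levels_def by (subst nn_integral_density) auto
  also have "\<dots> = (\<integral>\<^sup>+ s. indicator ({0<..} \<inter> {s. ennreal s < x}) s \<partial>lborel)"
    by (intro nn_integral_cong) (simp only: indicator_inter_arith)
  also have "\<dots> = emeasure lborel ({0<..} \<inter> {s. ennreal s < x})"
    by (rule nn_integral_indicator) simp
  also have "\<dots> = x"
  proof (cases x)
    case (real r)
    have "{0<..} \<inter> {s. ennreal s < x} = {0<..<r}" using real by (auto simp: ennreal_less_iff)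
    then show ?thesis using real by simp
  next
    case top
    then have "{0<..} \<inter> {s. ennreal s < x} = {0<..}" by auto
    moreover have "emeasure lborel {0::real<..} = \<top>"
    proof (rule ccontr)
      assume *: "emeasure lborel {0::real<..} \<noteq> \<top>"
      then obtain r where r: "emeasure lborel {0::real<..} = ennreal r" "0 \<le> r" by (cases "emeasure lborel {0::real<..}") auto
      have "ennreal (r + 1) = emeasure lborel {0<..<r+1}" using r by simp
      also have "\<dots> \<le> emeasure lborel {0::real<..}" by (rule emeasure_mono) auto
      finally show False using r by (simp add: ennreal_le_iff2)
    qed
    ultimately show ?thesis using top by simp
  qed
  finally show ?thesis .
qed

text \<open>The weight allows one factor of a product to be decomposed into layers while the other
  factors stay in place.\<close>

lemma layer_cake_weighted:
  assumes "sigma_finite_measure M" and [measurable]: "h \<in> borel_measurable M" "w \<in> borel_measurable M"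
  shows "(\<integral>\<^sup>+ x. w x * h x \<partial>M) = (\<integral>\<^sup>+ s. \<integral>\<^sup>+ x. w x * indicator {x. ennreal s < h x} x \<partial>M \<partial>levels)"
proof -
  interpret M: sigma_finite_measure M by fact
  interpret pair_sigma_finite M levels ..
  have "(\<integral>\<^sup>+ x. w x * h x \<partial>M) = (\<integral>\<^sup>+ x. \<integral>\<^sup>+ s. w x * indicator {x. ennreal s < h x} x \<partial>levels \<partial>M)"
  proof (rule nn_integral_cong)
    fix x
    have "w x * h x = w x * (\<integral>\<^sup>+ s. indicator {s. ennreal s < h x} s \<partial>levels)"
      by (simp add: nn_integral_levels_indicator)
    also have "\<dots> = (\<integral>\<^sup>+ s. w x * indicator {s. ennreal s < h x} s \<partial>levels)"
      by (subst nn_integral_cmult) auto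
    also have "\<dots> = (\<integral>\<^sup>+ s. w x * indicator {x. ennreal s < h x} x \<partial>levels)"
      by (intro nn_integral_cong) (auto split: split_indicator)
    finally show "w x * h x = \<dots>" .
  qed
  also have "\<dots> = (\<integral>\<^sup>+ s. \<integral>\<^sup>+ x. w x * indicator {x. ennreal s < h x} x \<partial>M \<partial>levels)"
    unfolding indicator_def by (rule Fubini'[symmetric]) measurable
  finally show ?thesis .
qed

lemma layer_cake:
  assumes "sigma_finite_measure M" and [measurable]: "h \<in> borel_measurable M"
  shows "(\<integral>\<^sup>+ x. h x \<partial>M) = (\<integral>\<^sup>+ s. emeasure M {x \<in> space M. ennreal s < h x} \<partial>levels)"
proof -
  have "(\<integral>\<^sup>+ x. h x \<partial>M) = (\<integral>\<^sup>+ s. \<integral>\<^sup>+ x. 1 * indicator {x. ennreal s < h x} x \<partial>M \<partial>levels)"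
    using layer_cake_weighted[OF assms, of "\<lambda>_. 1"] by simp
  also have "\<dots> = (\<integral>\<^sup>+ s. emeasure M {x \<in> space M. ennreal s < h x} \<partial>levels)"
  proof (rule nn_integral_cong)
    fix s
    have "(\<integral>\<^sup>+ x. 1 * indicator {x. ennreal s < h x} x \<partial>M) = (\<integral>\<^sup>+ x. indicator {x \<in> space M. ennreal s < h x} x \<partial>M)"
      by (intro nn_integral_cong) (auto split: split_indicator)
    also have "\<dots> = emeasure M {x \<in> space M. ennreal s < h x}"
      by (subst nn_integral_indicator) auto
    finally show "(\<integral>\<^sup>+ x. 1 * indicator {x. ennreal s < h x} x \<partial>M) = \<dots>" .
  qed
  finally show ?thesis .
qed

section \<open>The Riesz rearrangement inequality\<close>

lemma nn_integral_lborel_translate: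
  fixes f :: "'a::euclidean_space \<Rightarrow> ennreal"
  assumes [measurable]: "f \<in> borel_measurable borel"
  shows "(\<integral>\<^sup>+ x. f (c + x) \<partial>lborel) = (\<integral>\<^sup>+ x. f x \<partial>lborel)"
  by (subst (2) lborel_distr_plus[of c, symmetric]) (simp add: nn_integral_distr)

lemma lborel_distr_uminus': "distr lborel borel uminus = (lborel :: 'a::euclidean_space measure)"
  by (subst lborel_affine[of "-1" 0]) (auto simp: density_1 one_ennreal_def[symmetric])

lemma nn_integral_lborel_reflect:
  fixes f :: "'a::euclidean_space \<Rightarrow> ennreal"
  assumes [measurable]: "f \<in> borel_measurable borel"
  shows "(\<integral>\<^sup>+ x. f (c - x) \<partial>lborel) = (\<integral>\<^sup>+ x. f x \<partial>lborel)"
proof -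
  have "(\<integral>\<^sup>+ x. f (c - x) \<partial>lborel) = (\<integral>\<^sup>+ x. f (c + x) \<partial>distr lborel borel uminus)"
    by (subst nn_integral_distr) auto
  then show ?thesis by (simp add: lborel_distr_uminus' nn_integral_lborel_translate)
qed

lemma emeasure_lborel_reflect:
  fixes S :: "'a::euclidean_space set"
  assumes [measurable]: "S \<in> sets borel"
  shows "emeasure lborel {x. c - x \<in> S} = emeasure lborel S"
proof -
  have "emeasure lborel S = (\<integral>\<^sup>+ x. indicator S (c - x) \<partial>lborel)"
    by (subst nn_integral_lborel_reflect) auto
  also have "\<dots> = (\<integral>\<^sup>+ x. indicator {x. c - x \<in> S} x \<partial>lborel)"
    by (intro nn_integral_cong) (auto split: split_indicator)
  also have "\<dots> = emeasure lborel {x. c - x \<in> S}"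
    by (subst nn_integral_indicator) auto
  finally show ?thesis by simp
qed

lemma emeasure_lborel_translate:
  fixes S :: "'a::euclidean_space set"
  assumes [measurable]: "S \<in> sets borel"
  shows "emeasure lborel {x. c + x \<in> S} = emeasure lborel S"
proof -
  have "emeasure lborel S = (\<integral>\<^sup>+ x. indicator S (c + x) \<partial>lborel)"
    by (subst nn_integral_lborel_translate) auto
  also have "\<dots> = (\<integral>\<^sup>+ x. indicator {x. c + x \<in> S} x \<partial>lborel)"
    by (intro nn_integral_cong) (auto split: split_indicator)
  also have "\<dots> = emeasure lborel {x. c + x \<in> S}"
    by (subst nn_integral_indicator) auto
  finally show ?thesis by simp
qed

lemma nn_integral_lborel_shear:
  fixes f :: "'a::euclidean_space \<Rightarrow> 'a \<Rightarrow> ennreal"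
  assumes [measurable]: "case_prod f \<in> borel_measurable (borel \<Otimes>\<^sub>M borel)"
  shows "(\<integral>\<^sup>+ x. \<integral>\<^sup>+ y. f x y \<partial>lborel \<partial>lborel) = (\<integral>\<^sup>+ s. \<integral>\<^sup>+ x. f x (s - x) \<partial>lborel \<partial>lborel)"
proof -
  have "(\<integral>\<^sup>+ x. \<integral>\<^sup>+ y. f x y \<partial>lborel \<partial>lborel) = (\<integral>\<^sup>+ x. \<integral>\<^sup>+ s. f x (s - x) \<partial>lborel \<partial>lborel)"
  proof (rule nn_integral_cong)
    fix x :: 'a
    show "(\<integral>\<^sup>+ y. f x y \<partial>lborel) = (\<integral>\<^sup>+ s. f x (s - x) \<partial>lborel)"
      using nn_integral_lborel_translate[of "f x" "- x"] by (simp add: add.commute)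
  qed
  also have "\<dots> = (\<integral>\<^sup>+ s. \<integral>\<^sup>+ x. f x (s - x) \<partial>lborel \<partial>lborel)"
    by (rule lborel_pair.Fubini'[symmetric]) measurable
  finally show ?thesis .
qed

text \<open>The convolution of the indicators of \<open>A\<close> and \<open>B\<close>, integrated
  over \<open>C\<close>. Reflecting \<open>B\<close> gives the more common form with a difference;
  centred balls do not notice the reflection.\<close>

definition riesz :: "'a::euclidean_space set \<Rightarrow> 'a set \<Rightarrow> 'a set \<Rightarrow> ennreal" where
  "riesz A B C = (\<integral>\<^sup>+ x. \<integral>\<^sup>+ y. indicator A x * indicator B y * indicator C (x + y) \<partial>lborel \<partial>lborel)"

lemma riesz_mono: "A \<subseteq> A' \<Longrightarrow> B \<subseteq> B' \<Longrightarrow> C \<subseteq> C' \<Longrightarrow> riesz A B C \<le> riesz A' B' C'"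
  unfolding riesz_def by (intro nn_integral_mono mult_mono) (auto split: split_indicator)

context
  fixes A B C :: "'a::euclidean_space set"
  assumes [measurable]: "A \<in> sets borel" "B \<in> sets borel" "C \<in> sets borel"
begin

lemma riesz_shear:
  "riesz A B C = (\<integral>\<^sup>+ s. \<integral>\<^sup>+ x. indicator A x * indicator B (s - x) * indicator C s \<partial>lborel \<partial>lborel)"
  unfolding riesz_def by (subst nn_integral_lborel_shear) (auto intro!: nn_integral_cong)

lemma riesz_commute: "riesz A B C = riesz B A C"
  unfolding riesz_def
  by (subst lborel_pair.Fubini') (auto simp: add.commute mult.commute mult.left_commute intro!: nn_integral_cong)

lemma riesz_le_prod: "riesz A B C \<le> emeasure lborel A * emeasure lborel B"
proof -
  have "riesz A B C \<le> (\<integral>\<^sup>+ x. \<integral>\<^sup>+ y. indicator A x * indicator B y \<partial>lborel \<partial>lborel)"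
    unfolding riesz_def by (intro nn_integral_mono) (auto split: split_indicator)
  also have "\<dots> = emeasure lborel A * emeasure lborel B"
    by (simp add: nn_integral_cmult nn_integral_multc)
  finally show ?thesis .
qed

lemma riesz_le_prod_right: "riesz A B C \<le> emeasure lborel A * emeasure lborel C"
proof -
  have "riesz A B C \<le> (\<integral>\<^sup>+ s. \<integral>\<^sup>+ x. indicator A x * indicator C s \<partial>lborel \<partial>lborel)"
    unfolding riesz_shear by (intro nn_integral_mono) (auto split: split_indicator)
  also have "\<dots> = emeasure lborel A * emeasure lborel C"
    by (simp add: nn_integral_cmult nn_integral_multc)
  finally show ?thesis .
qed

lemma riesz_eq_prod:
  assumes "\<And>x y. x \<in> A \<Longrightarrow> y \<in> B \<Longrightarrow> x + y \<in> C"
  shows "riesz A B C = emeasure lborel A * emeasure lborel B"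
proof -
  have "riesz A B C = (\<integral>\<^sup>+ x. \<integral>\<^sup>+ y. indicator A x * indicator B y \<partial>lborel \<partial>lborel)"
    unfolding riesz_def using assms by (intro nn_integral_cong) (auto split: split_indicator)
  also have "\<dots> = emeasure lborel A * emeasure lborel B"
    by (simp add: nn_integral_cmult nn_integral_multc)
  finally show ?thesis .
qed

lemma riesz_eq_prod_right:
  assumes "\<And>x s. x \<in> A \<Longrightarrow> s \<in> C \<Longrightarrow> s - x \<in> B"
  shows "riesz A B C = emeasure lborel A * emeasure lborel C"
proof -
  have "riesz A B C = (\<integral>\<^sup>+ s. \<integral>\<^sup>+ x. indicator A x * indicator C s \<partial>lborel \<partial>lborel)"
    unfolding riesz_shear using assms by (intro nn_integral_cong) (auto split: split_indicator)
  also have "\<dots> = emeasure lborel A * emeasure lborel C"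
    by (simp add: nn_integral_cmult nn_integral_multc)
  finally show ?thesis .
qed

end

section \<open>The Riesz inequality on the line\<close>

text \<open>Lebesgue measure restricted to \<open>A\<close> has no atoms, so its distribution
  function is continuous and the intermediate value theorem applies.\<close>

lemma emeasure_cut_real:
  fixes A :: "real set"
  assumes [measurable]: "A \<in> sets borel" and t: "0 < t" "ennreal t < emeasure lborel A"
    and fin: "emeasure lborel A < \<top>"
  obtains a where "emeasure lborel (A \<inter> {..a}) = ennreal t"
proof -
  define M where "M = density lborel (indicator A :: real \<Rightarrow> ennreal)"
  have em: "emeasure M S = emeasure lborel (A \<inter> S)" if "S \<in> sets borel" for S
    using that unfolding M_def
    by (subst emeasure_density) (auto simp: nn_integral_indicator[symmetric] indicator_inter_arith simp del: nn_integral_indicator)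
  have "emeasure M (space M) = emeasure lborel A" using em[of UNIV] by (simp add: M_def)
  then interpret finite_measure M using fin by (intro finite_measureI) auto
  interpret finite_borel_measure M by unfold_locales (simp add: M_def)
  have null: "measure M {x} = 0" for x
  proof -
    have "emeasure M {x} \<le> emeasure lborel {x}" unfolding em[of "{x}", simplified] by (rule emeasure_mono) auto
    then show ?thesis by (simp add: measure_def)
  qed
  then have "isCont (cdf M) x" for x by (simp add: isCont_cdf)
  then have cont: "continuous_on UNIV (cdf M)" by (simp add: continuous_at_imp_continuous_on)
  have sp: "measure M (space M) = measure lborel A" using em[of UNIV] by (simp add: measure_def M_def)
  have "emeasure lborel A = ennreal (measure lborel A)"
    using fin by (simp add: emeasure_eq_ennreal_measure less_top)
  then have t': "t < measure lborel A" using t by (simp add: ennreal_less_iff)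
  have "\<forall>\<^sub>F x in at_bot. cdf M x < t"
    using cdf_lim_at_bot t(1) by (rule order_tendstoD)
  then obtain l where l: "cdf M l < t" by (auto simp: eventually_at_bot_linorder)
  have "\<forall>\<^sub>F x in at_top. t < cdf M x"
    using cdf_lim_at_top t' unfolding sp by (rule order_tendstoD)
  then obtain u where u: "t < cdf M u" by (auto simp: eventually_at_top_linorder)
  have "l \<le> u" using cdf_nondecreasing[of u l] l u by linarith
  then obtain a where "cdf M a = t"
    using IVT'[of "cdf M" l t u] l u continuous_on_subset[OF cont] by auto
  then have "emeasure M {..a} = ennreal t" by (simp add: cdf_def emeasure_eq_measure)
  then show thesis using em[of "{..a}"] that by simp
qed

lemma rball_real: "0 \<le> a \<Longrightarrow> rball (ennreal a) = {- (a/2) <..< a/2 :: real}"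
proof -
  assume "0 \<le> a"
  then have "ennreal a = emeasure lborel (ball 0 (a/2) :: real set)"
    by (simp add: ball_eq_greaterThanLessThan)
  moreover have "rball (emeasure lborel (ball 0 (a/2) :: real set)) = (ball 0 (a/2) :: real set)"
    using \<open>0 \<le> a\<close> by (intro rball_emeasure_ball) simp
  ultimately show ?thesis by (simp only:) (simp add: ball_eq_greaterThanLessThan)
qed

text \<open>Both the upper bound for general sets and its equality for centred intervals come from the
  same decomposition: cut off the left part of \<open>A\<close> and the right part of \<open>B\<close>.\<close>

lemma riesz_cut:
  fixes A B C :: "real set" and a b :: real
  assumes [measurable]: "A \<in> sets borel" "B \<in> sets borel" "C \<in> sets borel"
  shows "riesz A B C = riesz (A \<inter> {a<..}) (B \<inter> {..b}) C +
    (\<integral>\<^sup>+ s. emeasure lborel {x. x \<in> A \<and> s - x \<in> B \<and> (x \<le> a \<or> b < s - x)} * indicator C s \<partial>lborel)"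
proof -
  have "riesz A B C = (\<integral>\<^sup>+ s. (\<integral>\<^sup>+ x. indicator (A \<inter> {a<..}) x * indicator (B \<inter> {..b}) (s - x) * indicator C s \<partial>lborel) +
      (\<integral>\<^sup>+ x. indicator {x. x \<in> A \<and> s - x \<in> B \<and> (x \<le> a \<or> b < s - x)} x * indicator C s \<partial>lborel) \<partial>lborel)"
    unfolding riesz_shear[OF assms]
    by (intro nn_integral_cong, subst nn_integral_add[symmetric])
       (auto intro!: nn_integral_cong split: split_indicator)
  also have "\<dots> = riesz (A \<inter> {a<..}) (B \<inter> {..b}) C +
      (\<integral>\<^sup>+ s. \<integral>\<^sup>+ x. indicator {x. x \<in> A \<and> s - x \<in> B \<and> (x \<le> a \<or> b < s - x)} x * indicator C s \<partial>lborel \<partial>lborel)"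
    by (subst riesz_shear, simp, simp, simp, subst nn_integral_add[symmetric]) (auto simp: indicator_def)
  also have "(\<integral>\<^sup>+ s. \<integral>\<^sup>+ x. indicator {x. x \<in> A \<and> s - x \<in> B \<and> (x \<le> a \<or> b < s - x)} x * indicator C s \<partial>lborel \<partial>lborel) =
     (\<integral>\<^sup>+ s. emeasure lborel {x. x \<in> A \<and> s - x \<in> B \<and> (x \<le> a \<or> b < s - x)} * indicator C s \<partial>lborel)"
    by (intro nn_integral_cong, subst nn_integral_multc) (auto)
  finally show ?thesis .
qed

lemma riesz_upper:
  fixes A B C :: "real set"
  assumes [measurable]: "A \<in> sets borel" "B \<in> sets borel" "C \<in> sets borel"
    and A: "emeasure lborel A = ennreal \<alpha>" and B: "emeasure lborel B = ennreal \<beta>"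
    and t: "0 < t" "t < \<alpha>" "t < \<beta>"
  shows "riesz A B C \<le> ennreal (\<alpha> - t) * ennreal (\<beta> - t) + ennreal t * emeasure lborel C"
proof -
  obtain a where a: "emeasure lborel (A \<inter> {..a}) = ennreal t"
    using emeasure_cut_real[of A t] A t by (auto simp: ennreal_less_iff)
  obtain b where b: "emeasure lborel (B \<inter> {..b}) = ennreal (\<beta> - t)"
    using emeasure_cut_real[of B "\<beta> - t"] B t by (auto simp: ennreal_less_iff)
  have "A \<inter> {a<..} = A - (A \<inter> {..a})" by auto
  then have a1: "emeasure lborel (A \<inter> {a<..}) = ennreal (\<alpha> - t)"
    using t by (simp only:) (subst emeasure_Diff, auto simp: a A ennreal_minus)
  have "B \<inter> {b<..} = B - (B \<inter> {..b})" by auto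
  then have b1: "emeasure lborel (B \<inter> {b<..}) = ennreal t"
    using t by (simp only:) (subst emeasure_Diff, auto simp: b B ennreal_minus)
  \<comment> \<open>The conditions \<open>x \<le> a\<close> and \<open>x < s - b\<close> describe
    nested half-lines, so the larger one alone contains the set, and either one cuts off only a
    piece of length \<open>t\<close>.\<close>
  have half_line: "emeasure lborel {x. x \<in> A \<and> s - x \<in> B \<and> (x \<le> a \<or> b < s - x)} \<le> ennreal t" for s
  proof (cases "s - b \<le> a")
    case True
    then have "emeasure lborel {x. x \<in> A \<and> s - x \<in> B \<and> (x \<le> a \<or> b < s - x)} \<le> emeasure lborel (A \<inter> {..a})"
      by (intro emeasure_mono) auto
    then show ?thesis using a by simp
  next
    case False
    then have "emeasure lborel {x. x \<in> A \<and> s - x \<in> B \<and> (x \<le> a \<or> b < s - x)} \<le> emeasure lborel {x. s - x \<in> B \<inter> {b<..}}"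
      by (intro emeasure_mono) auto
    then show ?thesis using emeasure_lborel_reflect[of "B \<inter> {b<..}" s] by (simp add: b1)
  qed
  have "riesz A B C \<le> emeasure lborel (A \<inter> {a<..}) * emeasure lborel (B \<inter> {..b}) + (\<integral>\<^sup>+ s. ennreal t * indicator C s \<partial>lborel)"
    unfolding riesz_cut[OF assms(1-3), of a b]
    by (intro add_mono riesz_le_prod nn_integral_mono mult_right_mono half_line) auto
  then show ?thesis by (simp add: a1 b nn_integral_cmult)
qed

text \<open>This \<open>t\<close> makes the lengths of the trimmed intervals add up to
  \<open>\<gamma>\<close>. Sums of their points then fall into the third interval, and both
  estimates used in \<open>riesz_upper\<close> are attained.\<close>

lemma riesz_intervals:
  fixes \<alpha> \<beta> \<gamma> :: real
  defines "t \<equiv> (\<alpha> + \<beta> - \<gamma>) / 2"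
  assumes t: "0 < t" "t < \<alpha>" "t < \<beta>" and g: "0 \<le> \<gamma>"
  shows "ennreal (\<alpha> - t) * ennreal (\<beta> - t) + ennreal t * ennreal \<gamma>
    \<le> riesz {-(\<alpha>/2)<..<\<alpha>/2} {-(\<beta>/2)<..<\<beta>/2} {-(\<gamma>/2)<..<\<gamma>/2}"
proof -
  let ?A = "{-(\<alpha>/2)<..<\<alpha>/2}" and ?B = "{-(\<beta>/2)<..<\<beta>/2}" and ?C = "{-(\<gamma>/2)<..<\<gamma>/2}"
  define a where "a = t - \<alpha>/2"
  define b where "b = \<beta>/2 - t"
  have gt: "\<gamma> = \<alpha> + \<beta> - 2 * t" by (simp add: t_def field_simps)
  have 1: "?A \<inter> {a<..} = {a<..<\<alpha>/2}" "?B \<inter> {..b} = {-(\<beta>/2)<..b}"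
    using t by (auto simp: a_def b_def)
  have "riesz (?A \<inter> {a<..}) (?B \<inter> {..b}) ?C = emeasure lborel (?A \<inter> {a<..}) * emeasure lborel (?B \<inter> {..b})"
    using t by (intro riesz_eq_prod) (auto simp: a_def b_def gt field_simps)
  also have "\<dots> = ennreal (\<alpha> - t) * ennreal (\<beta> - t)"
    unfolding 1 using t by (simp add: a_def b_def) 
  finally have p1: "riesz (?A \<inter> {a<..}) (?B \<inter> {..b}) ?C = ennreal (\<alpha> - t) * ennreal (\<beta> - t)" .
  have *: "ennreal t \<le> emeasure lborel {x. x \<in> ?A \<and> s - x \<in> ?B \<and> (x \<le> a \<or> b < s - x)}" if "s \<in> ?C" for s
  proof (cases "s - b \<le> a")
    case True
    have "ennreal t = emeasure lborel {-(\<alpha>/2)<..<a}" using t by (simp add: a_def)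
    also have "\<dots> \<le> emeasure lborel {x. x \<in> ?A \<and> s - x \<in> ?B \<and> (x \<le> a \<or> b < s - x)}"
      using that True t by (intro emeasure_mono) (auto simp: a_def b_def gt field_simps)
    finally show ?thesis .
  next
    case False
    have "ennreal t = emeasure lborel {s - \<beta>/2<..<s - b}" using t by (simp add: b_def)
    also have "\<dots> \<le> emeasure lborel {x. x \<in> ?A \<and> s - x \<in> ?B \<and> (x \<le> a \<or> b < s - x)}"
      using that False t by (intro emeasure_mono) (auto simp: a_def b_def gt field_simps)
    finally show ?thesis .
  qed
  have "ennreal t * ennreal \<gamma> = (\<integral>\<^sup>+ s. ennreal t * indicator ?C s \<partial>lborel)"
    using g by (simp add: nn_integral_cmult)
  also have "\<dots> \<le> (\<integral>\<^sup>+ s. emeasure lborel {x. x \<in> ?A \<and> s - x \<in> ?B \<and> (x \<le> a \<or> b < s - x)} * indicator ?C s \<partial>lborel)"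
    using * by (intro nn_integral_mono) (auto split: split_indicator)
  finally show ?thesis
    by (subst riesz_cut[of _ _ _ a b]) (auto simp: p1 simp del: greaterThanLessThan_iff)
qed

lemma riesz_real:
  fixes A B C :: "real set"
  assumes [measurable]: "A \<in> sets borel" "B \<in> sets borel" "C \<in> sets borel"
    and fin: "emeasure lborel A < \<top>" "emeasure lborel B < \<top>" "emeasure lborel C < \<top>"
  shows "riesz A B C \<le> riesz (rball (emeasure lborel A)) (rball (emeasure lborel B)) (rball (emeasure lborel C) :: real set)"
proof -
  have real: "\<exists>r. v = ennreal r \<and> 0 \<le> r" if "v < \<top>" for v
    using that by (cases v) auto
  obtain \<alpha> \<beta> \<gamma> where A: "emeasure lborel A = ennreal \<alpha>" "0 \<le> \<alpha>" and B: "emeasure lborel B = ennreal \<beta>" "0 \<le> \<beta>"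
    and C: "emeasure lborel C = ennreal \<gamma>" "0 \<le> \<gamma>"
    using real[OF fin(1)] real[OF fin(2)] real[OF fin(3)] by blast
  let ?A = "{-(\<alpha>/2)<..<\<alpha>/2}" and ?B = "{-(\<beta>/2)<..<\<beta>/2}" and ?C = "{-(\<gamma>/2)<..<\<gamma>/2}"
  have "riesz A B C \<le> riesz ?A ?B ?C"
  proof -
    \<comment> \<open>When one length is at least the sum of the other two, the intervals attain a
      trivial product bound. The last case says exactly that
      \<open>(\<alpha> + \<beta> - \<gamma>) / 2\<close> is positive and below both
      \<open>\<alpha>\<close> and \<open>\<beta>\<close>.\<close>
    consider "\<alpha> + \<beta> \<le> \<gamma>" | "\<alpha> + \<gamma> \<le> \<beta>" | "\<beta> + \<gamma> \<le> \<alpha>" | "\<gamma> < \<alpha> + \<beta>" "\<beta> < \<alpha> + \<gamma>" "\<alpha> < \<beta> + \<gamma>"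
      by linarith
    then show ?thesis
    proof cases
      case 1
      have "riesz ?A ?B ?C = ennreal \<alpha> * ennreal \<beta>"
        using 1 A B by (subst riesz_eq_prod) auto
      then show ?thesis using riesz_le_prod[of A B C] A B by simp
    next
      case 2
      have "riesz ?A ?B ?C = ennreal \<alpha> * ennreal \<gamma>"
        using 2 A C by (subst riesz_eq_prod_right) auto
      then show ?thesis using riesz_le_prod_right[of A B C] A C by simp
    next
      case 3
      have "riesz ?A ?B ?C = ennreal \<beta> * ennreal \<gamma>"
        using 3 B C by (subst riesz_commute, simp, simp, simp, subst riesz_eq_prod_right) auto
      then show ?thesis using riesz_le_prod_right[of B A C] B C by (simp add: riesz_commute[of A B])
    next
      case 4
      then show ?thesis
        using order_trans[OF riesz_upper[OF assms(1-3) A(1) B(1), of "(\<alpha> + \<beta> - \<gamma>) / 2"], of "riesz ?A ?B ?C"]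
          riesz_intervals[of \<alpha> \<beta> \<gamma>] C by simp
    qed
  qed
  moreover have "rball (emeasure lborel A) = ?A" unfolding A(1) by (rule rball_real) (rule A(2))
  moreover have "rball (emeasure lborel B) = ?B" unfolding B(1) by (rule rball_real) (rule B(2))
  moreover have "rball (emeasure lborel C) = ?C" unfolding C(1) by (rule rball_real) (rule C(2))
  ultimately show ?thesis by (simp only:)
qed

section \<open>Steiner symmetrization along a coordinate axis\<close>

lemma nn_integral_lborel_slices:
  fixes f :: "'a::euclidean_space \<Rightarrow> ennreal" and b0 :: 'a
  assumes [measurable]: "f \<in> borel_measurable borel" and b0: "b0 \<in> Basis"
  shows "(\<integral>\<^sup>+ x. f x \<partial>lborel) =
    (\<integral>\<^sup>+ y. \<integral>\<^sup>+ s. f (s *\<^sub>R b0 + (\<Sum>b\<in>Basis - {b0}. y b *\<^sub>R b)) \<partial>lborel \<partial>(\<Pi>\<^sub>M b\<in>Basis - {b0}. lborel))"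
proof -
  interpret product_sigma_finite "\<lambda>_::'a. lborel :: real measure"
    by standard
  have ins: "Basis = insert b0 (Basis - {b0})" using b0 by auto
  have "(\<integral>\<^sup>+ x. f x \<partial>lborel) = (\<integral>\<^sup>+ y. f (\<Sum>b\<in>Basis. y b *\<^sub>R b) \<partial>(\<Pi>\<^sub>M b\<in>Basis. lborel))"
    by (subst lborel_eq) (simp add: nn_integral_distr)
  also have "\<dots> = (\<integral>\<^sup>+ y. f (\<Sum>b\<in>Basis. y b *\<^sub>R b) \<partial>(\<Pi>\<^sub>M b\<in>insert b0 (Basis - {b0}). lborel))"
    using ins by simp
  also have "\<dots> = (\<integral>\<^sup>+ y. \<integral>\<^sup>+ s. f (\<Sum>b\<in>Basis. (y(b0 := s)) b *\<^sub>R b) \<partial>lborel \<partial>(\<Pi>\<^sub>M b\<in>Basis - {b0}. lborel))"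
    by (subst product_nn_integral_insert) (use ins in auto)
  also have "\<dots> = (\<integral>\<^sup>+ y. \<integral>\<^sup>+ s. f (s *\<^sub>R b0 + (\<Sum>b\<in>Basis - {b0}. y b *\<^sub>R b)) \<partial>lborel \<partial>(\<Pi>\<^sub>M b\<in>Basis - {b0}. lborel))"
  proof (intro nn_integral_cong arg_cong[where f=f])
    fix y :: "'a \<Rightarrow> real" and s
    have "(\<Sum>b\<in>Basis. (y(b0 := s)) b *\<^sub>R b) = s *\<^sub>R b0 + (\<Sum>b\<in>Basis - {b0}. (y(b0 := s)) b *\<^sub>R b)"
      using b0 by (subst sum.remove[of _ b0]) auto
    also have "(\<Sum>b\<in>Basis - {b0}. (y(b0 := s)) b *\<^sub>R b) = (\<Sum>b\<in>Basis - {b0}. y b *\<^sub>R b)"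
      by (intro sum.cong) auto
    finally show "(\<Sum>b\<in>Basis. (y(b0 := s)) b *\<^sub>R b) = s *\<^sub>R b0 + (\<Sum>b\<in>Basis - {b0}. y b *\<^sub>R b)" .
  qed
  finally show ?thesis .
qed

definition slice :: "'a::euclidean_space \<Rightarrow> 'a set \<Rightarrow> 'a \<Rightarrow> real set" where
  "slice b A x = {s. s *\<^sub>R b + x \<in> A}"

text \<open>Meant for a unit vector \<open>b\<close>. Removing the component along \<open>b\<close>
  from \<open>x\<close> makes all points of one line refer to the same slice.\<close>

definition steiner :: "'a::euclidean_space \<Rightarrow> 'a set \<Rightarrow> 'a set" where
  "steiner b A = {x. x \<bullet> b \<in> rball (emeasure lborel (slice b A (x - (x \<bullet> b) *\<^sub>R b)))}"

lemma sets_slice [measurable]: "A \<in> sets borel \<Longrightarrow> slice b A x \<in> sets borel"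
  using measurable_sets[of "\<lambda>s. s *\<^sub>R b + x" borel borel A] by (simp add: slice_def vimage_def)

lemma emeasure_slice: "A \<in> sets borel \<Longrightarrow> emeasure lborel (slice b A x) = (\<integral>\<^sup>+ s. indicator A (s *\<^sub>R b + x) \<partial>lborel)"
proof -
  assume "A \<in> sets borel"
  then have "emeasure lborel (slice b A x) = (\<integral>\<^sup>+ s. indicator (slice b A x) s \<partial>lborel)"
    by (simp add: sets_slice)
  then show ?thesis by (simp add: slice_def indicator_def)
qed

lemma slice_steiner:
  assumes "b \<in> Basis" "x \<bullet> b = 0"
  shows "slice b (steiner b A) x = rball (emeasure lborel (slice b A x))"
  using assms by (simp add: slice_def steiner_def inner_add_left)

lemma sets_steiner [measurable]:
  assumes [measurable]: "A \<in> sets borel"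
  shows "steiner b A \<in> sets borel"
proof -
  have "{x. emeasure lborel (ball 0 (norm (x \<bullet> b)) :: real set) < (\<integral>\<^sup>+ s. indicator A (s *\<^sub>R b + (x - (x \<bullet> b) *\<^sub>R b)) \<partial>lborel)} \<in> sets borel"
    unfolding ball_eq_greaterThanLessThan by (simp add: emeasure_lborel_Ioo)
  then show ?thesis
    by (simp add: steiner_def rball_def emeasure_slice assms)
qed

context
  fixes b0 :: "'a::euclidean_space"
  assumes b0: "b0 \<in> Basis"
begin

abbreviation "hyp \<equiv> (\<Pi>\<^sub>M b\<in>Basis - {b0}. lborel :: real measure)"
abbreviation "emb y \<equiv> (\<Sum>b\<in>Basis - {b0}. y b *\<^sub>R b)"

lemma emb_inner: "emb y \<bullet> b0 = 0"
  using b0 by (auto simp: inner_sum_left inner_not_same_Basis intro!: sum.neutral)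

lemma emeasure_slices:
  assumes [measurable]: "A \<in> sets borel"
  shows "emeasure lborel A = (\<integral>\<^sup>+ y. emeasure lborel (slice b0 A (emb y)) \<partial>hyp)"
  by (subst nn_integral_indicator[symmetric], simp, subst nn_integral_lborel_slices[OF _ b0]) (simp_all add: emeasure_slice)

lemma emeasure_steiner:
  assumes [measurable]: "A \<in> sets borel"
  shows "emeasure lborel (steiner b0 A) = emeasure lborel A"
  by (subst (1 2) emeasure_slices) (simp_all add: slice_steiner b0 emb_inner)

lemma sigma_finite_hyp: "sigma_finite_measure hyp"
proof -
  interpret finite_product_sigma_finite "\<lambda>_. lborel :: real measure" "Basis - {b0}"
    by standard simp
  show ?thesis by (rule sigma_finite_measure_axioms)
qed

text \<open>The three sets are coupled by addition only, which acts separately along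
  \<open>b0\<close> and in the hyperplane; so the functional is an integral of one-dimensional
  functionals of slices.\<close>

lemma riesz_slices:
  assumes [measurable]: "A \<in> sets borel" "B \<in> sets borel" "C \<in> sets borel"
  shows "riesz A B C = (\<integral>\<^sup>+ x. \<integral>\<^sup>+ y. riesz (slice b0 A (emb x)) (slice b0 B (emb y)) (slice b0 C (emb x + emb y)) \<partial>hyp \<partial>hyp)"
proof -
  interpret hyp: sigma_finite_measure hyp by (rule sigma_finite_hyp)
  interpret P: pair_sigma_finite lborel hyp ..
  have "riesz A B C = (\<integral>\<^sup>+ x. \<integral>\<^sup>+ s. \<integral>\<^sup>+ y. \<integral>\<^sup>+ t. indicator A (s *\<^sub>R b0 + emb x) * indicator B (t *\<^sub>R b0 + emb y)
      * indicator C ((s *\<^sub>R b0 + emb x) + (t *\<^sub>R b0 + emb y)) \<partial>lborel \<partial>hyp \<partial>lborel \<partial>hyp)"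
    unfolding riesz_def
    by (subst nn_integral_lborel_slices[OF _ b0], measurable)
       (intro nn_integral_cong, subst nn_integral_lborel_slices[OF _ b0], auto)
  also have "\<dots> = (\<integral>\<^sup>+ x. \<integral>\<^sup>+ y. \<integral>\<^sup>+ s. \<integral>\<^sup>+ t. indicator A (s *\<^sub>R b0 + emb x) * indicator B (t *\<^sub>R b0 + emb y)
      * indicator C ((s *\<^sub>R b0 + emb x) + (t *\<^sub>R b0 + emb y)) \<partial>lborel \<partial>lborel \<partial>hyp \<partial>hyp)"
    by (intro nn_integral_cong P.Fubini'[symmetric]) measurable
  also have "\<dots> = (\<integral>\<^sup>+ x. \<integral>\<^sup>+ y. riesz (slice b0 A (emb x)) (slice b0 B (emb y)) (slice b0 C (emb x + emb y)) \<partial>hyp \<partial>hyp)"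
    unfolding riesz_def
    by (intro nn_integral_cong) (auto simp: slice_def indicator_def scaleR_add_left add_ac)
  finally show ?thesis .
qed

lemma emeasure_slice_bounded:
  assumes "A \<subseteq> ball 0 R"
  shows "emeasure lborel (slice b0 A x) < \<top>"
proof -
  have "slice b0 A x \<subseteq> {- (R + norm x)..R + norm x}"
  proof
    fix s assume "s \<in> slice b0 A x"
    then have "norm (s *\<^sub>R b0 + x) < R" using assms by (auto simp: slice_def)
    moreover have "norm (s *\<^sub>R b0) \<le> norm (s *\<^sub>R b0 + x) + norm x" by (metis add_diff_cancel_right' norm_triangle_ineq4)
    ultimately show "s \<in> {- (R + norm x)..R + norm x}" using b0 by auto
  qed
  then have "emeasure lborel (slice b0 A x) \<le> emeasure lborel {- (R + norm x)..R + norm x}"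
    by (rule emeasure_mono) simp
  also have "\<dots> < \<top>" by (simp add: emeasure_lborel_Icc_eq)
  finally show ?thesis .
qed

text \<open>The one-dimensional inequality is applied slice by slice; containment in a ball gives
  the slices finite length.\<close>

lemma riesz_steiner:
  assumes [measurable]: "A \<in> sets borel" "B \<in> sets borel" "C \<in> sets borel"
    and "A \<subseteq> ball 0 R" "B \<subseteq> ball 0 R" "C \<subseteq> ball 0 R"
  shows "riesz A B C \<le> riesz (steiner b0 A) (steiner b0 B) (steiner b0 C)"
proof -
  have "(emb x + emb y) \<bullet> b0 = 0" for x y by (simp add: inner_add_left emb_inner)
  then show ?thesis
    by (subst (1 2) riesz_slices)
       (auto simp: slice_steiner b0 emb_inner intro!: nn_integral_mono riesz_real emeasure_slice_bounded[of _ R] assms)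
qed

lemma radial_slice:
  assumes W: "\<And>x y. x \<in> W \<Longrightarrow> norm y \<le> norm x \<Longrightarrow> y \<in> W" and x: "x \<bullet> b0 = 0"
    and s: "s \<in> slice b0 W x" "norm t \<le> norm s"
  shows "t \<in> slice b0 W x"
proof -
  have eq: "norm (r *\<^sub>R b0 + x) ^ 2 = r^2 + norm x ^ 2" for r
    unfolding power2_norm_eq_inner using x b0
    by (simp add: inner_add_left inner_add_right inner_commute[of b0 x] power2_eq_square)
  have "norm (t *\<^sub>R b0 + x) ^ 2 \<le> norm (s *\<^sub>R b0 + x) ^ 2"
    unfolding eq using s(2) by (simp add: abs_le_square_iff[symmetric])
  then have "norm (t *\<^sub>R b0 + x) \<le> norm (s *\<^sub>R b0 + x)" by (rule power2_le_imp_le) simp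
  with W s(1) show ?thesis by (auto simp: slice_def)
qed

text \<open>The slices of a ball are symmetric intervals, so the centred interval that replaces a
  slice of \<open>A\<close> still fits inside.\<close>

lemma steiner_in_ball:
  assumes A: "A \<subseteq> ball 0 R" "A \<in> sets borel"
  shows "steiner b0 A \<subseteq> ball 0 R"
proof
  fix x assume x: "x \<in> steiner b0 A"
  define x' where "x' = x - (x \<bullet> b0) *\<^sub>R b0"
  have 0: "x' \<bullet> b0 = 0" using b0 by (simp add: x'_def inner_diff_left)
  have "x \<bullet> b0 \<in> rball (emeasure lborel (slice b0 A x'))"
    using x by (simp add: steiner_def x'_def)
  moreover have "slice b0 A x' \<subseteq> slice b0 (ball 0 R) x'" using A by (auto simp: slice_def)
  then have "emeasure lborel (slice b0 A x') \<le> emeasure lborel (slice b0 (ball 0 R) x')"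
    by (rule emeasure_mono) (simp add: sets_slice)
  ultimately have "x \<bullet> b0 \<in> rball (emeasure lborel (slice b0 (ball 0 R) x'))"
    using rball_mono by blast
  also have "rball (emeasure lborel (slice b0 (ball 0 R) x')) \<subseteq> slice b0 (ball 0 R) x'"
    by (rule radial_set_rball(1)) (auto simp: sets_slice intro: radial_slice[OF _ 0])
  finally show "x \<in> ball 0 R" by (simp add: slice_def x'_def)
qed

text \<open>On each line the ball leaves a centred interval, so after symmetrization the overlap is
  the smaller of two lengths. The points counted by the second term lie in the part of
  \<open>A\<close> outside the ball and, after translation, in the part of the ball outside
  \<open>A\<close>; so both lengths exceed the old overlap by at least the measure of these
  points.\<close>

lemma steiner_gain:
  assumes [measurable]: "A \<in> sets borel"
  shows "emeasure lborel (A \<inter> rball v) + emeasure lborel {x \<in> A - rball v. x + \<tau> *\<^sub>R b0 \<in> rball v - A}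
    \<le> emeasure lborel (steiner b0 A \<inter> rball v)"
proof -
  define W :: "'a set" where "W = rball v"
  have [measurable]: "W \<in> sets borel" by (simp add: W_def)
  define Q where "Q = {x \<in> A - W. x + \<tau> *\<^sub>R b0 \<in> W - A}"
  have [measurable]: "Q \<in> sets borel" unfolding Q_def by measurable
  have "emeasure lborel (A \<inter> W) + emeasure lborel Q =
     (\<integral>\<^sup>+ y. emeasure lborel (slice b0 (A \<inter> W) (emb y)) + emeasure lborel (slice b0 Q (emb y)) \<partial>hyp)"
    by (subst (1 2) emeasure_slices) (simp_all add: nn_integral_add emeasure_slice)
  also have "\<dots> \<le> (\<integral>\<^sup>+ y. emeasure lborel (slice b0 (steiner b0 A \<inter> W) (emb y)) \<partial>hyp)"
  proof (rule nn_integral_mono)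
    fix y
    let ?x = "emb y"
    let ?A = "slice b0 A ?x" and ?W = "slice b0 W ?x" and ?Q = "slice b0 Q ?x"
    have rW: "rball (emeasure lborel ?W) \<subseteq> ?W"
      by (rule radial_set_rball(1), simp add: sets_slice)
         (rule radial_slice, auto simp: emb_inner W_def intro: rball_radial)
    have 1: "emeasure lborel (?A \<inter> ?W) + emeasure lborel ?Q \<le> emeasure lborel ?A"
      by (subst plus_emeasure) (auto simp: sets_slice slice_def Q_def intro!: emeasure_mono)
    have "emeasure lborel ?Q \<le> emeasure lborel {s. \<tau> + s \<in> ?W - ?A}"
      by (intro emeasure_mono) (auto simp: slice_def Q_def algebra_simps)
    also have "\<dots> = emeasure lborel (?W - ?A)"
      by (rule emeasure_lborel_translate) (simp add: sets_slice)
    finally have "emeasure lborel (?A \<inter> ?W) + emeasure lborel ?Q \<le> emeasure lborel (?A \<inter> ?W) + emeasure lborel (?W - ?A)"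
      by (rule add_left_mono)
    also have "\<dots> = emeasure lborel ?W"
      by (subst plus_emeasure) (auto simp: sets_slice intro!: arg_cong[where f="emeasure lborel"])
    finally have "emeasure lborel (?A \<inter> ?W) + emeasure lborel ?Q \<le> min (emeasure lborel ?A) (emeasure lborel ?W)"
      using 1 by simp
    also have "\<dots> = emeasure lborel (rball (emeasure lborel ?A) \<inter> rball (emeasure lborel ?W) :: real set)"
      by (simp add: rball_Int)
    also have "\<dots> \<le> emeasure lborel (rball (emeasure lborel ?A) \<inter> ?W)"
      using rW by (intro emeasure_mono) (auto simp: sets_slice)
    also have "rball (emeasure lborel ?A) \<inter> ?W = slice b0 (steiner b0 A \<inter> W) ?x"
      using slice_steiner[OF b0 emb_inner, of A y] by (auto simp: slice_def)
    finally show "emeasure lborel (slice b0 (A \<inter> W) ?x) + emeasure lborel ?Q \<le> emeasure lborel (slice b0 (steiner b0 A \<inter> W) ?x)"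
      by (simp add: slice_def Int_def)
  qed
  also have "\<dots> = emeasure lborel (steiner b0 A \<inter> W)"
    by (rule emeasure_slices[symmetric]) simp
  finally show ?thesis by (simp add: W_def Q_def)
qed

end

text \<open>Evaluating the double integral of \<open>indicator A x * indicator B (x - y)\<close> in two ways
  shows that the two measures are proportional; balls fix the factor.\<close>

lemma lborel_eq_translation_invariant:
  fixes \<mu> :: "'a::euclidean_space measure"
  assumes sets [measurable_cong]: "sets \<mu> = sets borel" and sf: "sigma_finite_measure \<mu>"
    and inv: "\<And>c f. f \<in> borel_measurable borel \<Longrightarrow> (\<integral>\<^sup>+ x. f (c + x) \<partial>\<mu>) = (\<integral>\<^sup>+ x. (f x::ennreal) \<partial>\<mu>)"
    and ball: "emeasure \<mu> (ball 0 1) = emeasure lborel (ball 0 1 :: 'a set)"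
  shows "\<mu> = lborel"
proof (rule measure_eqI)
  show "sets \<mu> = sets lborel" using sets by simp
  fix A assume "A \<in> sets \<mu>"
  then have [measurable]: "A \<in> sets borel" using sets by simp
  interpret \<mu>: sigma_finite_measure \<mu> by fact
  interpret P: pair_sigma_finite \<mu> lborel ..
  let ?B = "ball 0 1 :: 'a set"
  have [measurable, simp]: "?B \<in> sets borel" by (rule borel_open) (rule open_ball)
  have "emeasure \<mu> A * emeasure lborel ?B = (\<integral>\<^sup>+ x. \<integral>\<^sup>+ y. indicator A x * indicator ?B (x - y) \<partial>lborel \<partial>\<mu>)"
  proof -
    have "(\<integral>\<^sup>+ y. indicator A x * indicator ?B (x - y) \<partial>lborel) = indicator A x * emeasure lborel ?B" for x
    proof -
      have "(\<integral>\<^sup>+ y. indicator ?B (x - y) \<partial>lborel) = emeasure lborel ?B"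
        using nn_integral_lborel_reflect[OF borel_measurable_indicator, of ?B x] by simp
      moreover have "(\<integral>\<^sup>+ y. indicator A x * indicator ?B (x - y) \<partial>lborel) = indicator A x * (\<integral>\<^sup>+ y. indicator ?B (x - y) \<partial>lborel)"
        by (rule nn_integral_cmult) measurable
      ultimately show ?thesis by simp
    qed
    then show ?thesis by (simp add: nn_integral_multc sets)
  qed
  also have "\<dots> = (\<integral>\<^sup>+ y. \<integral>\<^sup>+ x. indicator A x * indicator ?B (x - y) \<partial>\<mu> \<partial>lborel)"
    by (rule P.Fubini'[symmetric]) measurable
  also have "\<dots> = (\<integral>\<^sup>+ y. \<integral>\<^sup>+ x. indicator A (y + x) * indicator ?B x \<partial>\<mu> \<partial>lborel)"
  proof (rule nn_integral_cong)
    fix y :: 'a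
    show "(\<integral>\<^sup>+ x. indicator A x * indicator ?B (x - y) \<partial>\<mu>) = (\<integral>\<^sup>+ x. indicator A (y + x) * indicator ?B x \<partial>\<mu>)"
      by (subst inv[of _ y, symmetric]) simp_all
  qed
  also have "\<dots> = (\<integral>\<^sup>+ x. \<integral>\<^sup>+ y. indicator A (y + x) * indicator ?B x \<partial>lborel \<partial>\<mu>)"
    by (rule P.Fubini') measurable
  also have "\<dots> = (\<integral>\<^sup>+ x. emeasure lborel A * indicator ?B x \<partial>\<mu>)"
  proof (rule nn_integral_cong)
    fix x :: 'a
    have "(\<integral>\<^sup>+ y. indicator A (y + x) \<partial>lborel) = emeasure lborel A"
      using nn_integral_lborel_translate[of "indicator A" x] by (simp add: add.commute)
    then show "(\<integral>\<^sup>+ y. indicator A (y + x) * indicator ?B x \<partial>lborel) = emeasure lborel A * indicator ?B x"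
      by (simp add: nn_integral_multc)
  qed
  also have "\<dots> = emeasure lborel A * emeasure lborel ?B"
    by (simp add: nn_integral_cmult sets ball)
  finally have "emeasure \<mu> A * emeasure lborel ?B = emeasure lborel A * emeasure lborel ?B" .
  moreover have "emeasure lborel ?B \<noteq> 0" "emeasure lborel ?B \<noteq> \<top>"
    using emeasure_lborel_ball_finite[of "0::'a" 1] unit_ball_vol_pos[of "real DIM('a)"] by (auto simp: emeasure_ball less_imp_neq[symmetric])
  ultimately show "emeasure \<mu> A = emeasure lborel A"
    by (metis ennreal_mult_divide_eq)
qed

section \<open>Steiner symmetrization in arbitrary directions\<close>

text \<open>A translation by \<open>c\<close> pulls back to the translation by the preimage of
  \<open>c\<close>, so the image measure is translation invariant; norms are preserved, so it agrees
  with \<open>lborel\<close> on the unit ball.\<close>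

lemma lborel_distr_orthogonal:
  fixes f :: "'a::euclidean_space \<Rightarrow> 'a"
  assumes f: "orthogonal_transformation f"
  shows "distr lborel borel f = lborel"
proof -
  have lin: "linear f" and nf: "norm (f x) = norm x" for x
    using f by (auto simp: orthogonal_transformation_linear orthogonal_transformation_norm)
  have [measurable]: "f \<in> borel_measurable borel"
    using linear_continuous_on[of f] lin by (intro borel_measurable_continuous_onI) (simp add: linear_conv_bounded_linear)
  define g where "g = inv f"
  have g: "f (g x) = x" for x
    using orthogonal_transformation_surj[OF f] by (simp add: g_def surj_f_inv_f)
  have B: "f -` ball 0 r = ball 0 r" for r by (auto simp: nf)
  show ?thesis
  proof (rule lborel_eq_translation_invariant)
    show "emeasure (distr lborel borel f) (ball 0 1) = emeasure lborel (ball 0 1 :: 'a set)"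
      by (subst emeasure_distr) (auto simp: B)
    show "sigma_finite_measure (distr lborel borel f)"
    proof (intro sigma_finite_measure.intro exI[of _ "range (\<lambda>n::nat. ball 0 (real n))"] conjI ballI)
      show "\<Union> (range (\<lambda>n::nat. ball (0::'a) (real n))) = space (distr lborel borel f)"
        using reals_Archimedean2 by auto
      show "emeasure (distr lborel borel f) a \<noteq> \<infinity>" if "a \<in> range (\<lambda>n::nat. ball 0 (real n))" for a
        using that emeasure_lborel_ball_finite[of "0::'a"] by (auto simp: emeasure_distr B less_top[symmetric])
    qed auto
    show "(\<integral>\<^sup>+ x. h (c + x) \<partial>distr lborel borel f) = (\<integral>\<^sup>+ x. h x \<partial>distr lborel borel f)"
      if [measurable]: "h \<in> borel_measurable borel" for c and h :: "'a \<Rightarrow> ennreal"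
    proof -
      have "(\<integral>\<^sup>+ x. h (c + x) \<partial>distr lborel borel f) = (\<integral>\<^sup>+ x. h (f (g c + x)) \<partial>lborel)"
        by (simp add: nn_integral_distr linear_add[OF lin] g)
      also have "\<dots> = (\<integral>\<^sup>+ x. h (f x) \<partial>lborel)" by (rule nn_integral_lborel_translate) measurable
      finally show ?thesis by (simp add: nn_integral_distr)
    qed
  qed simp
qed

lemma nn_integral_lborel_orthogonal:
  fixes f :: "'a::euclidean_space \<Rightarrow> 'a" and h :: "'a \<Rightarrow> ennreal"
  assumes f: "orthogonal_transformation f" and [measurable]: "h \<in> borel_measurable borel"
  shows "(\<integral>\<^sup>+ x. h (f x) \<partial>lborel) = (\<integral>\<^sup>+ x. h x \<partial>lborel)"
proof -
  have [measurable]: "f \<in> borel_measurable borel"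
    using linear_continuous_on[of f] orthogonal_transformation_linear[OF f]
    by (intro borel_measurable_continuous_onI) (simp add: linear_conv_bounded_linear)
  show ?thesis
    by (subst (2) lborel_distr_orthogonal[OF f, symmetric]) (simp add: nn_integral_distr)
qed

lemma borel_measurable_orthogonal:
  fixes f :: "'a::euclidean_space \<Rightarrow> 'a"
  shows "orthogonal_transformation f \<Longrightarrow> f \<in> borel_measurable borel"
  using linear_continuous_on[of f] orthogonal_transformation_linear[of f]
  by (intro borel_measurable_continuous_onI) (simp add: linear_conv_bounded_linear)

lemma emeasure_lborel_orthogonal:
  fixes f :: "'a::euclidean_space \<Rightarrow> 'a"
  assumes f: "orthogonal_transformation f" and [measurable]: "A \<in> sets borel"
  shows "emeasure lborel (f -` A) = emeasure lborel A"
proof -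
  note [measurable] = borel_measurable_orthogonal[OF f]
  show ?thesis
    by (subst (2) lborel_distr_orthogonal[OF f, symmetric]) (simp add: emeasure_distr)
qed

lemma riesz_orthogonal:
  fixes f :: "'a::euclidean_space \<Rightarrow> 'a"
  assumes f: "orthogonal_transformation f"
    and [measurable]: "A \<in> sets borel" "B \<in> sets borel" "C \<in> sets borel"
  shows "riesz (f -` A) (f -` B) (f -` C) = riesz A B C"
proof -
  note [measurable] = borel_measurable_orthogonal[OF f]
  have "riesz (f -` A) (f -` B) (f -` C) =
     (\<integral>\<^sup>+ x. \<integral>\<^sup>+ y. indicator A (f x) * indicator B (f y) * indicator C (f x + f y) \<partial>lborel \<partial>lborel)"
    unfolding riesz_def using orthogonal_transformation_linear[OF f]
    by (auto simp: linear_add indicator_def intro!: nn_integral_cong)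
  also have "\<dots> = (\<integral>\<^sup>+ x. \<integral>\<^sup>+ y. indicator A (f x) * indicator B y * indicator C (f x + y) \<partial>lborel \<partial>lborel)"
  proof (rule nn_integral_cong)
    fix x
    show "(\<integral>\<^sup>+ y. indicator A (f x) * indicator B (f y) * indicator C (f x + f y) \<partial>lborel) =
        (\<integral>\<^sup>+ y. indicator A (f x) * indicator B y * indicator C (f x + y) \<partial>lborel)"
      by (rule nn_integral_lborel_orthogonal[OF f, of "\<lambda>y. indicator A (f x) * indicator B y * indicator C (f x + y)"]) measurable
  qed
  also have "\<dots> = riesz A B C"
    unfolding riesz_def by (rule nn_integral_lborel_orthogonal[OF f]) measurable
  finally show ?thesis .
qed

text \<open>A lower bound for how much a symmetrization in the direction of \<open>v\<close>
  enlarges the overlap of \<open>A\<close> with its ball.\<close>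

definition transfer :: "'a::euclidean_space set \<Rightarrow> 'a \<Rightarrow> ennreal" where
  "transfer A v = emeasure lborel {x \<in> A - rball (emeasure lborel A). x + v \<in> rball (emeasure lborel A) - A}"

text \<open>A coordinate symmetrization is conjugated by an orthogonal map that carries a basis
  vector to the direction of \<open>v\<close>. Centred balls are invariant under the map, and the
  gain along \<open>norm v *\<^sub>R b\<close> becomes \<open>transfer A v\<close>.\<close>

lemma steiner_direction:
  fixes v :: "real ^ 'n"
  assumes v: "v \<noteq> 0"
  shows "\<exists>\<sigma> :: (real ^ 'n) set \<Rightarrow> (real ^ 'n) set.
    (\<forall>A. A \<in> sets borel \<longrightarrow> \<sigma> A \<in> sets borel) \<and>
    (\<forall>A. A \<in> sets borel \<longrightarrow> emeasure lborel (\<sigma> A) = emeasure lborel A) \<and>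
    (\<forall>A R. A \<in> sets borel \<longrightarrow> A \<subseteq> ball 0 R \<longrightarrow> \<sigma> A \<subseteq> ball 0 R) \<and>
    (\<forall>A B C R. A \<in> sets borel \<longrightarrow> B \<in> sets borel \<longrightarrow> C \<in> sets borel \<longrightarrow>
       A \<subseteq> ball 0 R \<longrightarrow> B \<subseteq> ball 0 R \<longrightarrow> C \<subseteq> ball 0 R \<longrightarrow> riesz A B C \<le> riesz (\<sigma> A) (\<sigma> B) (\<sigma> C)) \<and>
    (\<forall>A. A \<in> sets borel \<longrightarrow> emeasure lborel (A \<inter> rball (emeasure lborel A)) + transfer A v
       \<le> emeasure lborel (\<sigma> A \<inter> rball (emeasure lborel A)))"
proof -
  obtain b :: "real ^ 'n" where b: "b \<in> Basis" using nonempty_Basis by blast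
  have "norm b = norm (v /\<^sub>R norm v)" using v b by simp
  then obtain f where f: "orthogonal_transformation f" and fb: "f b = v /\<^sub>R norm v"
    using orthogonal_transformation_exists by blast
  define g where "g = inv f"
  have g: "orthogonal_transformation g" unfolding g_def by (rule orthogonal_transformation_inv[OF f])
  have gf: "g (f x) = x" "f (g x) = x" for x
    using orthogonal_transformation_inj[OF f] orthogonal_transformation_surj[OF f]
    by (auto simp: g_def inv_f_f surj_f_inv_f)
  have n: "norm (f x) = norm x" "norm (g x) = norm x" for x
    using f g by (auto simp: orthogonal_transformation_norm)
  note [measurable] = borel_measurable_orthogonal[OF f] borel_measurable_orthogonal[OF g]
  have fm: "f -` A \<in> sets borel" "g -` A \<in> sets borel" if [measurable]: "A \<in> sets borel" for A
    using measurable_sets[of f borel borel A] measurable_sets[of g borel borel A] by auto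
  define \<sigma> where "\<sigma> A = g -` steiner b (f -` A)" for A
  have fball: "f -` A \<subseteq> ball 0 R" if "A \<subseteq> ball 0 R" for A R
    using that n(1) by fastforce
  have gball: "g -` A \<subseteq> ball 0 R" if "A \<subseteq> ball 0 R" for A R
    using that n(2) by fastforce
  have rf: "f -` rball w = rball w" "g -` rball w = rball w" for w by (auto simp: rball_def n)
  show ?thesis
  proof (intro exI[of _ \<sigma>] conjI allI impI)
    fix A :: "(real^'n) set" assume A[measurable]: "A \<in> sets borel"
    show "\<sigma> A \<in> sets borel" by (simp add: \<sigma>_def fm sets_steiner)
    show "emeasure lborel (\<sigma> A) = emeasure lborel A"
      by (simp add: \<sigma>_def emeasure_lborel_orthogonal f g fm b emeasure_steiner sets_steiner)
    show "\<sigma> A \<subseteq> ball 0 R" if "A \<subseteq> ball 0 R" for R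
      unfolding \<sigma>_def by (intro gball steiner_in_ball b fball that fm A)
    let ?W = "rball (emeasure lborel A) :: (real^'n) set"
    have "emeasure lborel (A \<inter> ?W) = emeasure lborel (f -` A \<inter> ?W)"
      by (subst emeasure_lborel_orthogonal[OF f, symmetric]) (simp_all add: rf)
    moreover have "transfer A v = emeasure lborel {x \<in> f -` A - ?W. x + norm v *\<^sub>R b \<in> ?W - f -` A}"
    proof -
      have "f (x + norm v *\<^sub>R b) = f x + v" for x
        using v fb orthogonal_transformation_linear[OF f] by (simp add: linear_add linear_scale)
      note eq = this
      have W: "f y \<in> ?W \<longleftrightarrow> y \<in> ?W" for y by (simp add: rball_def n)
      have "f -` {x \<in> A - ?W. x + v \<in> ?W - A} = {x \<in> f -` A - ?W. x + norm v *\<^sub>R b \<in> ?W - f -` A}"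
        by (simp add: vimage_def eq[symmetric] W)
      moreover have "{x \<in> A - ?W. x + v \<in> ?W - A} \<in> sets borel" by measurable
      ultimately show ?thesis
        unfolding transfer_def using emeasure_lborel_orthogonal[OF f, of "{x \<in> A - ?W. x + v \<in> ?W - A}"] by (simp only:)
    qed
    moreover have "emeasure lborel (\<sigma> A \<inter> ?W) = emeasure lborel (steiner b (f -` A) \<inter> ?W)"
    proof -
      have "\<sigma> A \<inter> ?W = g -` (steiner b (f -` A) \<inter> ?W)" by (simp add: \<sigma>_def rf)
      then show ?thesis
        by (simp only:) (rule emeasure_lborel_orthogonal[OF g], intro sets.Int sets_steiner fm A sets_rball)
    qed
    ultimately show "emeasure lborel (A \<inter> ?W) + transfer A v \<le> emeasure lborel (\<sigma> A \<inter> ?W)"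
      using steiner_gain[OF b, of "f -` A" "emeasure lborel A" "norm v"] by (simp add: fm)
  next
    fix A B C :: "(real^'n) set" and R assume [measurable]: "A \<in> sets borel" "B \<in> sets borel" "C \<in> sets borel"
      and sub: "A \<subseteq> ball 0 R" "B \<subseteq> ball 0 R" "C \<subseteq> ball 0 R"
    have "riesz A B C = riesz (f -` A) (f -` B) (f -` C)" by (simp add: riesz_orthogonal f)
    also have "\<dots> \<le> riesz (steiner b (f -` A)) (steiner b (f -` B)) (steiner b (f -` C))"
      by (rule riesz_steiner[OF b, of _ _ _ R]) (simp_all add: fm fball sub)
    also have "\<dots> = riesz (\<sigma> A) (\<sigma> B) (\<sigma> C)"
      unfolding \<sigma>_def by (rule riesz_orthogonal[symmetric]) (simp_all add: fm b g sets_steiner)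
    finally show "riesz A B C \<le> riesz (\<sigma> A) (\<sigma> B) (\<sigma> C)" .
  qed
qed

section \<open>Reducing the defect and the Riesz inequality in all dimensions\<close>

text \<open>The surplus of \<open>A\<close> outside its ball and the gap inside have equal volume,
  and the integral of \<open>transfer A v\<close> over all \<open>v\<close> is the square of that
  volume. As it vanishes for \<open>v\<close> outside the ball of radius \<open>2 * R\<close>, some
  \<open>v\<close> does nearly as well as the average; the extra factor 2 turns a failure at every
  \<open>v\<close> into a contradiction.\<close>

lemma transfer_large:
  fixes A :: "'a::euclidean_space set"
  assumes [measurable]: "A \<in> sets borel" and A: "A \<subseteq> ball 0 R" "0 < R"
    and pos: "0 < measure lborel (A - rball (emeasure lborel A))"
  obtains v where "v \<noteq> 0"
    "ennreal ((measure lborel (A - rball (emeasure lborel A)))\<^sup>2 / (2 * measure lborel (ball 0 (2 * R) :: 'a set))) \<le> transfer A v"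
proof -
  let ?W = "rball (emeasure lborel A) :: 'a set"
  define P where "P = A - ?W"
  define Q where "Q = ?W - A"
  have [measurable]: "P \<in> sets borel" "Q \<in> sets borel" by (simp_all add: P_def Q_def)
  define \<delta> where "\<delta> = measure lborel P"
  have \<delta>: "0 < \<delta>" using pos by (simp add: \<delta>_def P_def)
  have finA: "emeasure lborel A < \<top>"
    using emeasure_mono[OF A(1), of lborel] emeasure_lborel_ball_finite[of 0 R] by (auto intro: le_less_trans)
  have W: "?W \<subseteq> ball 0 R" using rball_in_ball[OF A(1)] A(2) by simp
  have eA: "emeasure lborel A = emeasure lborel (A \<inter> ?W) + emeasure lborel P"
  proof -
    have "A = (A \<inter> ?W) \<union> P" by (auto simp: P_def)
    then have "emeasure lborel A = emeasure lborel ((A \<inter> ?W) \<union> P)" by simp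
    also have "\<dots> = emeasure lborel (A \<inter> ?W) + emeasure lborel P"
      by (rule plus_emeasure[symmetric]) (auto simp: P_def)
    finally show ?thesis .
  qed
  have eW: "emeasure lborel A = emeasure lborel (A \<inter> ?W) + emeasure lborel Q"
  proof -
    have "emeasure lborel ?W = emeasure lborel (A \<inter> ?W) + emeasure lborel Q"
    proof -
      have "?W = (A \<inter> ?W) \<union> Q" by (auto simp: Q_def)
      then have "emeasure lborel ?W = emeasure lborel ((A \<inter> ?W) \<union> Q)" by (rule arg_cong)
      also have "\<dots> = emeasure lborel (A \<inter> ?W) + emeasure lborel Q"
        by (rule plus_emeasure[symmetric]) (auto simp: Q_def)
      finally show ?thesis .
    qed
    then show ?thesis by simp
  qed
  have "emeasure lborel (A \<inter> ?W) \<le> emeasure lborel A" by (rule emeasure_mono) auto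
  with finA have "emeasure lborel (A \<inter> ?W) \<noteq> \<top>" by auto
  moreover from eW[symmetric] eA
  have "emeasure lborel (A \<inter> ?W) + emeasure lborel Q = emeasure lborel (A \<inter> ?W) + emeasure lborel P"
    by (rule trans)
  ultimately have PQ: "emeasure lborel Q = emeasure lborel P"
    unfolding ennreal_add_left_cancel by simp
  have "emeasure lborel P \<le> emeasure lborel A" by (rule emeasure_mono) (auto simp: P_def)
  with finA have "emeasure lborel P \<noteq> \<top>" by auto
  then have P: "emeasure lborel P = ennreal \<delta>"
    unfolding \<delta>_def by (rule emeasure_eq_ennreal_measure)
  let ?V = "measure lborel (ball 0 (2 * R) :: 'a set)"
  have V: "emeasure lborel (ball 0 (2 * R) :: 'a set) = ennreal ?V" "0 < ?V"
    using A(2) emeasure_lborel_ball_finite[of "0::'a" "2 * R"]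
    by (auto intro!: emeasure_eq_ennreal_measure simp: less_top)
  have tr: "transfer A v = (\<integral>\<^sup>+ x. indicator P x * indicator Q (x + v) \<partial>lborel)" for v
  proof -
    have "transfer A v = (\<integral>\<^sup>+ x. indicator {x \<in> P. x + v \<in> Q} x \<partial>lborel)"
      unfolding transfer_def P_def[symmetric] Q_def[symmetric] by (subst nn_integral_indicator) auto
    also have "\<dots> = (\<integral>\<^sup>+ x. indicator P x * indicator Q (x + v) \<partial>lborel)"
      by (intro nn_integral_cong) (auto split: split_indicator)
    finally show ?thesis .
  qed
  have tr_int: "(\<integral>\<^sup>+ v. transfer A v \<partial>lborel) = ennreal (\<delta>\<^sup>2)"
  proof -
    have "(\<integral>\<^sup>+ v. transfer A v \<partial>lborel) = (\<integral>\<^sup>+ x. \<integral>\<^sup>+ v. indicator P x * indicator Q (x + v) \<partial>lborel \<partial>lborel)"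
      unfolding tr by (rule lborel_pair.Fubini') measurable
    also have "\<dots> = (\<integral>\<^sup>+ x. indicator P x * emeasure lborel Q \<partial>lborel)"
      by (intro nn_integral_cong) (simp add: nn_integral_cmult nn_integral_lborel_translate)
    also have "\<dots> = ennreal (\<delta>\<^sup>2)"
      using \<delta> by (simp add: nn_integral_multc PQ P ennreal_mult[symmetric] power2_eq_square)
    finally show ?thesis .
  qed
  define c where "c = \<delta>\<^sup>2 / (2 * ?V)"
  have c: "0 < c" using \<delta> V by (simp add: c_def)
  have "\<exists>v. ennreal c \<le> transfer A v"
  proof (rule ccontr)
    assume "\<not> ?thesis"
    then have less: "transfer A v < ennreal c" for v by (simp add: not_le)
    have "transfer A v \<le> ennreal c * indicator (ball 0 (2 * R)) v" for v
    proof (cases "v \<in> ball 0 (2 * R)")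
      case False
      have "{x \<in> A - ?W. x + v \<in> ?W - A} = {}"
      proof (rule ccontr)
        assume "{x \<in> A - ?W. x + v \<in> ?W - A} \<noteq> {}"
        then obtain x where "x \<in> ball 0 R" "x + v \<in> ball 0 R" using A W by blast
        then have "norm v < 2 * R" using norm_triangle_ineq4[of "x + v" x] by simp
        then show False using False by simp
      qed
      then show ?thesis unfolding transfer_def by (simp only:) simp
    qed (use less[of v] in auto)
    then have "(\<integral>\<^sup>+ v. transfer A v \<partial>lborel) \<le> (\<integral>\<^sup>+ v. ennreal c * indicator (ball (0::'a) (2 * R)) v \<partial>lborel)"
      by (intro nn_integral_mono) simp
    also have "\<dots> = ennreal (c * ?V)"
      using c by (subst nn_integral_cmult_indicator) (simp_all add: V ennreal_mult borel_open)
    finally have "\<delta>\<^sup>2 \<le> c * ?V" unfolding tr_int using c V by (simp add: ennreal_le_iff)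
    then show False using \<delta> V by (simp add: c_def)
  qed
  then obtain v where v: "ennreal c \<le> transfer A v" by blast
  have "v \<noteq> 0"
  proof
    assume "v = 0"
    then have "{x \<in> A - ?W. x + v \<in> ?W - A} = {}" by auto
    then have "transfer A v = 0" unfolding transfer_def by (simp only:) simp
    then show False using v c by simp
  qed
  with v that show thesis by (simp add: c_def \<delta>_def P_def)
qed

text \<open>Turns small defects into a small loss: a pair counted on the left but not by the primed
  sets has \<open>x\<close>, \<open>y\<close> or \<open>x + y\<close> in a difference set, and each
  of these cases is bounded by a product of two volumes.\<close>

lemma riesz_split:
  fixes A B C :: "'a::euclidean_space set"
  assumes [measurable]: "A \<in> sets borel" "B \<in> sets borel" "C \<in> sets borel"
    and V: "emeasure lborel A \<le> V" "emeasure lborel B \<le> V" "emeasure lborel C \<le> V"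
    and [measurable]: "A' \<in> sets borel" "B' \<in> sets borel" "C' \<in> sets borel"
  shows "riesz A B C \<le> riesz A' B' C' +
    V * (emeasure lborel (A - A') + emeasure lborel (B - B') + emeasure lborel (C - C'))"
proof -
  have "riesz A B C \<le> (\<integral>\<^sup>+ x. \<integral>\<^sup>+ y. indicator A' x * indicator B' y * indicator C' (x + y) +
     (indicator (A - A') x * indicator B y * indicator C (x + y) + indicator A x * indicator (B - B') y * indicator C (x + y) +
      indicator A x * indicator B y * indicator (C - C') (x + y)) \<partial>lborel \<partial>lborel)"
    unfolding riesz_def by (intro nn_integral_mono) (auto split: split_indicator)
  also have "\<dots> = riesz A' B' C' + (riesz (A - A') B C + riesz A (B - B') C + riesz A B (C - C'))"
    unfolding riesz_def by (simp add: nn_integral_add)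
  also have "\<dots> \<le> riesz A' B' C' + (emeasure lborel (A - A') * V + emeasure lborel (B - B') * V + V * emeasure lborel (C - C'))"
  proof (intro add_mono order_refl)
    show "riesz (A - A') B C \<le> emeasure lborel (A - A') * V"
      by (rule order_trans[OF riesz_le_prod]) (auto intro!: mult_left_mono V)
    show "riesz A (B - B') C \<le> emeasure lborel (B - B') * V"
      by (subst riesz_commute, simp, simp, simp, rule order_trans[OF riesz_le_prod]) (auto intro!: mult_left_mono V)
    show "riesz A B (C - C') \<le> V * emeasure lborel (C - C')"
      by (rule order_trans[OF riesz_le_prod_right]) (auto intro!: mult_right_mono V)
  qed
  also have "\<dots> = riesz A' B' C' + V * (emeasure lborel (A - A') + emeasure lborel (B - B') + emeasure lborel (C - C'))"
    by (simp add: algebra_simps)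
  finally show ?thesis .
qed

text \<open>Among the triples in the ball of radius \<open>R\<close> with the given volumes and at least the given
  Riesz integral, the total defect has infimum 0: if one defect is \<open>\<delta>\<close>, a Steiner symmetrization
  in a suitable direction lowers it by a multiple of \<open>\<delta>\<^sup>2\<close> and raises none of the others.\<close>

lemma riesz_bounded:
  fixes A B C :: "(real ^ 'n) set"
  assumes meas: "A \<in> sets borel" "B \<in> sets borel" "C \<in> sets borel"
    and sub: "A \<subseteq> ball 0 R" "B \<subseteq> ball 0 R" "C \<subseteq> ball 0 R"
  shows "riesz A B C \<le> riesz (rball (emeasure lborel A)) (rball (emeasure lborel B))
    (rball (emeasure lborel C) :: (real ^ 'n) set)"
proof (cases "0 < R")
  case False
  then have "ball 0 R = ({} :: (real^'n) set)" by simp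
  then have "A = {}" using sub(1) by (simp only: subset_empty)
  then show ?thesis by (simp add: riesz_def)
next
  case R: True
  define \<beta> where "\<beta> S = measure lborel (S - rball (emeasure lborel S))" for S :: "(real^'n) set"
  define ok where "ok S T \<longleftrightarrow> S \<in> sets borel \<and> S \<subseteq> ball 0 R \<and> emeasure lborel S = emeasure lborel T"
    for S T :: "(real^'n) set"
  define adm where "adm A' B' C' \<longleftrightarrow> ok A' A \<and> ok B' B \<and> ok C' C \<and> riesz A B C \<le> riesz A' B' C'" for A' B' C'
  \<comment> \<open>Only these numbers are minimized, so no limit of symmetrized sets has to be
    formed.\<close>
  define T where "T = {\<beta> A' + \<beta> B' + \<beta> C' | A' B' C'. adm A' B' C'}"
  have T_ne: "\<beta> A + \<beta> B + \<beta> C \<in> T" unfolding T_def adm_def ok_def using meas sub by blast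
  have T_pos: "0 \<le> d" if "d \<in> T" for d using that by (auto simp: T_def \<beta>_def)
  then have bdd: "bdd_below T" by (meson bdd_belowI)
  define V where "V = measure lborel (ball 0 (2 * R) :: (real^'n) set)"
  have V: "0 < V" using R by (simp add: V_def)
  have fin: "emeasure lborel S < \<top>" if "S \<subseteq> ball 0 R" for S :: "(real^'n) set"
    using emeasure_mono[OF that, of lborel] emeasure_lborel_ball_finite[of "0::real^'n" R] by (auto intro: le_less_trans)
  have \<beta>_eq: "emeasure lborel (S - rball (emeasure lborel S)) = ennreal (\<beta> S)" if "S \<subseteq> ball 0 R" for S :: "(real^'n) set"
  proof -
    have "emeasure lborel (S - rball (emeasure lborel S)) < \<top>"
      by (rule fin) (rule order_trans[OF Diff_subset that])
    then show ?thesis unfolding \<beta>_def by (intro emeasure_eq_ennreal_measure) simp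
  qed
  have step: "\<exists>d'\<in>T. d' + s\<^sup>2 / (2 * V) \<le> d" if d: "d \<in> T" and s: "0 < s" "3 * s \<le> d" for d s
  proof -
    obtain A' B' C' where adm: "adm A' B' C'" and deq: "d = \<beta> A' + \<beta> B' + \<beta> C'" using d by (auto simp: T_def)
    then have okA: "ok A' A" and okB: "ok B' B" and okC: "ok C' C" and ri: "riesz A B C \<le> riesz A' B' C'" by (auto simp: adm_def)
    have "s \<le> \<beta> A' \<or> s \<le> \<beta> B' \<or> s \<le> \<beta> C'" using s deq by linarith
    then obtain S where S: "S \<in> {A', B', C'}" "s \<le> \<beta> S" by blast
    have oS: "S \<in> sets borel" "S \<subseteq> ball 0 R" using S okA okB okC by (auto simp: ok_def)
    have "0 < \<beta> S" using S s by linarith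
    then obtain v where v: "v \<noteq> 0" "ennreal ((\<beta> S)\<^sup>2 / (2 * V)) \<le> transfer S v"
      unfolding \<beta>_def V_def by (rule transfer_large[OF oS R])
    have gain: "ennreal (s\<^sup>2 / (2 * V)) \<le> transfer S v"
      using S s V by (intro order_trans[OF _ v(2)] ennreal_leI divide_right_mono power_mono) auto
    obtain \<sigma> :: "(real^'n) set \<Rightarrow> (real^'n) set" where "(\<forall>A. A \<in> sets borel \<longrightarrow> \<sigma> A \<in> sets borel) \<and>
      (\<forall>A. A \<in> sets borel \<longrightarrow> emeasure lborel (\<sigma> A) = emeasure lborel A) \<and>
      (\<forall>A R. A \<in> sets borel \<longrightarrow> A \<subseteq> ball 0 R \<longrightarrow> \<sigma> A \<subseteq> ball 0 R) \<and>
      (\<forall>A B C R. A \<in> sets borel \<longrightarrow> B \<in> sets borel \<longrightarrow> C \<in> sets borel \<longrightarrow>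
         A \<subseteq> ball 0 R \<longrightarrow> B \<subseteq> ball 0 R \<longrightarrow> C \<subseteq> ball 0 R \<longrightarrow> riesz A B C \<le> riesz (\<sigma> A) (\<sigma> B) (\<sigma> C)) \<and>
      (\<forall>A. A \<in> sets borel \<longrightarrow> emeasure lborel (A \<inter> rball (emeasure lborel A)) + transfer A v
         \<le> emeasure lborel (\<sigma> A \<inter> rball (emeasure lborel A)))"
      using steiner_direction[OF v(1)] ..
    note \<sigma> = this[THEN conjunct1, rule_format]
      this[THEN conjunct2, THEN conjunct1, rule_format]
      this[THEN conjunct2, THEN conjunct2, THEN conjunct1, rule_format]
      this[THEN conjunct2, THEN conjunct2, THEN conjunct2, THEN conjunct1, rule_format]
      this[THEN conjunct2, THEN conjunct2, THEN conjunct2, THEN conjunct2, rule_format]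
    have dec: "ennreal (\<beta> (\<sigma> S)) + transfer S v \<le> ennreal (\<beta> S)" if S: "S \<in> sets borel" "S \<subseteq> ball 0 R" for S
    proof -
      let ?W = "rball (emeasure lborel S) :: (real^'n) set"
      note [measurable] = S(1) \<sigma>(1)[OF S(1)]
      have split: "emeasure lborel U = emeasure lborel (U \<inter> ?W) + emeasure lborel (U - ?W)"
        if [measurable]: "U \<in> sets borel" for U
      proof -
        have "emeasure lborel (U \<inter> ?W) + emeasure lborel (U - ?W) = emeasure lborel ((U \<inter> ?W) \<union> (U - ?W))"
          by (rule plus_emeasure) auto
        also have "(U \<inter> ?W) \<union> (U - ?W) = U" by blast
        finally show ?thesis ..
      qed
      let ?a = "emeasure lborel (S \<inter> ?W)"
      have "?a + (ennreal (\<beta> (\<sigma> S)) + transfer S v) = (?a + transfer S v) + emeasure lborel (\<sigma> S - ?W)"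
        using \<beta>_eq[OF \<sigma>(3)[OF S]] \<sigma>(2)[OF S(1)] by (simp add: ac_simps)
      also have "\<dots> \<le> emeasure lborel (\<sigma> S \<inter> ?W) + emeasure lborel (\<sigma> S - ?W)"
        by (intro add_right_mono \<sigma>(5) S)
      also have "\<dots> = emeasure lborel S" using split[of "\<sigma> S"] \<sigma>(1,2)[OF S(1)] by simp
      also have "\<dots> = ?a + ennreal (\<beta> S)" using split[of S] \<beta>_eq[OF S(2)] S(1) by simp
      finally have "?a + (ennreal (\<beta> (\<sigma> S)) + transfer S v) \<le> ?a + ennreal (\<beta> S)" .
      moreover have "?a < \<top>" by (rule fin) (rule order_trans[OF Int_lower1 S(2)])
      then have "?a \<noteq> \<top>" by simp
      ultimately show ?thesis unfolding ennreal_add_left_cancel_le by simp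
    qed
    have \<beta>0: "0 \<le> \<beta> U" for U by (simp add: \<beta>_def)
    have dec1: "\<beta> (\<sigma> U) \<le> \<beta> U" if "U \<in> sets borel" "U \<subseteq> ball 0 R" for U
    proof -
      have "ennreal (\<beta> (\<sigma> U)) \<le> ennreal (\<beta> (\<sigma> U)) + transfer U v" by simp
      also have "\<dots> \<le> ennreal (\<beta> U)" by (rule dec[OF that])
      finally show ?thesis by (simp add: ennreal_le_iff \<beta>0)
    qed
    have dec2: "\<beta> (\<sigma> S) + s\<^sup>2 / (2 * V) \<le> \<beta> S"
    proof -
      have "ennreal (\<beta> (\<sigma> S) + s\<^sup>2 / (2 * V)) = ennreal (\<beta> (\<sigma> S)) + ennreal (s\<^sup>2 / (2 * V))"
        using V by (intro ennreal_plus \<beta>0) simp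
      also have "\<dots> \<le> ennreal (\<beta> (\<sigma> S)) + transfer S v" by (intro add_left_mono gain)
      also have "\<dots> \<le> ennreal (\<beta> S)" by (rule dec[OF oS])
      finally show ?thesis by (simp add: ennreal_le_iff \<beta>0)
    qed
    have A': "A' \<in> sets borel" "A' \<subseteq> ball 0 R" "B' \<in> sets borel" "B' \<subseteq> ball 0 R" "C' \<in> sets borel" "C' \<subseteq> ball 0 R"
      using okA okB okC by (auto simp: ok_def)
    have "adm (\<sigma> A') (\<sigma> B') (\<sigma> C')"
      unfolding adm_def ok_def using okA okB okC \<sigma>(1-3) order_trans[OF ri \<sigma>(4)[OF A'(1,3,5) A'(2,4,6)]]
      by (auto simp: ok_def)
    then have "\<beta> (\<sigma> A') + \<beta> (\<sigma> B') + \<beta> (\<sigma> C') \<in> T" by (auto simp: T_def)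
    moreover have "\<beta> (\<sigma> A') + \<beta> (\<sigma> B') + \<beta> (\<sigma> C') + s\<^sup>2 / (2 * V) \<le> d"
      using S(1) dec2 dec1[OF A'(1,2)] dec1[OF A'(3,4)] dec1[OF A'(5,6)] unfolding deq by auto
    ultimately show ?thesis by blast
  qed
  define m where "m = Inf T"
  have m_le: "m \<le> d" if "d \<in> T" for d unfolding m_def by (rule cInf_lower[OF that bdd])
  have m0: "0 \<le> m" unfolding m_def using T_ne T_pos by (intro cInf_greatest) auto
  have "m = 0"
  proof (rule ccontr)
    assume "m \<noteq> 0"
    with m0 have mpos: "0 < m" by simp
    define s where "s = m / 3"
    have s: "0 < s" using mpos by (simp add: s_def)
    \<comment> \<open>A triple whose total defect is this close to the infimum would be carried
      below it by one more symmetrization.\<close>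
    have "m < m + s\<^sup>2 / (2 * V)" using s V by simp
    then obtain d where d: "d \<in> T" "d < m + s\<^sup>2 / (2 * V)"
      unfolding m_def using T_ne by (subst (asm) cInf_less_iff) (auto simp: bdd)
    have "3 * s \<le> d" using m_le[OF d(1)] by (simp add: s_def)
    from step[OF d(1) s this] obtain d' where "d' \<in> T" "d' + s\<^sup>2 / (2 * V) \<le> d" by blast
    with d(2) m_le[of d'] show False by linarith
  qed
  show ?thesis
  proof (rule ennreal_le_epsilon)
    let ?W = "\<lambda>S. rball (emeasure lborel S) :: (real^'n) set"
    fix e :: real assume e: "0 < e"
    define VR where "VR = measure lborel (ball 0 R :: (real^'n) set)"
    have VR: "emeasure lborel (ball 0 R :: (real^'n) set) = ennreal VR" "0 < VR"
      unfolding VR_def using R fin[of "ball 0 R"] by (auto intro!: emeasure_eq_ennreal_measure)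
    \<comment> \<open>Since the infimum is 0, some admissible triple can be exchanged for its balls
      at a cost of at most \<open>e\<close>. Admissible sets have the original volumes, so these are
      the balls of \<open>A\<close>, \<open>B\<close> and \<open>C\<close>.\<close>
    have "Inf T < e / VR" using \<open>m = 0\<close> e VR by (simp add: m_def)
    then obtain d where d: "d \<in> T" "d < e / VR" using T_ne by (subst (asm) cInf_less_iff) (auto simp: bdd)
    then obtain A' B' C' where adm: "adm A' B' C'" and deq: "d = \<beta> A' + \<beta> B' + \<beta> C'" by (auto simp: T_def)
    then have okA: "ok A' A" and okB: "ok B' B" and okC: "ok C' C" and ri: "riesz A B C \<le> riesz A' B' C'" by (auto simp: adm_def)
    have le: "emeasure lborel S \<le> ennreal VR" if "S \<subseteq> ball 0 R" for S :: "(real^'n) set"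
      using emeasure_mono[OF that, of lborel] VR by simp
    have "riesz A' B' C' \<le> riesz (?W A') (?W B') (?W C') + ennreal VR * (ennreal (\<beta> A') + ennreal (\<beta> B') + ennreal (\<beta> C'))"
    proof -
      have A': "A' \<in> sets borel" "B' \<in> sets borel" "C' \<in> sets borel"
        "A' \<subseteq> ball 0 R" "B' \<subseteq> ball 0 R" "C' \<subseteq> ball 0 R"
        using okA okB okC by (simp_all only: ok_def)
      show ?thesis
        unfolding \<beta>_eq[OF A'(4), symmetric] \<beta>_eq[OF A'(5), symmetric] \<beta>_eq[OF A'(6), symmetric]
        by (rule riesz_split) (simp_all only: A' le sets_rball)
    qed
    also have "ennreal VR * (ennreal (\<beta> A') + ennreal (\<beta> B') + ennreal (\<beta> C')) = ennreal (VR * d)"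
      unfolding deq using VR by (simp add: ennreal_mult ennreal_plus[symmetric] \<beta>_def del: ennreal_plus)
    also have "VR * d \<le> e" using d(2) VR by (simp add: field_simps)
    finally show "riesz A B C \<le> riesz (?W A) (?W B) (?W C) + ennreal e"
      using ri okA okB okC by (auto simp: ok_def intro: order_trans ennreal_leI add_left_mono)
  qed
qed

text \<open>The sets are exhausted by their intersections with large balls. Fatou's lemma handles
  the left side, and the right side only grows with the volumes.\<close>

theorem riesz_rearrangement_sets:
  fixes A B C :: "(real ^ 'n) set"
  assumes [measurable]: "A \<in> sets borel" "B \<in> sets borel" "C \<in> sets borel"
  shows "riesz A B C \<le> riesz (rball (emeasure lborel A)) (rball (emeasure lborel B))
    (rball (emeasure lborel C) :: (real ^ 'n) set)"
proof -
  define b :: "nat \<Rightarrow> (real^'n) set" where "b n = ball 0 (real n)" for n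
  have b[measurable]: "b n \<in> sets borel" for n by (simp add: b_def)
  have mono: "b m \<subseteq> b n" if "m \<le> n" for m n using that by (auto simp: b_def)
  have ev: "eventually (\<lambda>n. x \<in> b n) sequentially" for x
  proof -
    obtain N where "norm x < real N" using reals_Archimedean2 by blast
    then have "x \<in> b n" if "N \<le> n" for n using that by (auto simp: b_def)
    then show ?thesis by (auto simp: eventually_sequentially)
  qed
  let ?f = "\<lambda>n x y. indicator (A \<inter> b n) x * indicator (B \<inter> b n) y * indicator (C \<inter> b n) (x + y) :: ennreal"
  have "incseq (\<lambda>n. ?f n x y)" for x y
    using mono by (intro incseq_SucI) (auto split: split_indicator, (meson le_SucI order_refl subsetD)+)
  have "riesz A B C \<le> (\<integral>\<^sup>+ x. \<integral>\<^sup>+ y. liminf (\<lambda>n. ?f n x y) \<partial>lborel \<partial>lborel)"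
    unfolding riesz_def
  proof (intro nn_integral_mono)
    fix x y :: "real^'n"
    have "\<forall>\<^sub>F n in sequentially. indicator A x * indicator B y * indicator C (x + y) \<le> ?f n x y"
      using ev[of x] ev[of y] ev[of "x + y"] by eventually_elim (auto split: split_indicator)
    then show "indicator A x * indicator B y * indicator C (x + y) \<le> liminf (\<lambda>n. ?f n x y)"
      by (rule Liminf_bounded)
  qed
  also have "\<dots> \<le> (\<integral>\<^sup>+ x. liminf (\<lambda>n. \<integral>\<^sup>+ y. ?f n x y \<partial>lborel) \<partial>lborel)"
    by (intro nn_integral_mono nn_integral_liminf) measurable
  also have "\<dots> \<le> liminf (\<lambda>n. riesz (A \<inter> b n) (B \<inter> b n) (C \<inter> b n))"
    unfolding riesz_def by (intro nn_integral_liminf) measurable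
  also have "\<dots> \<le> limsup (\<lambda>n. riesz (A \<inter> b n) (B \<inter> b n) (C \<inter> b n))"
    by (rule Liminf_le_Limsup) simp
  also have "\<dots> \<le> riesz (rball (emeasure lborel A)) (rball (emeasure lborel B)) (rball (emeasure lborel C) :: (real ^ 'n) set)"
  proof (rule Limsup_bounded, rule always_eventually, rule allI)
    fix n
    have "riesz (A \<inter> b n) (B \<inter> b n) (C \<inter> b n) \<le> riesz (rball (emeasure lborel (A \<inter> b n)))
        (rball (emeasure lborel (B \<inter> b n))) (rball (emeasure lborel (C \<inter> b n)) :: (real ^ 'n) set)"
      by (rule riesz_bounded[where R="real n"]) (auto simp: b_def)
    also have "\<dots> \<le> riesz (rball (emeasure lborel A)) (rball (emeasure lborel B)) (rball (emeasure lborel C) :: (real ^ 'n) set)"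
      by (intro riesz_mono rball_mono emeasure_mono) auto
    finally show "riesz (A \<inter> b n) (B \<inter> b n) (C \<inter> b n) \<le> \<dots>" .
  qed
  finally show ?thesis .
qed

section \<open>Weak majorization\<close>

lemma sets_ball_borel [measurable]: "ball x r \<in> sets borel"
  by (rule borel_open[OF open_ball])

lemma emeasure_ball_less_top [simp]: "emeasure lborel (ball (x::'a::euclidean_space) r) < \<top>"
  using emeasure_lborel_ball_finite[of x r] by simp

lemma Liminf_ball_exhaust:
  fixes g :: "'a::euclidean_space \<Rightarrow> ennreal"
  shows "g x \<le> liminf (\<lambda>n. indicator (ball 0 (real n)) x * g x)"
proof (rule Liminf_bounded)
  obtain N where N: "norm x < real N" using reals_Archimedean2 by blast
  have "g x \<le> indicator (ball 0 (real n)) x * g x" if "N \<le> n" for n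
  proof -
    have "real N \<le> real n" using that by simp
    then have "x \<in> ball 0 (real n)" using N by simp
    then show ?thesis by simp
  qed
  then show "\<forall>\<^sub>F n in sequentially. g x \<le> indicator (ball 0 (real n)) x * g x"
    by (auto simp: eventually_sequentially)
qed

lemma superlevel_measurable [measurable]:
  assumes "sigma_finite_measure M" and [measurable]: "h \<in> borel_measurable M"
  shows "(\<lambda>s::real. emeasure M {x \<in> space M. ennreal s < h x}) \<in> borel_measurable borel"
proof -
  interpret sigma_finite_measure M by fact
  have "(\<lambda>s::real. \<integral>\<^sup>+ x. indicator {x. ennreal s < h x} x \<partial>M) \<in> borel_measurable borel"
    unfolding indicator_def by measurable
  moreover have "(\<integral>\<^sup>+ x. indicator {x. ennreal s < h x} x \<partial>M) = emeasure M {x \<in> space M. ennreal s < h x}" for s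
  proof -
    have "(\<integral>\<^sup>+ x. indicator {x. ennreal s < h x} x \<partial>M) = (\<integral>\<^sup>+ x. indicator {x \<in> space M. ennreal s < h x} x \<partial>M)"
      by (intro nn_integral_cong) (auto split: split_indicator)
    also have "\<dots> = emeasure M {x \<in> space M. ennreal s < h x}"
      by (rule nn_integral_indicator) measurable
    finally show ?thesis .
  qed
  ultimately show ?thesis by simp
qed

text \<open>Because balls are indexed by volume, the volume of
  \<open>C \<inter> rball (ennreal w)\<close> is a Lipschitz function of \<open>w\<close> with
  constant 1; the intermediate value theorem finds the piece of \<open>B - A\<close> to add to
  \<open>A\<close>.\<close>

lemma intermediate_set:
  fixes A B :: "'a::euclidean_space set"
  assumes [measurable]: "A \<in> sets borel" "B \<in> sets borel" and AB: "A \<subseteq> B"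
    and v: "emeasure lborel A \<le> v" "v \<le> emeasure lborel B" "v < \<top>"
  obtains E where "E \<in> sets borel" "A \<subseteq> E" "E \<subseteq> B" "emeasure lborel E = v"
proof -
  define C where "C = B - A"
  have [measurable]: "C \<in> sets borel" by (simp add: C_def)
  have Afin: "emeasure lborel A < \<top>" using v by (meson le_less_trans)
  have add: "emeasure lborel (A \<union> (C \<inter> S)) = emeasure lborel A + emeasure lborel (C \<inter> S)" if [measurable]: "S \<in> sets borel" for S
    by (rule plus_emeasure[symmetric]) (auto simp: C_def)
  show thesis
  proof (cases "v = emeasure lborel B")
    case True
    then show thesis using that[of B] AB by simp
  next
    case False
    have fin: "emeasure lborel (C \<inter> rball (ennreal w)) < \<top>" for w
      using emeasure_mono[of "C \<inter> rball (ennreal w)" "rball (ennreal w)" lborel] by (auto intro: le_less_trans)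
    define H where "H w = measure lborel (C \<inter> rball (ennreal w))" for w
    have eH: "emeasure lborel (C \<inter> rball (ennreal w)) = ennreal (H w)" for w
      unfolding H_def using fin[of w] by (intro emeasure_eq_ennreal_measure) simp
    have H0: "0 \<le> H w" for w by (simp add: H_def)
    have lip: "H w \<le> H w' \<and> H w' \<le> H w + (w' - w)" if "0 \<le> w" "w \<le> w'" for w w'
    proof
      have sub: "rball (ennreal w) \<subseteq> (rball (ennreal w') :: 'a set)" using that by (intro rball_mono ennreal_leI)
      then have "emeasure lborel (C \<inter> rball (ennreal w)) \<le> emeasure lborel (C \<inter> rball (ennreal w'))"
        by (intro emeasure_mono) auto
      then show "H w \<le> H w'" unfolding eH by (simp add: ennreal_le_iff H0)
      have "emeasure lborel (C \<inter> rball (ennreal w')) \<le> emeasure lborel ((C \<inter> rball (ennreal w)) \<union> (rball (ennreal w') - rball (ennreal w)))"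
        by (intro emeasure_mono) auto
      also have "\<dots> \<le> emeasure lborel (C \<inter> rball (ennreal w)) + emeasure lborel (rball (ennreal w') - rball (ennreal w) :: 'a set)"
        by (intro emeasure_subadditive) auto
      also have "emeasure lborel (rball (ennreal w') - rball (ennreal w) :: 'a set) = ennreal (w' - w)"
        using that sub by (subst emeasure_Diff) (auto simp: ennreal_minus)
      finally have "ennreal (H w') \<le> ennreal (H w + (w' - w))"
        unfolding eH using that H0 by simp
      then show "H w' \<le> H w + (w' - w)" using that H0[of w] by (simp add: ennreal_le_iff del: ennreal_plus)
    qed
    have cont: "continuous_on {0..} H"
    proof (rule lipschitz_on_continuous_on[where L=1], rule lipschitz_onI)
      fix x y :: real assume "x \<in> {0..}" "y \<in> {0..}"
      then show "dist (H x) (H y) \<le> 1 * dist x y"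
        using lip[of x y] lip[of y x] by (cases "x \<le> y") (auto simp: dist_real_def)
    qed simp
    obtain c where c: "v = emeasure lborel A + ennreal c" "0 \<le> c"
    proof -
      have "v = emeasure lborel A + (v - emeasure lborel A)"
        using v(1) by (simp add: add_diff_inverse_ennreal)
      moreover have "v - emeasure lborel A < \<top>" by (rule le_less_trans[OF diff_le_self_ennreal v(3)])
      ultimately show thesis using that by (cases "v - emeasure lborel A") auto
    qed
    have eB: "emeasure lborel B = emeasure lborel A + emeasure lborel C"
    proof -
      have "B = A \<union> (C \<inter> UNIV)" using AB by (auto simp: C_def)
      then show ?thesis using add[of UNIV] by simp
    qed
    have "ennreal c < emeasure lborel C"
    proof (rule ccontr)
      assume "\<not> ennreal c < emeasure lborel C"
      then have "emeasure lborel B \<le> v" unfolding eB c(1) by (intro add_left_mono) (simp add: not_less)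
      with v(2) False show False by simp
    qed
    also have "emeasure lborel C = (SUP n::nat. emeasure lborel (C \<inter> rball (ennreal (real n))))"
    proof (subst SUP_emeasure_incseq)
      show "incseq (\<lambda>n. C \<inter> rball (ennreal (real n)))"
        by (intro incseq_SucI Int_mono rball_mono ennreal_leI) auto
      have sup: "(SUP n. ennreal (real n)) = \<top>"
        using ennreal_SUP_of_nat_eq_top by (simp only: ennreal_of_nat_eq_real_of_nat)
      have "(\<Union>n. rball (ennreal (real n))) = (rball (SUP n. ennreal (real n)) :: 'a set)"
        by (rule rball_UN_incseq) (auto intro: incseq_SucI ennreal_leI)
      then have "(\<Union>n. rball (ennreal (real n))) = (UNIV :: 'a set)"
        by (simp only: sup rball_top)
      then have "(\<Union>n. C \<inter> rball (ennreal (real n))) = C" by blast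
      then show "emeasure lborel C = emeasure lborel (\<Union>n. C \<inter> rball (ennreal (real n)))" by simp
    qed auto
    finally obtain n :: nat where "c < H (real n)"
      unfolding less_SUP_iff eH using c(2) by (auto simp: ennreal_less_iff)
    moreover have "H 0 = 0" by (simp add: H_def)
    ultimately obtain w where "H w = c"
      using IVT'[of H 0 c "real n"] continuous_on_subset[OF cont, of "{0..real n}"] c(2) by auto
    then show thesis
      using that[of "A \<union> (C \<inter> rball (ennreal w))"] AB add[of "rball (ennreal w)"] c(1) eH[of w] by (auto simp: C_def)
  qed
qed

text \<open>For radially decreasing \<open>G\<close> this is the Hardy-Littlewood-Polya order: the
  largest integral of \<open>g\<close> over sets of a given volume is compared with that of
  \<open>G\<close>.\<close>

definition weakly_majorized :: "('a::euclidean_space \<Rightarrow> ennreal) \<Rightarrow> ('a \<Rightarrow> ennreal) \<Rightarrow> bool" where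
  "weakly_majorized g G \<longleftrightarrow> (\<forall>E. E \<in> sets borel \<longrightarrow> emeasure lborel E < \<top> \<longrightarrow>
     (\<integral>\<^sup>+ x. indicator E x * g x \<partial>lborel) \<le> (\<integral>\<^sup>+ x. indicator (rball (emeasure lborel E)) x * G x \<partial>lborel))"

lemma weakly_majorizedD:
  "weakly_majorized g G \<Longrightarrow> E \<in> sets borel \<Longrightarrow> emeasure lborel E < \<top> \<Longrightarrow>
   (\<integral>\<^sup>+ x. indicator E x * g x \<partial>lborel) \<le> (\<integral>\<^sup>+ x. indicator (rball (emeasure lborel E)) x * G x \<partial>lborel)"
  by (auto simp: weakly_majorized_def)

lemma nn_integral_rball_mono:
  "v \<le> w \<Longrightarrow> (\<integral>\<^sup>+ x. indicator (rball v) x * G x \<partial>lborel) \<le> (\<integral>\<^sup>+ x. indicator (rball w) x * (G x::ennreal) \<partial>lborel)"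
  by (intro nn_integral_mono mult_right_mono) (use rball_mono[of v w] in \<open>auto split: split_indicator\<close>)

lemma nn_integral_superlevels:
  fixes g :: "'a::euclidean_space \<Rightarrow> ennreal"
  assumes [measurable]: "g \<in> borel_measurable borel" "E \<in> sets borel"
  shows "(\<integral>\<^sup>+ x. indicator E x * g x \<partial>lborel) = (\<integral>\<^sup>+ s. emeasure lborel (E \<inter> {x. ennreal s < g x}) \<partial>levels)"
proof -
  have "(\<integral>\<^sup>+ x. indicator E x * g x \<partial>lborel) = (\<integral>\<^sup>+ s. \<integral>\<^sup>+ x. indicator E x * indicator {x. ennreal s < g x} x \<partial>lborel \<partial>levels)"
    by (rule layer_cake_weighted) (auto intro: sigma_finite_lborel)
  also have "\<dots> = (\<integral>\<^sup>+ s. emeasure lborel (E \<inter> {x. ennreal s < g x}) \<partial>levels)"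
    by (intro nn_integral_cong) (simp flip: indicator_inter_arith)
  finally show ?thesis .
qed

text \<open>The choice \<open>{g > s\<^sub>0} \<subseteq> E \<subseteq> {g > s}\<close> with \<open>E\<close> of volume \<open>v\<close> and \<open>s\<close> close to the level \<open>s\<^sub>0\<close> at
  which the superlevel sets shrink below \<open>v\<close> nearly maximizes the integral of \<open>g\<close> among sets of
  volume \<open>v\<close>.\<close>

lemma weakly_majorized_levels_finite:
  fixes g G :: "'a::euclidean_space \<Rightarrow> ennreal"
  assumes maj: "weakly_majorized g G" and [measurable]: "g \<in> borel_measurable borel" and v: "v < \<top>"
  shows "(\<integral>\<^sup>+ s. min (emeasure lborel {x. ennreal s < g x}) v \<partial>levels) \<le> (\<integral>\<^sup>+ x. indicator (rball v) x * G x \<partial>lborel)"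
proof -
  define N where "N s = emeasure lborel {x. ennreal s < g x}" for s
  let ?R = "\<integral>\<^sup>+ x. indicator (rball v) x * G x \<partial>lborel"
  have Nmeas [measurable]: "N \<in> borel_measurable borel"
    using superlevel_measurable[OF sigma_finite_lborel, of g] by (simp add: N_def[abs_def])
  have le_R: "(\<integral>\<^sup>+ s. emeasure lborel (E \<inter> {x. ennreal s < g x}) \<partial>levels) \<le> ?R"
    if E[measurable]: "E \<in> sets borel" and "emeasure lborel E \<le> v" for E
  proof -
    have "emeasure lborel E < \<top>" using that v by (meson le_less_trans)
    from weakly_majorizedD[OF maj E this]
    show ?thesis using nn_integral_rball_mono[OF that(2), of G] by (simp add: nn_integral_superlevels)
  qed
  have anti: "{x. ennreal s < g x} \<subseteq> {x. ennreal r < g x}" if "r \<le> s" for r s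
    using that by (auto intro: le_less_trans ennreal_leI)
  show "(\<integral>\<^sup>+ s. min (N s) v \<partial>levels) \<le> ?R"
  proof (cases "\<exists>s>0. N s \<le> v")
    \<comment> \<open>All superlevel sets at positive levels have volume above \<open>v\<close>.
      Then \<open>g\<close> exceeds any \<open>T\<close> on a set of volume \<open>v\<close>, which
      makes the right side infinite unless \<open>v = 0\<close>.\<close>
    case False
    then have big: "v \<le> N s" if "0 < s" for s using that by (auto intro: less_imp_le)
    show ?thesis
    proof (cases "v = 0")
      case True then show ?thesis by simp
    next
      case v0: False
      have lower: "ennreal T * v \<le> ?R" if T: "0 < T" for T
      proof -
        obtain E where E: "E \<in> sets borel" "E \<subseteq> {x. ennreal T < g x}" "emeasure lborel E = v"
        proof (rule intermediate_set[of "{}" "{x. ennreal T < g x}" v])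
          show "v \<le> emeasure lborel {x. ennreal T < g x}" using big[OF T] by (simp add: N_def)
        qed (use v that in auto)
        have "ennreal T * v = (\<integral>\<^sup>+ x. indicator E x * ennreal T \<partial>lborel)"
          using E by (subst nn_integral_multc) (simp_all add: mult.commute)
        also have "\<dots> \<le> (\<integral>\<^sup>+ x. indicator E x * g x \<partial>lborel)"
          using E(2) by (intro nn_integral_mono) (auto split: split_indicator intro: less_imp_le)
        also have "\<dots> \<le> ?R" using weakly_majorizedD[OF maj E(1)] E(3) v by simp
        finally show ?thesis .
      qed
      have "?R = \<top>"
      proof (rule ccontr)
        assume "?R \<noteq> \<top>"
        then obtain R where R: "?R = ennreal R" "0 \<le> R" by (cases ?R) auto
        obtain w where w: "v = ennreal w" "0 < w" using v v0 by (cases v) (auto simp: zero_less_iff_neq_zero)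
        have "ennreal ((R + 1) / w * w) \<le> ennreal R"
          using lower[of "(R + 1) / w"] R w by (subst ennreal_mult) simp_all
        moreover have "(R + 1) / w * w = R + 1" using w by simp
        ultimately have "ennreal (R + 1) \<le> ennreal R" by (simp only:)
        then show False using R by (simp add: ennreal_le_iff del: ennreal_plus)
      qed
      then show ?thesis by simp
    qed
  next
    case True
    define U where "U = {s. 0 < s \<and> N s \<le> v}"
    define s0 where "s0 = Inf U"
    have U: "U \<noteq> {}" "bdd_below U" using True by (auto simp: U_def intro!: bdd_belowI[of _ 0] less_imp_le)
    have s0: "0 \<le> s0" unfolding s0_def using U by (intro cInf_greatest) (auto simp: U_def)
    have above: "N s \<le> v" if "s0 < s" for s
    proof -
      have "\<exists>r\<in>U. r < s" using that unfolding s0_def cInf_less_iff[OF U] .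
      then obtain r where "r \<in> U" "r < s" by blast
      then show ?thesis unfolding U_def N_def using emeasure_mono[OF anti[of r s], of lborel] by auto
    qed
    have below: "v \<le> N s" if "0 < s" "s < s0" for s
    proof (rule ccontr)
      assume "\<not> v \<le> N s"
      then have "s \<in> U" using that by (auto simp: U_def)
      then have "s0 \<le> s" unfolding s0_def using U by (intro cInf_lower) auto
      then show False using that by simp
    qed
    \<comment> \<open>Right continuity of the distribution function \<open>N\<close>: superlevel
      sets increase as the level decreases to \<open>s0\<close>, so the bound persists at
      \<open>s0\<close> itself.\<close>
    have at: "N s0 \<le> v"
    proof -
      have "{x. ennreal s0 < g x} = (\<Union>n::nat. {x. ennreal (s0 + 1 / real (Suc n)) < g x})"
      proof (intro equalityI subsetI)
        fix x assume "x \<in> {x. ennreal s0 < g x}"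
        then obtain r where r: "ennreal s0 < r" "r < g x" using dense by auto
        then obtain r' where r': "r = ennreal r'" "0 \<le> r'" by (cases r) auto
        then have "0 < r' - s0" using r s0 by (simp add: ennreal_less_iff)
        then obtain n :: nat where "inverse (real (Suc n)) < r' - s0" using reals_Archimedean by blast
        then have "1 / real (Suc n) < r' - s0" by (simp only: inverse_eq_divide)
        then have "ennreal (s0 + 1 / real (Suc n)) \<le> r" unfolding r' by (intro ennreal_leI) simp
        then show "x \<in> (\<Union>n::nat. {x. ennreal (s0 + 1 / real (Suc n)) < g x})" using r by (auto intro: le_less_trans)
      next
        fix x assume "x \<in> (\<Union>n::nat. {x. ennreal (s0 + 1 / real (Suc n)) < g x})"
        then obtain n :: nat where "x \<in> {x. ennreal (s0 + 1 / real (Suc n)) < g x}" by blast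
        then show "x \<in> {x. ennreal s0 < g x}" using anti[of s0 "s0 + 1 / real (Suc n)"] by auto
      qed
      then have "N s0 = emeasure lborel (\<Union>n::nat. {x. ennreal (s0 + 1 / real (Suc n)) < g x})" by (simp add: N_def)
      also have "\<dots> = (SUP n. N (s0 + 1 / real (Suc n)))"
        unfolding N_def
        by (rule SUP_emeasure_incseq[symmetric])
           (auto intro!: incseq_SucI anti divide_left_mono)
      also have "\<dots> \<le> v" by (intro SUP_least above) simp
      finally show ?thesis .
    qed
    have approx: "(\<integral>\<^sup>+ s. min (N s) v \<partial>levels) \<le> ?R + v * ennreal (s0 - s)"
      if s: "0 < s" "s < s0 \<or> s0 = 0 \<and> s \<le> s0" for s
    proof -
      have s: "0 < s" "s < s0" using s by auto
      obtain E where E[measurable]: "E \<in> sets borel" and sub: "{x. ennreal s0 < g x} \<subseteq> E" "E \<subseteq> {x. ennreal s < g x}"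
        and Ev: "emeasure lborel E = v"
      proof (rule intermediate_set[of "{x. ennreal s0 < g x}" "{x. ennreal s < g x}" v])
        show "{x. ennreal s0 < g x} \<subseteq> {x. ennreal s < g x}" using s by (intro anti) simp
        show "emeasure lborel {x. ennreal s0 < g x} \<le> v" using at by (simp add: N_def)
        show "v \<le> emeasure lborel {x. ennreal s < g x}" using below[OF s] by (simp add: N_def)
      qed (use v that in auto)
      \<comment> \<open>For levels below \<open>s\<close> the superlevel set contains
        \<open>E\<close>, for levels above \<open>s0\<close> it is contained in \<open>E\<close>; in
        both cases the minimum is captured. Each level in between costs at most
        \<open>v\<close>.\<close>
      have "(\<integral>\<^sup>+ r. min (N r) v \<partial>levels) \<le> (\<integral>\<^sup>+ r. emeasure lborel (E \<inter> {x. ennreal r < g x}) + v * indicator {s..s0} r \<partial>levels)"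
      proof (rule nn_integral_mono)
        fix r
        consider "r < s" | "s0 < r" | "s \<le> r" "r \<le> s0" by linarith
        then show "min (N r) v \<le> emeasure lborel (E \<inter> {x. ennreal r < g x}) + v * indicator {s..s0} r"
        proof cases
          case 1
          then have "E \<inter> {x. ennreal r < g x} = E" using sub anti[of r s] by auto
          then show ?thesis using Ev by (simp add: add_increasing2 min.coboundedI2)
        next
          case 2
          then have "E \<inter> {x. ennreal r < g x} = {x. ennreal r < g x}" using sub anti[of s0 r] by auto
          then show ?thesis by (simp add: N_def add_increasing2 min.coboundedI1)
        next
          case 3
          then show ?thesis by (simp add: add_increasing min.coboundedI2)
        qed
      qed
      also have "\<dots> = (\<integral>\<^sup>+ r. emeasure lborel (E \<inter> {x. ennreal r < g x}) \<partial>levels) + (\<integral>\<^sup>+ r. v * indicator {s..s0} r \<partial>levels)"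
      proof (rule nn_integral_add)
        have "(\<lambda>r. \<integral>\<^sup>+ x. indicator E x * indicator {x. ennreal r < g x} x \<partial>lborel) \<in> borel_measurable levels"
          unfolding indicator_def by measurable
        then show "(\<lambda>r. emeasure lborel (E \<inter> {x. ennreal r < g x})) \<in> borel_measurable levels"
          by (simp flip: indicator_inter_arith)
      qed measurable
      also have "(\<integral>\<^sup>+ r. v * indicator {s..s0} r \<partial>levels) \<le> v * ennreal (s0 - s)"
      proof -
        have "emeasure levels {s..s0} = (\<integral>\<^sup>+ r. indicator {0<..} r * indicator {s..s0} r \<partial>lborel)"
          unfolding levels_def by (subst emeasure_density) auto
        also have "\<dots> \<le> (\<integral>\<^sup>+ r. indicator {s..s0} r \<partial>lborel)"
          by (intro nn_integral_mono) (auto split: split_indicator)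
        also have "\<dots> = ennreal (s0 - s)" using s by simp
        finally have le: "emeasure levels {s..s0} \<le> ennreal (s0 - s)" .
        have "(\<integral>\<^sup>+ r. v * indicator {s..s0} r \<partial>levels) = v * emeasure levels {s..s0}"
          by (rule nn_integral_cmult_indicator) simp
        also have "\<dots> \<le> v * ennreal (s0 - s)" by (rule mult_left_mono[OF le]) simp
        finally show ?thesis .
      qed
      also have "(\<integral>\<^sup>+ r. emeasure lborel (E \<inter> {x. ennreal r < g x}) \<partial>levels) \<le> ?R"
        by (rule le_R) (simp_all add: Ev)
      finally show ?thesis by (simp add: add_mono)
    qed
    show ?thesis
    proof (cases "s0 = 0")
      \<comment> \<open>There are no levels below \<open>s0\<close> to approximate from. The set
        where \<open>g\<close> is positive has volume at most \<open>v\<close> by \<open>at\<close>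
        and serves as \<open>E\<close> without any loss.\<close>
      case True
      have "(\<integral>\<^sup>+ r. min (N r) v \<partial>levels) \<le> (\<integral>\<^sup>+ r. emeasure lborel ({x. ennreal 0 < g x} \<inter> {x. ennreal r < g x}) \<partial>levels)"
        using AE_levels
      proof (intro nn_integral_mono_AE, eventually_elim)
        case (elim r)
        then have "{x. ennreal 0 < g x} \<inter> {x. ennreal r < g x} = {x. ennreal r < g x}" using anti[of 0 r] by auto
        then show ?case by (simp add: N_def)
      qed
      also have "\<dots> \<le> ?R" by (rule le_R) (use at True in \<open>simp_all add: N_def\<close>)
      finally show ?thesis .
    next
      case False
      obtain w where w: "v = ennreal w" "0 \<le> w" using v by (cases v) auto
      show ?thesis
      proof (rule ennreal_le_epsilon)
        fix e :: real assume e: "0 < e"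
        \<comment> \<open>At least \<open>s0 / 2\<close>, hence positive, and so close to
          \<open>s0\<close> that the loss \<open>w * (s0 - s)\<close> is at most \<open>e\<close>.
          The summand 1 in the denominator covers \<open>w = 0\<close>.\<close>
        define s where "s = max (s0 / 2) (s0 - e / (w + 1))"
        have s: "0 < s" "s < s0" using False s0 e w by (auto simp: s_def)
        have "w * (s0 - s) \<le> w * (e / (w + 1))" using w by (intro mult_left_mono) (auto simp: s_def)
        also have "\<dots> \<le> e" using w e by (simp add: field_simps)
        finally have "v * ennreal (s0 - s) \<le> ennreal e"
          unfolding w(1) using w(2) s by (simp add: ennreal_mult[symmetric] ennreal_leI)
        with approx[of s] s show "(\<integral>\<^sup>+ s. min (N s) v \<partial>levels) \<le> ?R + ennreal e"
          by (auto intro: order_trans add_left_mono)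
      qed
    qed
  qed
qed

text \<open>Majorization speaks of sets of finite volume, so infinite \<open>v\<close> is reached by
  exhausting the space with balls.\<close>

lemma weakly_majorized_levels:
  fixes g G :: "'a::euclidean_space \<Rightarrow> ennreal"
  assumes maj: "weakly_majorized g G" and [measurable]: "g \<in> borel_measurable borel"
  shows "(\<integral>\<^sup>+ s. min (emeasure lborel {x. ennreal s < g x}) v \<partial>levels) \<le> (\<integral>\<^sup>+ x. indicator (rball v) x * G x \<partial>lborel)"
proof (cases "v = \<top>")
  case False
  then show ?thesis by (intro weakly_majorized_levels_finite assms) (simp add: less_top[symmetric])
next
  case True
  have "(\<integral>\<^sup>+ s. emeasure lborel {x. ennreal s < g x} \<partial>levels) = (\<integral>\<^sup>+ x. g x \<partial>lborel)"
    using layer_cake[OF sigma_finite_lborel, of g] by simp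
  also have "\<dots> \<le> (\<integral>\<^sup>+ x. liminf (\<lambda>n. indicator (ball 0 (real n)) x * g x) \<partial>lborel)"
    by (intro nn_integral_mono Liminf_ball_exhaust)
  also have "\<dots> \<le> liminf (\<lambda>n. \<integral>\<^sup>+ x. indicator (ball 0 (real n)) x * g x \<partial>lborel)"
    by (intro nn_integral_liminf) measurable
  also have "\<dots> \<le> limsup (\<lambda>n. \<integral>\<^sup>+ x. indicator (ball 0 (real n)) x * g x \<partial>lborel)"
    by (rule Liminf_le_Limsup) simp
  also have "\<dots> \<le> (\<integral>\<^sup>+ x. G x \<partial>lborel)"
  proof (rule Limsup_bounded, rule always_eventually, rule allI)
    fix n
    have "(\<integral>\<^sup>+ x. indicator (ball 0 (real n)) x * g x \<partial>lborel) \<le>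
        (\<integral>\<^sup>+ x. indicator (rball (emeasure lborel (ball 0 (real n) :: 'a set))) x * G x \<partial>lborel)"
      by (rule weakly_majorizedD[OF maj]) (simp_all add: emeasure_lborel_ball_finite borel_open)
    also have "\<dots> \<le> (\<integral>\<^sup>+ x. G x \<partial>lborel)"
      by (intro nn_integral_mono) (auto split: split_indicator)
    finally show "(\<integral>\<^sup>+ x. indicator (ball 0 (real n)) x * g x \<partial>lborel) \<le> (\<integral>\<^sup>+ x. G x \<partial>lborel)" .
  qed
  finally show ?thesis by (simp add: True min_top)
qed

section \<open>Averages over random shifts\<close>

text \<open>The Markov operator of adding an independent increment of law
  \<open>\<mu>\<close>.\<close>

definition shift_avg :: "'a::euclidean_space measure \<Rightarrow> ('a \<Rightarrow> ennreal) \<Rightarrow> 'a \<Rightarrow> ennreal" where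
  "shift_avg \<mu> g x = (\<integral>\<^sup>+ u. g (x + u) \<partial>\<mu>)"

definition overlap :: "'a::euclidean_space set \<Rightarrow> 'a set \<Rightarrow> 'a \<Rightarrow> ennreal" where
  "overlap E F u = (\<integral>\<^sup>+ x. indicator E x * indicator F (x + u) \<partial>lborel)"

text \<open>The Riesz inequality with measures in place of one of the three functions, so that point
  masses and degenerate Gaussian laws are covered.\<close>

definition symm_dominated :: "'a::euclidean_space measure \<Rightarrow> 'a measure \<Rightarrow> bool" where
  "symm_dominated \<mu> \<mu>' \<longleftrightarrow> (\<forall>E F. E \<in> sets borel \<longrightarrow> F \<in> sets borel \<longrightarrow>
     emeasure lborel E < \<top> \<longrightarrow> emeasure lborel F < \<top> \<longrightarrow>
     (\<integral>\<^sup>+ u. overlap E F u \<partial>\<mu>) \<le>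
     (\<integral>\<^sup>+ u. overlap (rball (emeasure lborel E)) (rball (emeasure lborel F)) u \<partial>\<mu>'))"

text \<open>A substitute for a radially decreasing density that also applies to a point mass at the
  origin: the mass of a ball of fixed volume shrinks as its centre \<open>- x\<close> moves
  outwards.\<close>

definition unimodal :: "'a::euclidean_space measure \<Rightarrow> bool" where
  "unimodal \<mu> \<longleftrightarrow> (\<forall>v. radially_decreasing (\<lambda>x. emeasure \<mu> {u. x + u \<in> rball v}))"

lemma overlap_measurable [measurable]:
  assumes [measurable]: "E \<in> sets borel" "F \<in> sets borel"
  shows "overlap E F \<in> borel_measurable borel"
  unfolding overlap_def[abs_def] by measurable

lemma overlap_mono: "E \<subseteq> E' \<Longrightarrow> F \<subseteq> F' \<Longrightarrow> overlap E F u \<le> overlap E' F' u"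
  unfolding overlap_def by (intro nn_integral_mono mult_mono) (auto split: split_indicator)

locale borel_finite = finite_measure \<mu> for \<mu> :: "'a::euclidean_space measure" +
  assumes sets_eq [measurable_cong, simp]: "sets \<mu> = sets borel"
begin

lemma space_eq [simp]: "space \<mu> = UNIV"
  using sets_eq_imp_space_eq[OF sets_eq] by simp

lemma shift_avg_measurable [measurable]:
  "g \<in> borel_measurable borel \<Longrightarrow> shift_avg \<mu> g \<in> borel_measurable borel"
proof -
  assume [measurable]: "g \<in> borel_measurable borel"
  show ?thesis unfolding shift_avg_def[abs_def] by measurable
qed

end

text \<open>Superlevel sets of an averaged function may have infinite volume, so \<open>F\<close> is
  exhausted here by sets of finite volume.\<close>

lemma symm_dominatedD:
  assumes dom: "symm_dominated \<mu> \<mu>'" and "borel_finite \<mu>"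
    and [measurable]: "E \<in> sets borel" "F \<in> sets borel" and E: "emeasure lborel E < \<top>"
  shows "(\<integral>\<^sup>+ u. overlap E F u \<partial>\<mu>) \<le>
     (\<integral>\<^sup>+ u. overlap (rball (emeasure lborel E)) (rball (emeasure lborel F)) u \<partial>\<mu>')"
proof -
  interpret \<mu>: borel_finite \<mu> by fact
  define b where "b n = (ball 0 (real n) :: 'a set)" for n
  have [measurable]: "b n \<in> sets borel" for n by (simp add: b_def sets_ball_borel)
  have "(\<integral>\<^sup>+ u. overlap E F u \<partial>\<mu>) \<le> (\<integral>\<^sup>+ u. liminf (\<lambda>n. overlap E (F \<inter> b n) u) \<partial>\<mu>)"
  proof (rule nn_integral_mono)
    fix u
    have "overlap E F u \<le> (\<integral>\<^sup>+ x. liminf (\<lambda>n. indicator E x * indicator (F \<inter> b n) (x + u)) \<partial>lborel)"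
      unfolding overlap_def
    proof (rule nn_integral_mono)
      fix x
      have "(indicator E x * indicator F (x + u) :: ennreal) \<le> liminf (\<lambda>n. indicator (b n) (x + u) * (indicator E x * indicator F (x + u)))"
        using Liminf_ball_exhaust[of "\<lambda>y. indicator E (y - u) * indicator F y" "x + u"] by (simp add: b_def)
      also have "\<dots> = liminf (\<lambda>n. indicator E x * indicator (F \<inter> b n) (x + u))"
        by (intro arg_cong[where f=liminf] ext) (auto split: split_indicator)
      finally show "(indicator E x * indicator F (x + u) :: ennreal) \<le> \<dots>" .
    qed
    also have "\<dots> \<le> liminf (\<lambda>n. overlap E (F \<inter> b n) u)"
      unfolding overlap_def by (rule nn_integral_liminf) measurable
    finally show "overlap E F u \<le> \<dots>" .
  qed
  also have "\<dots> \<le> liminf (\<lambda>n. \<integral>\<^sup>+ u. overlap E (F \<inter> b n) u \<partial>\<mu>)"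
    by (rule nn_integral_liminf) measurable
  also have "\<dots> \<le> limsup (\<lambda>n. \<integral>\<^sup>+ u. overlap E (F \<inter> b n) u \<partial>\<mu>)"
    by (rule Liminf_le_Limsup) simp
  also have "\<dots> \<le> (\<integral>\<^sup>+ u. overlap (rball (emeasure lborel E)) (rball (emeasure lborel F)) u \<partial>\<mu>')"
  proof (rule Limsup_bounded, rule always_eventually, rule allI)
    fix n
    have "emeasure lborel (F \<inter> b n) \<le> emeasure lborel (b n)" by (rule emeasure_mono) auto
    also have "\<dots> < \<top>" by (simp add: b_def)
    finally have "(\<integral>\<^sup>+ u. overlap E (F \<inter> b n) u \<partial>\<mu>) \<le>
      (\<integral>\<^sup>+ u. overlap (rball (emeasure lborel E)) (rball (emeasure lborel (F \<inter> b n))) u \<partial>\<mu>')"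
      using dom E by (auto simp: symm_dominated_def)
    also have "\<dots> \<le> (\<integral>\<^sup>+ u. overlap (rball (emeasure lborel E)) (rball (emeasure lborel F)) u \<partial>\<mu>')"
      by (intro nn_integral_mono overlap_mono rball_mono emeasure_mono) auto
    finally show "(\<integral>\<^sup>+ u. overlap E (F \<inter> b n) u \<partial>\<mu>) \<le> \<dots>" .
  qed
  finally show ?thesis .
qed

lemma emeasure_rball_Int_radial:
  fixes S :: "'a::euclidean_space set"
  assumes [measurable]: "S \<in> sets borel" and S: "\<And>x y. x \<in> S \<Longrightarrow> norm y \<le> norm x \<Longrightarrow> y \<in> S"
  shows "emeasure lborel (rball v \<inter> S) = min v (emeasure lborel S)"
proof (rule antisym)
  show "emeasure lborel (rball v \<inter> S) \<le> min v (emeasure lborel S)"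
    using emeasure_mono[of "rball v \<inter> S" "rball v" lborel] emeasure_mono[of "rball v \<inter> S" S lborel] by simp
  have "min v (emeasure lborel S) = emeasure lborel (rball v \<inter> rball (emeasure lborel S) :: 'a set)"
    by (simp add: rball_Int)
  also have "\<dots> \<le> emeasure lborel (rball v \<inter> S)"
  proof (rule emeasure_mono)
    have "rball (emeasure lborel S) \<subseteq> S" by (rule radial_set_rball(1)[OF assms])
    then show "rball v \<inter> rball (emeasure lborel S) \<subseteq> rball v \<inter> S" by blast
  qed simp
  finally show "min v (emeasure lborel S) \<le> emeasure lborel (rball v \<inter> S)" .
qed

lemma radially_decreasing_superlevel:
  "radially_decreasing K \<Longrightarrow> x \<in> {x. t < K x} \<Longrightarrow> norm y \<le> norm x \<Longrightarrow> y \<in> {x. t < K x}"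
  using radially_decreasingD[of K y x] by (auto intro: less_le_trans)

text \<open>Domination replaces \<open>E\<close> and the superlevel sets of \<open>g\<close> by
  balls. Averaging \<open>E'\<close> over \<open>\<mu>'\<close> gives the radially decreasing
  function \<open>K\<close>, and concentric balls meet in the smaller one, which leaves a double
  integral of \<open>min (N s) (M t)\<close>. Integrating over \<open>s\<close> first, at fixed
  \<open>t\<close>, is the point where majorization of \<open>g\<close> by \<open>G\<close> enters;
  the layers of \<open>K\<close> are then put together again.\<close>

theorem weakly_majorized_shift_avg:
  fixes \<mu> \<mu>' :: "'a::euclidean_space measure"
  assumes \<mu>: "borel_finite \<mu>" and \<mu>': "borel_finite \<mu>'" and dom: "symm_dominated \<mu> \<mu>'" and uni: "unimodal \<mu>'"
    and [measurable]: "g \<in> borel_measurable borel" and maj: "weakly_majorized g G" and G: "radially_decreasing G"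
  shows "weakly_majorized (shift_avg \<mu> g) (shift_avg \<mu>' G)"
  unfolding weakly_majorized_def
proof (intro allI impI)
  interpret \<mu>: borel_finite \<mu> by fact
  interpret \<mu>': borel_finite \<mu>' by fact
  interpret P: pair_sigma_finite lborel \<mu> ..
  interpret P': pair_sigma_finite lborel \<mu>' ..
  interpret L: pair_sigma_finite levels \<mu> ..
  interpret LL: pair_sigma_finite levels levels ..
  have [measurable]: "G \<in> borel_measurable borel" by (rule radially_decreasing_measurable[OF G])
  fix E :: "'a set" assume E[measurable]: "E \<in> sets borel" and fin: "emeasure lborel E < \<top>"
  define E' where "E' = (rball (emeasure lborel E) :: 'a set)"
  have [measurable]: "E' \<in> sets borel" by (simp add: E'_def)
  define N where "N s = emeasure lborel {x. ennreal s < g x}" for s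
  have [measurable]: "N \<in> borel_measurable borel"
    using superlevel_measurable[OF sigma_finite_lborel, of g] by (simp add: N_def[abs_def])
  \<comment> \<open>\<open>K\<close> moves the average from the function to the ball
    \<open>E'\<close>. Its reflection is a function of the kind in \<open>unimodal\<close>, and the
    sign is harmless because only norms matter.\<close>
  define K where "K y = (\<integral>\<^sup>+ u. indicator E' (y - u) \<partial>\<mu>')" for y
  have [measurable]: "K \<in> borel_measurable borel" unfolding K_def[abs_def] by measurable
  have K: "radially_decreasing K"
  proof -
    have "K y = emeasure \<mu>' {u. - y + u \<in> rball (emeasure lborel E)}" for y
    proof -
      have "K y = (\<integral>\<^sup>+ u. indicator {u. - y + u \<in> rball (emeasure lborel E)} u \<partial>\<mu>')"
        unfolding K_def E'_def
        by (intro nn_integral_cong) (auto split: split_indicator simp: rball_minus_commute[of y])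
      then show ?thesis by simp
    qed
    moreover have "radially_decreasing (\<lambda>x. emeasure \<mu>' {u. x + u \<in> rball (emeasure lborel E)})"
      using uni by (simp add: unimodal_def)
    ultimately show ?thesis unfolding radially_decreasing_def by (metis norm_minus_cancel)
  qed
  define M where "M s = emeasure lborel {x. ennreal s < K x}" for s
  have [measurable]: "M \<in> borel_measurable borel"
    using superlevel_measurable[OF sigma_finite_lborel, of K] by (simp add: M_def[abs_def])
  have flip: "(\<integral>\<^sup>+ u. \<integral>\<^sup>+ x. indicator E' x * h (x + u) \<partial>lborel \<partial>\<mu>') = (\<integral>\<^sup>+ y. h y * K y \<partial>lborel)"
    if [measurable]: "h \<in> borel_measurable borel" for h :: "'a \<Rightarrow> ennreal"
  proof -
    have "(\<integral>\<^sup>+ u. \<integral>\<^sup>+ x. indicator E' x * h (x + u) \<partial>lborel \<partial>\<mu>') = (\<integral>\<^sup>+ u. \<integral>\<^sup>+ y. indicator E' (y - u) * h y \<partial>lborel \<partial>\<mu>')"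
    proof (rule nn_integral_cong)
      fix u :: 'a
      show "(\<integral>\<^sup>+ x. indicator E' x * h (x + u) \<partial>lborel) = (\<integral>\<^sup>+ y. indicator E' (y - u) * h y \<partial>lborel)"
        using nn_integral_lborel_translate[of "\<lambda>y. indicator E' (y - u) * h y" u] by (simp add: add.commute)
    qed
    also have "\<dots> = (\<integral>\<^sup>+ y. \<integral>\<^sup>+ u. indicator E' (y - u) * h y \<partial>\<mu>' \<partial>lborel)"
      by (rule P'.Fubini') measurable
    also have "\<dots> = (\<integral>\<^sup>+ y. h y * K y \<partial>lborel)"
      unfolding K_def
    proof (rule nn_integral_cong)
      fix y
      show "(\<integral>\<^sup>+ u. indicator E' (y - u) * h y \<partial>\<mu>') = h y * (\<integral>\<^sup>+ u. indicator E' (y - u) \<partial>\<mu>')"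
        by (subst nn_integral_multc) (simp_all add: mult.commute)
    qed
    finally show ?thesis .
  qed
  have "(\<integral>\<^sup>+ x. indicator E x * shift_avg \<mu> g x \<partial>lborel) = (\<integral>\<^sup>+ x. \<integral>\<^sup>+ u. indicator E x * g (x + u) \<partial>\<mu> \<partial>lborel)"
    unfolding shift_avg_def by (intro nn_integral_cong nn_integral_cmult[symmetric]) measurable
  also have "\<dots> = (\<integral>\<^sup>+ u. \<integral>\<^sup>+ x. indicator E x * g (x + u) \<partial>lborel \<partial>\<mu>)"
    by (rule P.Fubini'[symmetric]) measurable
  also have "\<dots> = (\<integral>\<^sup>+ u. \<integral>\<^sup>+ s. overlap E {x. ennreal s < g x} u \<partial>levels \<partial>\<mu>)"
    unfolding overlap_def
    by (intro nn_integral_cong, subst layer_cake_weighted) (auto intro: sigma_finite_lborel simp: indicator_def)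
  also have "\<dots> = (\<integral>\<^sup>+ s. \<integral>\<^sup>+ u. overlap E {x. ennreal s < g x} u \<partial>\<mu> \<partial>levels)"
    unfolding overlap_def indicator_def by (rule L.Fubini') measurable
  also have "\<dots> \<le> (\<integral>\<^sup>+ s. \<integral>\<^sup>+ u. overlap E' (rball (N s)) u \<partial>\<mu>' \<partial>levels)"
    unfolding E'_def N_def by (intro nn_integral_mono symm_dominatedD[OF dom \<mu> _ _ fin]) measurable
  also have "\<dots> = (\<integral>\<^sup>+ s. \<integral>\<^sup>+ t. min (N s) (M t) \<partial>levels \<partial>levels)"
  proof (rule nn_integral_cong)
    fix s
    have "(\<integral>\<^sup>+ u. overlap E' (rball (N s)) u \<partial>\<mu>') = (\<integral>\<^sup>+ y. indicator (rball (N s)) y * K y \<partial>lborel)"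
      unfolding overlap_def by (rule flip) measurable
    also have "\<dots> = (\<integral>\<^sup>+ t. emeasure lborel (rball (N s) \<inter> {x. ennreal t < K x}) \<partial>levels)"
      by (rule nn_integral_superlevels) measurable
    also have "\<dots> = (\<integral>\<^sup>+ t. min (N s) (M t) \<partial>levels)"
      unfolding M_def
    proof (intro nn_integral_cong emeasure_rball_Int_radial)
      show "y \<in> {x. ennreal t < K x}" if "x \<in> {x. ennreal t < K x}" "norm y \<le> norm x" for t x y
        by (rule radially_decreasing_superlevel[OF K that])
    qed measurable
    finally show "(\<integral>\<^sup>+ u. overlap E' (rball (N s)) u \<partial>\<mu>') = (\<integral>\<^sup>+ t. min (N s) (M t) \<partial>levels)" .
  qed
  also have "\<dots> = (\<integral>\<^sup>+ t. \<integral>\<^sup>+ s. min (N s) (M t) \<partial>levels \<partial>levels)"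
    by (rule LL.Fubini') measurable
  also have "\<dots> \<le> (\<integral>\<^sup>+ t. \<integral>\<^sup>+ y. indicator {x. ennreal t < K x} y * G y \<partial>lborel \<partial>levels)"
  proof (rule nn_integral_mono)
    fix t
    have "(\<integral>\<^sup>+ s. min (N s) (M t) \<partial>levels) \<le> (\<integral>\<^sup>+ x. indicator (rball (M t)) x * G x \<partial>lborel)"
      unfolding N_def by (rule weakly_majorized_levels[OF maj]) measurable
    also have "rball (M t) \<subseteq> {x. ennreal t < K x}"
      unfolding M_def
    proof (rule radial_set_rball(1))
      show "y \<in> {x. ennreal t < K x}" if "x \<in> {x. ennreal t < K x}" "norm y \<le> norm x" for x y
        by (rule radially_decreasing_superlevel[OF K that])
    qed measurable
    then have "(\<integral>\<^sup>+ x. indicator (rball (M t)) x * G x \<partial>lborel) \<le> (\<integral>\<^sup>+ y. indicator {x. ennreal t < K x} y * G y \<partial>lborel)"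
      by (intro nn_integral_mono mult_right_mono) (auto split: split_indicator)
    finally show "(\<integral>\<^sup>+ s. min (N s) (M t) \<partial>levels) \<le> (\<integral>\<^sup>+ y. indicator {x. ennreal t < K x} y * G y \<partial>lborel)" .
  qed
  also have "\<dots> = (\<integral>\<^sup>+ y. G y * K y \<partial>lborel)"
    by (subst layer_cake_weighted) (auto intro: sigma_finite_lborel simp: mult.commute)
  also have "\<dots> = (\<integral>\<^sup>+ u. \<integral>\<^sup>+ x. indicator E' x * G (x + u) \<partial>lborel \<partial>\<mu>')"
    by (rule flip[symmetric]) measurable
  also have "\<dots> = (\<integral>\<^sup>+ x. \<integral>\<^sup>+ u. indicator E' x * G (x + u) \<partial>\<mu>' \<partial>lborel)"
    by (rule P'.Fubini') measurable
  also have "\<dots> = (\<integral>\<^sup>+ x. indicator E' x * shift_avg \<mu>' G x \<partial>lborel)"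
    unfolding shift_avg_def by (intro nn_integral_cong nn_integral_cmult) measurable
  finally show "(\<integral>\<^sup>+ x. indicator E x * shift_avg \<mu> g x \<partial>lborel) \<le>
    (\<integral>\<^sup>+ x. indicator (rball (emeasure lborel E)) x * shift_avg \<mu>' G x \<partial>lborel)"
    by (simp add: E'_def)
qed

text \<open>The second case is a closed ball. It occurs when \<open>S\<close> contains a point of
  the boundary sphere, and then by radiality all of that sphere.\<close>

lemma radial_set_cases:
  fixes S :: "'a::euclidean_space set"
  assumes [measurable]: "S \<in> sets borel" and S: "\<And>x y. x \<in> S \<Longrightarrow> norm y \<le> norm x \<Longrightarrow> y \<in> S"
  obtains v where "S = rball v" | v where "v < \<top>" "S = {x. emeasure lborel (ball 0 (norm x) :: 'a set) \<le> v}"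
proof (cases "S = rball (emeasure lborel S)")
  case True
  then show thesis by (rule that(1))
next
  case False
  have "rball (emeasure lborel S) \<subseteq> S" by (rule radial_set_rball(1)[OF assms])
  with False obtain x where x: "x \<in> S" "x \<notin> rball (emeasure lborel S)" by blast
  have le: "emeasure lborel (ball 0 (norm y) :: 'a set) \<le> emeasure lborel S" if "y \<in> S" for y
  proof (rule emeasure_mono)
    show "ball 0 (norm y) \<subseteq> S" using S[OF that] by auto
  qed simp
  have xv: "emeasure lborel (ball 0 (norm x) :: 'a set) = emeasure lborel S"
    using x(2) le[OF x(1)] by (simp add: rball_def)
  show thesis
  proof (rule that(2)[of "emeasure lborel S"])
    show "emeasure lborel S < \<top>" unfolding xv[symmetric] by simp
    show "S = {x. emeasure lborel (ball 0 (norm x) :: 'a set) \<le> emeasure lborel S}"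
    proof (intro equalityI subsetI CollectI)
      fix y :: 'a assume "y \<in> {x. emeasure lborel (ball 0 (norm x) :: 'a set) \<le> emeasure lborel S}"
      then have "\<not> emeasure lborel (ball 0 (norm x) :: 'a set) < emeasure lborel (ball 0 (norm y) :: 'a set)"
        unfolding xv by (simp add: not_less)
      then have "norm y \<le> norm x" by (simp add: emeasure_lborel_ball_mono_iff)
      then show "y \<in> S" using S x(1) by blast
    qed (rule le)
  qed
qed

text \<open>Superlevel sets may be closed balls, about which \<open>unimodal\<close> says nothing
  directly. A closed ball is a decreasing intersection of open ones, and \<open>\<mu>\<close> is
  finite, so the masses converge from above.\<close>

lemma unimodal_radial_set:
  fixes \<mu> :: "'a::euclidean_space measure"
  assumes \<mu>: "borel_finite \<mu>" and uni: "unimodal \<mu>"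
    and Sm[measurable]: "S \<in> sets borel" and S: "\<And>x y. x \<in> S \<Longrightarrow> norm y \<le> norm x \<Longrightarrow> y \<in> S"
    and xy: "norm y \<le> norm x"
  shows "emeasure \<mu> {u. x + u \<in> S} \<le> emeasure \<mu> {u. y + u \<in> S}"
proof -
  interpret \<mu>: borel_finite \<mu> by fact
  have le: "emeasure \<mu> {u. x + u \<in> rball v} \<le> emeasure \<mu> {u. y + u \<in> rball v}" for v
    using uni xy by (auto simp: unimodal_def radially_decreasing_def)
  show ?thesis
  proof (rule radial_set_cases[OF Sm S])
    fix v assume "S = rball v"
    then show ?thesis using le by simp
  next
    fix v assume v: "v < \<top>" and Sv: "S = {x. emeasure lborel (ball 0 (norm x) :: 'a set) \<le> v}"
    define B where "B n = (rball (v + ennreal (1 / real (Suc n))) :: 'a set)" for n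
    have [measurable]: "B n \<in> sets borel" for n by (simp add: B_def)
    have "S = (\<Inter>n. B n)"
    proof (intro equalityI subsetI)
      fix z :: 'a assume "z \<in> S"
      have less: "v < v + ennreal c" if "0 < c" for c
        using v that by (cases v) (auto simp: ennreal_less_iff simp flip: ennreal_plus)
      have "v < v + ennreal (1 / real (Suc n))" for n by (rule less) simp
      then show "z \<in> (\<Inter>n. B n)" using \<open>z \<in> S\<close> unfolding Sv B_def rball_def by (auto intro: le_less_trans)
    next
      fix z :: 'a assume z: "z \<in> (\<Inter>n. B n)"
      have "emeasure lborel (ball 0 (norm z) :: 'a set) \<le> v"
      proof (rule ennreal_le_epsilon)
        fix e :: real assume "0 < e"
        then obtain n where "inverse (real (Suc n)) < e" using reals_Archimedean by blast
        then have "v + ennreal (1 / real (Suc n)) \<le> v + ennreal e"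
          by (intro add_left_mono ennreal_leI) (simp add: inverse_eq_divide)
        moreover have "emeasure lborel (ball 0 (norm z) :: 'a set) < v + ennreal (1 / real (Suc n))"
          using z by (auto simp: B_def rball_def)
        ultimately show "emeasure lborel (ball 0 (norm z) :: 'a set) \<le> v + ennreal e"
          by (meson less_imp_le order_trans)
      qed
      then show "z \<in> S" by (simp add: Sv)
    qed
    then have eq: "{u. z + u \<in> S} = (\<Inter>n. {u. z + u \<in> B n})" for z by auto
    have inf: "emeasure \<mu> {u. z + u \<in> S} = (INF n. emeasure \<mu> {u. z + u \<in> B n})" for z
      unfolding eq
    proof (rule INF_emeasure_decseq[symmetric])
      show "range (\<lambda>n. {u. z + u \<in> B n}) \<subseteq> sets \<mu>"
      proof (intro image_subsetI)
        fix n show "{u. z + u \<in> B n} \<in> sets \<mu>" by (simp, measurable)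
      qed
      show "decseq (\<lambda>n. {u. z + u \<in> B n})"
      proof (rule decseq_SucI, rule Collect_mono, rule impI)
        fix n u assume "z + u \<in> B (Suc n)"
        moreover have "B (Suc n) \<subseteq> B n" unfolding B_def
          by (intro rball_mono add_left_mono ennreal_leI divide_left_mono) auto
        ultimately show "z + u \<in> B n" by blast
      qed
    qed simp
    show ?thesis unfolding inf
    proof (rule INF_mono)
      fix n show "\<exists>m\<in>UNIV. emeasure \<mu> {u. x + u \<in> B m} \<le> emeasure \<mu> {u. y + u \<in> B n}"
        unfolding B_def by (intro bexI[of _ n] le) simp
    qed
  qed
qed

lemma radially_decreasing_shift_avg:
  fixes \<mu> :: "'a::euclidean_space measure"
  assumes \<mu>: "borel_finite \<mu>" and uni: "unimodal \<mu>" and G: "radially_decreasing G"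
  shows "radially_decreasing (shift_avg \<mu> G)"
  unfolding radially_decreasing_def
proof (intro allI impI)
  interpret \<mu>: borel_finite \<mu> by fact
  have [measurable]: "G \<in> borel_measurable borel" by (rule radially_decreasing_measurable[OF G])
  have eq: "shift_avg \<mu> G x = (\<integral>\<^sup>+ t. emeasure \<mu> {u. x + u \<in> {z. ennreal t < G z}} \<partial>levels)" for x
    unfolding shift_avg_def by (subst layer_cake) (auto intro: \<mu>.sigma_finite_measure_axioms)
  fix x y :: 'a assume xy: "norm y \<le> norm x"
  show "shift_avg \<mu> G x \<le> shift_avg \<mu> G y"
    unfolding eq
  proof (intro nn_integral_mono unimodal_radial_set[OF \<mu> uni])
    show "q \<in> {x. ennreal t < G x}" if "p \<in> {x. ennreal t < G x}" "norm q \<le> norm p" for t p q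
      by (rule radially_decreasing_superlevel[OF G that])
  qed (measurable, rule xy)
qed

section \<open>Products with weights and evaluation at a point\<close>

lemma weakly_majorized_one: "weakly_majorized (\<lambda>_. 1) (\<lambda>_. 1)"
  by (simp add: weakly_majorized_def)

text \<open>Each layer of \<open>f\<close> restricts the integral of \<open>g\<close> to an
  intersection of three sets. The volume of the intersection is at most each of the three volumes,
  so its ball lies in all three balls.\<close>

lemma weakly_majorized_mult:
  fixes f g G :: "'a::euclidean_space \<Rightarrow> ennreal"
  assumes maj: "weakly_majorized g G"
    and [measurable]: "f \<in> borel_measurable borel" "g \<in> borel_measurable borel" "f' \<in> borel_measurable borel" "G \<in> borel_measurable borel" "D \<in> sets borel"
    and f': "\<And>t. 0 \<le> t \<Longrightarrow> {x. ennreal t < f' x} = rball (emeasure lborel {x. ennreal t < f x})"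
  shows "weakly_majorized (\<lambda>x. f x * indicator D x * g x) (\<lambda>x. f' x * indicator (rball (emeasure lborel D)) x * G x)"
  unfolding weakly_majorized_def
proof (intro allI impI)
  fix E :: "'a set" assume [measurable]: "E \<in> sets borel" and fin: "emeasure lborel E < \<top>"
  let ?D = "rball (emeasure lborel D) :: 'a set" and ?E = "rball (emeasure lborel E) :: 'a set"
  have "(\<integral>\<^sup>+ x. indicator E x * (f x * indicator D x * g x) \<partial>lborel) =
      (\<integral>\<^sup>+ x. (indicator E x * indicator D x * g x) * f x \<partial>lborel)"
    by (simp add: ac_simps)
  also have "\<dots> = (\<integral>\<^sup>+ t. \<integral>\<^sup>+ x. (indicator E x * indicator D x * g x) * indicator {x. ennreal t < f x} x \<partial>lborel \<partial>levels)"
    by (rule layer_cake_weighted) (auto intro: sigma_finite_lborel)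
  also have "\<dots> \<le> (\<integral>\<^sup>+ t. \<integral>\<^sup>+ x. (indicator ?E x * indicator ?D x * G x) * indicator {x. ennreal t < f' x} x \<partial>lborel \<partial>levels)"
    using AE_levels
  proof (intro nn_integral_mono_AE, eventually_elim)
    fix t :: real assume t: "0 < t"
    define S where "S = E \<inter> D \<inter> {x. ennreal t < f x}"
    have [measurable]: "S \<in> sets borel" unfolding S_def by measurable
    have le: "emeasure lborel S \<le> emeasure lborel E" "emeasure lborel S \<le> emeasure lborel D"
      "emeasure lborel S \<le> emeasure lborel {x. ennreal t < f x}"
      by (rule emeasure_mono, auto simp: S_def)+
    have "(\<integral>\<^sup>+ x. (indicator E x * indicator D x * g x) * indicator {x. ennreal t < f x} x \<partial>lborel) = (\<integral>\<^sup>+ x. indicator S x * g x \<partial>lborel)"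
      by (intro nn_integral_cong) (auto simp: S_def split: split_indicator)
    also have "\<dots> \<le> (\<integral>\<^sup>+ x. indicator (rball (emeasure lborel S)) x * G x \<partial>lborel)"
      using le(1) fin by (intro weakly_majorizedD[OF maj]) auto
    also have "\<dots> \<le> (\<integral>\<^sup>+ x. (indicator ?E x * indicator ?D x * G x) * indicator {x. ennreal t < f' x} x \<partial>lborel)"
      using rball_mono[OF le(1), where 'a='a] rball_mono[OF le(2), where 'a='a] rball_mono[OF le(3), where 'a='a] t
      by (intro nn_integral_mono) (auto simp: f' split: split_indicator)
    finally show "(\<integral>\<^sup>+ x. (indicator E x * indicator D x * g x) * indicator {x. ennreal t < f x} x \<partial>lborel) \<le> \<dots>" .
  qed
  also have "\<dots> = (\<integral>\<^sup>+ x. (indicator ?E x * indicator ?D x * G x) * f' x \<partial>lborel)"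
    by (rule layer_cake_weighted[symmetric]) (auto intro: sigma_finite_lborel)
  also have "\<dots> = (\<integral>\<^sup>+ x. indicator ?E x * (f' x * indicator ?D x * G x) \<partial>lborel)"
    by (simp add: ac_simps)
  finally show "(\<integral>\<^sup>+ x. indicator E x * (f x * indicator D x * g x) \<partial>lborel) \<le> \<dots>" .
qed

text \<open>Lower semicontinuity of \<open>g\<close> bounds \<open>g z\<close> by averages over small balls.\<close>

lemma weakly_majorized_pointwise:
  fixes g G :: "'a::euclidean_space \<Rightarrow> ennreal"
  assumes maj: "weakly_majorized g G" and G: "radially_decreasing G"
    and lsc: "\<And>s. s < g z \<Longrightarrow> \<forall>\<^sub>F y in nhds z. s < g y"
  shows "g z \<le> G 0"
proof (rule dense_le)
  fix s assume "s < g z"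
  then obtain r where r: "0 < r" "\<And>y. dist y z < r \<Longrightarrow> s < g y"
    using lsc unfolding eventually_nhds_metric by blast
  let ?V = "emeasure lborel (ball z r)"
  have V: "?V = emeasure lborel (ball (0::'a) r)" using r by (simp add: emeasure_ball)
  have "?V \<noteq> 0" using r unit_ball_vol_pos[of "real DIM('a)"] by (auto simp: emeasure_ball less_imp_neq[symmetric])
  have "s * ?V = (\<integral>\<^sup>+ x. indicator (ball z r) x * s \<partial>lborel)"
    by (subst nn_integral_multc) (simp_all add: mult.commute sets_ball_borel)
  also have "\<dots> \<le> (\<integral>\<^sup>+ x. indicator (ball z r) x * g x \<partial>lborel)"
    using r(2) by (intro nn_integral_mono) (auto split: split_indicator simp: dist_commute intro: less_imp_le)
  also have "\<dots> \<le> (\<integral>\<^sup>+ x. indicator (rball ?V) x * G x \<partial>lborel)"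
    by (rule weakly_majorizedD[OF maj]) (simp_all add: sets_ball_borel)
  also have "\<dots> \<le> (\<integral>\<^sup>+ x. indicator (rball ?V :: 'a set) x * G 0 \<partial>lborel)"
    using radially_decreasingD[OF G, of 0] by (intro nn_integral_mono mult_left_mono) auto
  also have "\<dots> = ?V * G 0" by (subst nn_integral_multc) simp_all
  finally have "?V * s \<le> ?V * G 0" by (simp add: mult.commute)
  moreover have "?V \<noteq> \<top>" using emeasure_ball_less_top[of z r] by (rule less_imp_neq)
  ultimately show "s \<le> G 0" using \<open>?V \<noteq> 0\<close> ennreal_mult_le_mult_iff by blast
qed

section \<open>Domination of probability measures\<close>

locale borel_prob = prob_space \<mu> for \<mu> :: "'a::euclidean_space measure" +
  assumes sets_eq_borel [measurable_cong, simp]: "sets \<mu> = sets borel"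

sublocale borel_prob \<subseteq> borel_finite
  by unfold_locales simp

lemma borel_prob_finite: "borel_prob \<mu> \<Longrightarrow> borel_finite \<mu>"
proof -
  assume "borel_prob \<mu>"
  then interpret borel_prob \<mu> .
  show ?thesis by (rule borel_finite_axioms)
qed

definition rearrangement_dominated :: "'a::euclidean_space measure \<Rightarrow> 'a measure \<Rightarrow> bool" where
  "rearrangement_dominated \<mu> \<mu>' \<longleftrightarrow>
     borel_prob \<mu> \<and> borel_prob \<mu>' \<and> symm_dominated \<mu> \<mu>' \<and> unimodal \<mu>'"

text \<open>The reflection exchanging \<open>- x\<close> and \<open>- y\<close> maps the part of the ball \<open>rball w\<close> which lies only
  in the ball around \<open>- x\<close> into the part which lies only in the ball around \<open>- y\<close>.\<close>

lemma ball_intersection_decreasing: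
  fixes x y :: "'a::euclidean_space"
  assumes xy: "norm y \<le> norm x"
  shows "emeasure lborel (rball w \<inter> {u. x + u \<in> rball v}) \<le> emeasure lborel (rball w \<inter> {u. y + u \<in> rball v})"
proof (cases "x = y")
  case False
  define d where "d = x - y"
  define q where "q = d \<bullet> d"
  have q: "0 < q" using False by (simp add: q_def d_def)
  define c where "c = ((norm x)\<^sup>2 - (norm y)\<^sup>2) / 2"
  have c: "0 \<le> c" using xy by (simp add: c_def power_mono)
  have y: "y = x - d" by (simp add: d_def)
  have c': "c = x \<bullet> d - q / 2"
    unfolding c_def power2_norm_eq_inner y q_def by (simp add: inner_diff_left inner_diff_right inner_commute[of d x] field_simps)
  \<comment> \<open>The points equidistant from \<open>- x\<close> and \<open>- y\<close> form the
    hyperplane \<open>u \<bullet> d + c = 0\<close>, and \<open>\<sigma>\<close> is the reflection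
    in it. By \<open>c \<ge> 0\<close> the origin is on the side of \<open>- y\<close> or on the
    hyperplane.\<close>
  define k where "k u = (u \<bullet> d + c) / q" for u
  have kq: "k u * q = u \<bullet> d + c" for u using q by (simp add: k_def)
  define \<sigma> where "\<sigma> u = u - (2 * k u) *\<^sub>R d" for u
  define f where "f u = u - (2 * (u \<bullet> d) / q) *\<^sub>R d" for u
  define a where "a = - ((2 * c / q) *\<^sub>R d)"
  have \<sigma>_f: "\<sigma> u = a + f u" for u
    by (simp add: \<sigma>_def f_def a_def k_def add_divide_distrib distrib_left scaleR_add_left)
  have norm1: "(norm (z - (2 * r) *\<^sub>R d))\<^sup>2 = (norm z)\<^sup>2 - 4 * r * (z \<bullet> d) + 4 * r * (r * q)" for z r
    unfolding power2_norm_eq_inner q_def by (simp add: inner_diff_left inner_diff_right inner_commute[of d z] algebra_simps)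
  have lin: "linear f"
    unfolding f_def by (rule linearI) (simp_all add: inner_add_left algebra_simps add_divide_distrib)
  have "norm (f u) = norm u" for u
  proof -
    have "f u = u - (2 * ((u \<bullet> d) / q)) *\<^sub>R d" by (simp add: f_def)
    then have "(norm (f u))\<^sup>2 = (norm u)\<^sup>2" using q by (simp only: norm1) simp
    then show ?thesis by (simp add: power2_eq_iff_nonneg)
  qed
  then have orth: "orthogonal_transformation f" using lin by (simp add: orthogonal_transformation)
  note [measurable] = borel_measurable_orthogonal[OF orth]
  have [measurable]: "\<sigma> \<in> borel_measurable borel" unfolding \<sigma>_f[abs_def] by measurable
  have n_x: "norm (x + \<sigma> u) = norm (y + u)" for u
  proof -
    have "x + \<sigma> u = (x + u) - (2 * k u) *\<^sub>R d" by (simp add: \<sigma>_def)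
    then have "(norm (x + \<sigma> u))\<^sup>2 = (norm (x + u))\<^sup>2 - 4 * k u * ((x + u) \<bullet> d) + 4 * k u * (u \<bullet> d + c)"
      by (simp only: norm1 kq)
    also have "\<dots> = (norm (x + u))\<^sup>2 - 2 * (k u * q)" using kq[of u] by (simp add: c' inner_add_left algebra_simps)
    also have "\<dots> = (norm (x + u))\<^sup>2 - 4 * (1/2) * ((x + u) \<bullet> d) + 4 * (1/2) * (1/2 * q)"
      using kq[of u] by (simp add: c' inner_add_left algebra_simps)
    also have "\<dots> = (norm ((x + u) - (2 * (1/2)) *\<^sub>R d))\<^sup>2" by (simp only: norm1)
    also have "(x + u) - (2 * (1/2)) *\<^sub>R d = y + u" by (simp add: y)
    finally show ?thesis by (simp add: power2_eq_iff_nonneg)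
  qed
  have k_\<sigma>: "k (\<sigma> u) = - k u" for u
    using q kq[of u] by (simp add: \<sigma>_def k_def inner_diff_left q_def[symmetric] field_simps)
  have \<sigma>\<sigma>: "\<sigma> (\<sigma> u) = u" for u
    by (subst \<sigma>_def) (simp add: k_\<sigma>, simp add: \<sigma>_def)
  have n_y: "norm (y + \<sigma> u) = norm (x + u)" for u using n_x[of "\<sigma> u"] by (simp add: \<sigma>\<sigma>)
  \<comment> \<open>A point closer to \<open>- x\<close> than to \<open>- y\<close> lies across the
    hyperplane from the origin, so reflecting it does not increase its norm.\<close>
  have n_0: "norm (\<sigma> u) \<le> norm u" if "norm (x + u) < norm (y + u)" for u
  proof -
    have "(norm (y + u))\<^sup>2 = (norm ((x + u) - (2 * (1/2)) *\<^sub>R d))\<^sup>2" by (simp add: y algebra_simps)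
    also have "\<dots> = (norm (x + u))\<^sup>2 - 2 * (u \<bullet> d + c)"
      unfolding norm1 by (simp add: c' inner_add_left algebra_simps)
    finally have "u \<bullet> d + c < 0"
      using power_strict_mono[OF that, of 2] by simp
    then have k: "k u < 0" using q by (simp add: k_def divide_neg_pos)
    have "(norm (\<sigma> u))\<^sup>2 = (norm u)\<^sup>2 + 4 * (k u * c)"
      unfolding \<sigma>_def norm1 kq by (simp add: algebra_simps)
    also have "\<dots> \<le> (norm u)\<^sup>2" using mult_nonpos_nonneg[of "k u" c] k c by (simp add: mult.commute)
    finally show ?thesis by (rule power2_le_imp_le) simp
  qed
  define X where "X = rball w \<inter> {u. x + u \<in> rball v}"
  define Y where "Y = rball w \<inter> {u. y + u \<in> rball v}"
  have [measurable]: "X \<in> sets borel" "Y \<in> sets borel" unfolding X_def Y_def by measurable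
  have "emeasure lborel (X - Y) \<le> emeasure lborel (\<sigma> -` (Y - X))"
  proof (rule emeasure_mono)
    show "X - Y \<subseteq> \<sigma> -` (Y - X)"
    proof
      fix u assume u: "u \<in> X - Y"
      then have *: "u \<in> rball w" "x + u \<in> rball v" "y + u \<notin> rball v" by (auto simp: X_def Y_def)
      then have "norm (x + u) < norm (y + u)" using rball_radial[of "x + u" v "y + u"] by force
      then have "\<sigma> u \<in> rball w" using rball_radial[OF *(1) n_0] by blast
      moreover have "y + \<sigma> u \<in> rball v" "x + \<sigma> u \<notin> rball v"
        using *(2,3) n_x[of u] n_y[of u] by (auto simp: rball_def)
      ultimately show "u \<in> \<sigma> -` (Y - X)" by (simp add: X_def Y_def)
    qed
    show "\<sigma> -` (Y - X) \<in> sets lborel"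
      using measurable_sets[of \<sigma> borel borel "Y - X"] by simp
  qed
  also have "\<dots> = emeasure lborel (f -` {z. a + z \<in> Y - X})"
    by (rule arg_cong[where f="emeasure lborel"]) (auto simp: \<sigma>_f)
  also have "\<dots> = emeasure lborel {z. a + z \<in> Y - X}"
    by (rule emeasure_lborel_orthogonal[OF orth]) measurable
  also have "\<dots> = emeasure lborel (Y - X)"
    by (rule emeasure_lborel_translate) measurable
  finally have le: "emeasure lborel (X - Y) \<le> emeasure lborel (Y - X)" .
  have "emeasure lborel X = emeasure lborel ((X \<inter> Y) \<union> (X - Y))" by (simp add: Int_Diff_Un)
  also have "\<dots> = emeasure lborel (X \<inter> Y) + emeasure lborel (X - Y)" by (rule plus_emeasure[symmetric]) auto
  also have "\<dots> \<le> emeasure lborel (X \<inter> Y) + emeasure lborel (Y - X)" by (rule add_left_mono[OF le])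
  also have "\<dots> = emeasure lborel ((X \<inter> Y) \<union> (Y - X))" by (rule plus_emeasure) auto
  also have "(X \<inter> Y) \<union> (Y - X) = Y" by blast
  finally show ?thesis by (simp add: X_def Y_def)
qed simp

section \<open>Laws with densities and point masses\<close>

context
  fixes \<phi> \<phi>' :: "real ^ 'n \<Rightarrow> ennreal"
  assumes \<phi>[measurable]: "\<phi> \<in> borel_measurable borel" "\<phi>' \<in> borel_measurable borel"
    and lev: "\<And>t. 0 \<le> t \<Longrightarrow> {x. ennreal t < \<phi>' x} = rball (emeasure lborel {x. ennreal t < \<phi> x})"
begin

lemma nn_integral_density_overlap:
  assumes [measurable]: "E \<in> sets borel" "F \<in> sets borel" "\<psi> \<in> borel_measurable borel"
  shows "(\<integral>\<^sup>+ u. overlap E F u \<partial>density lborel \<psi>) = (\<integral>\<^sup>+ t. riesz {x. ennreal t < \<psi> x} E F \<partial>levels)"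
proof -
  have "(\<integral>\<^sup>+ u. overlap E F u \<partial>density lborel \<psi>) = (\<integral>\<^sup>+ u. overlap E F u * \<psi> u \<partial>lborel)"
    by (simp add: nn_integral_density mult.commute)
  also have "\<dots> = (\<integral>\<^sup>+ t. \<integral>\<^sup>+ u. overlap E F u * indicator {x. ennreal t < \<psi> x} u \<partial>lborel \<partial>levels)"
    by (rule layer_cake_weighted) (auto intro: sigma_finite_lborel)
  also have "\<dots> = (\<integral>\<^sup>+ t. riesz {x. ennreal t < \<psi> x} E F \<partial>levels)"
  proof (intro nn_integral_cong)
    fix t :: real
    have "overlap E F u * indicator {x. ennreal t < \<psi> x} u =
      (\<integral>\<^sup>+ x. indicator {x. ennreal t < \<psi> x} u * indicator E x * indicator F (u + x) \<partial>lborel)" for u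
      unfolding overlap_def by (subst nn_integral_multc[symmetric]) (auto simp: ac_simps)
    then show "(\<integral>\<^sup>+ u. overlap E F u * indicator {x. ennreal t < \<psi> x} u \<partial>lborel) = riesz {x. ennreal t < \<psi> x} E F"
      by (simp add: riesz_def)
  qed
  finally show ?thesis .
qed

text \<open>Layer by layer this is the Riesz inequality, with the superlevel set of the density as
  the third set.\<close>

lemma symm_dominated_density: "symm_dominated (density lborel \<phi>) (density lborel \<phi>')"
  unfolding symm_dominated_def
proof (intro allI impI)
  fix E F :: "(real ^ 'n) set" assume [measurable]: "E \<in> sets borel" "F \<in> sets borel"
  show "(\<integral>\<^sup>+ u. overlap E F u \<partial>density lborel \<phi>) \<le>
     (\<integral>\<^sup>+ u. overlap (rball (emeasure lborel E)) (rball (emeasure lborel F)) u \<partial>density lborel \<phi>')"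
    unfolding nn_integral_density_overlap[OF \<open>E \<in> _\<close> \<open>F \<in> _\<close> \<phi>(1)] nn_integral_density_overlap[OF sets_rball sets_rball \<phi>(2)]
  proof (rule nn_integral_mono_AE, use AE_levels in eventually_elim)
    fix t :: real assume "0 < t"
    then have t: "0 \<le> t" by simp
    show "riesz {x. ennreal t < \<phi> x} E F \<le> riesz {x. ennreal t < \<phi>' x} (rball (emeasure lborel E)) (rball (emeasure lborel F))"
      unfolding lev[OF t] by (intro riesz_rearrangement_sets) measurable
  qed
qed

text \<open>The layers of the rearranged density are centred balls, whose intersection with a moving
  ball shrinks as the latter moves away.\<close>

lemma unimodal_density: "unimodal (density lborel \<phi>')"
  unfolding unimodal_def radially_decreasing_def
proof (intro allI impI)
  fix v and x y :: "real ^ 'n" assume xy: "norm y \<le> norm x"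
  have eq: "emeasure (density lborel \<phi>') {u. z + u \<in> rball v} =
     (\<integral>\<^sup>+ t. emeasure lborel ({u. z + u \<in> rball v} \<inter> {x. ennreal t < \<phi>' x}) \<partial>levels)" for z
    by (subst emeasure_density, simp, simp, subst nn_integral_superlevels[symmetric]) (simp_all add: mult.commute)
  show "emeasure (density lborel \<phi>') {u. x + u \<in> rball v} \<le> emeasure (density lborel \<phi>') {u. y + u \<in> rball v}"
    unfolding eq
  proof (rule nn_integral_mono_AE, use AE_levels in eventually_elim)
    fix t :: real assume "0 < t"
    then have t: "0 \<le> t" by simp
    show "emeasure lborel ({u. x + u \<in> rball v} \<inter> {x. ennreal t < \<phi>' x}) \<le>
        emeasure lborel ({u. y + u \<in> rball v} \<inter> {x. ennreal t < \<phi>' x})"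
      unfolding lev[OF t] Int_commute[of _ "rball _"] by (intro ball_intersection_decreasing xy)
  qed
qed

lemma nn_integral_rearrangement: "(\<integral>\<^sup>+ x. \<phi>' x \<partial>lborel) = (\<integral>\<^sup>+ x. \<phi> x \<partial>lborel)"
proof -
  have "(\<integral>\<^sup>+ x. \<phi>' x \<partial>lborel) = (\<integral>\<^sup>+ t. emeasure lborel {x. ennreal t < \<phi>' x} \<partial>levels)"
    using layer_cake[OF sigma_finite_lborel, of \<phi>'] by simp
  also have "\<dots> = (\<integral>\<^sup>+ t. emeasure lborel {x. ennreal t < \<phi> x} \<partial>levels)"
    by (rule nn_integral_cong_AE, use AE_levels in eventually_elim) (simp add: lev)
  also have "\<dots> = (\<integral>\<^sup>+ x. \<phi> x \<partial>lborel)"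
    using layer_cake[OF sigma_finite_lborel, of \<phi>] by simp
  finally show ?thesis .
qed

lemma rearrangement_dominated_density:
  assumes "(\<integral>\<^sup>+ x. \<phi> x \<partial>lborel) = 1"
  shows "rearrangement_dominated (density lborel \<phi>) (density lborel \<phi>')"
proof -
  have "borel_prob (density lborel \<psi>)" if [measurable]: "\<psi> \<in> borel_measurable borel"
    and "(\<integral>\<^sup>+ x. \<psi> x \<partial>lborel) = 1" for \<psi> :: "real ^ 'n \<Rightarrow> ennreal"
    using that by (intro borel_prob.intro borel_prob_axioms.intro prob_spaceI) (simp_all add: emeasure_density)
  then show ?thesis
    using assms by (simp add: rearrangement_dominated_def symm_dominated_density unimodal_density nn_integral_rearrangement)
qed

end

text \<open>No overlap exceeds the smaller of the two volumes, and concentric balls attain it. This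
  absorbs every drift, and also a Gaussian part whose matrix is singular.\<close>

lemma rearrangement_dominated_return:
  fixes \<mu> :: "'a::euclidean_space measure"
  assumes "borel_prob \<mu>"
  shows "rearrangement_dominated \<mu> (return borel 0)"
proof -
  interpret \<mu>: borel_prob \<mu> by fact
  have "symm_dominated \<mu> (return borel 0)"
    unfolding symm_dominated_def
  proof (intro allI impI)
    fix E F :: "'a set" assume [measurable]: "E \<in> sets borel" "F \<in> sets borel"
    have "overlap E F u \<le> min (emeasure lborel E) (emeasure lborel F)" for u
    proof (rule min.boundedI)
      have "overlap E F u \<le> (\<integral>\<^sup>+ x. indicator E x \<partial>lborel)"
        unfolding overlap_def by (intro nn_integral_mono) (auto split: split_indicator)
      then show "overlap E F u \<le> emeasure lborel E" by simp
      have "overlap E F u \<le> (\<integral>\<^sup>+ x. indicator F (u + x) \<partial>lborel)"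
        unfolding overlap_def by (intro nn_integral_mono) (auto simp: add.commute split: split_indicator)
      also have "\<dots> = emeasure lborel F" by (subst nn_integral_lborel_translate) simp_all
      finally show "overlap E F u \<le> emeasure lborel F" .
    qed
    then have "(\<integral>\<^sup>+ u. overlap E F u \<partial>\<mu>) \<le> (\<integral>\<^sup>+ u. min (emeasure lborel E) (emeasure lborel F) \<partial>\<mu>)"
      by (intro nn_integral_mono)
    also have "\<dots> = emeasure lborel (rball (emeasure lborel E) \<inter> rball (emeasure lborel F) :: 'a set)"
      by (simp add: rball_Int \<mu>.emeasure_space_1[simplified])
    also have "\<dots> = overlap (rball (emeasure lborel E)) (rball (emeasure lborel F)) (0::'a)"
      unfolding overlap_def by (simp flip: indicator_inter_arith)
    also have "\<dots> = (\<integral>\<^sup>+ u. overlap (rball (emeasure lborel E)) (rball (emeasure lborel F)) u \<partial>return borel (0::'a))"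
      by (subst nn_integral_return) auto
    finally show "(\<integral>\<^sup>+ u. overlap E F u \<partial>\<mu>) \<le> \<dots>" .
  qed
  moreover have "unimodal (return borel (0::'a))"
    unfolding unimodal_def radially_decreasing_def
  proof (intro allI impI)
    fix v and x y :: 'a assume "norm y \<le> norm x"
    then show "emeasure (return borel 0) {u. x + u \<in> rball v} \<le> emeasure (return borel 0) {u. y + u \<in> rball v}"
      using rball_radial[of x v y] by (subst (1 2) emeasure_return) (auto split: split_indicator)
  qed
  moreover have "borel_prob (return borel (0::'a))"
    by (intro borel_prob.intro borel_prob_axioms.intro prob_space_return) auto
  ultimately show ?thesis using assms by (simp add: rearrangement_dominated_def)
qed

section \<open>Convolutions and mixtures\<close>

definition conv :: "'a::euclidean_space measure \<Rightarrow> 'a measure \<Rightarrow> 'a measure" where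
  "conv \<mu> \<nu> = distr (\<mu> \<Otimes>\<^sub>M \<nu>) borel (\<lambda>(x, y). x + y)"

text \<open>For \<open>p\<close> between 0 and 1 this is
  \<open>(1 - p) \<delta>\<^sub>0 + p \<mu>\<close>, realized by a coin toss so that it is visibly a
  probability law.\<close>

definition jump_mixture :: "real \<Rightarrow> 'a::euclidean_space measure \<Rightarrow> 'a measure" where
  "jump_mixture p \<mu> = distr (measure_pmf (bernoulli_pmf p) \<Otimes>\<^sub>M \<mu>) borel (\<lambda>(b, x). if b then x else 0)"

lemma borel_prob_conv:
  assumes "borel_prob \<mu>" "borel_prob \<nu>" shows "borel_prob (conv \<mu> \<nu>)"
proof -
  interpret \<mu>: borel_prob \<mu> by fact
  interpret \<nu>: borel_prob \<nu> by fact
  interpret P: pair_prob_space \<mu> \<nu> ..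
  show ?thesis
    by (intro borel_prob.intro borel_prob_axioms.intro) (auto simp: conv_def intro!: P.prob_space_distr)
qed

lemma nn_integral_conv:
  assumes "borel_prob \<mu>" "borel_prob \<nu>" and [measurable]: "f \<in> borel_measurable borel"
  shows "(\<integral>\<^sup>+ x. f x \<partial>conv \<mu> \<nu>) = (\<integral>\<^sup>+ x. \<integral>\<^sup>+ y. f (x + y) \<partial>\<nu> \<partial>\<mu>)"
proof -
  interpret \<mu>: borel_prob \<mu> by fact
  interpret \<nu>: borel_prob \<nu> by fact
  interpret P: pair_prob_space \<mu> \<nu> ..
  show ?thesis unfolding conv_def by (simp add: nn_integral_distr \<nu>.nn_integral_fst[symmetric])
qed

lemma shift_avg_conv:
  assumes "borel_prob \<mu>" "borel_prob \<nu>" and [measurable]: "f \<in> borel_measurable borel"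
  shows "shift_avg (conv \<mu> \<nu>) f = shift_avg \<mu> (shift_avg \<nu> f)"
  unfolding shift_avg_def by (subst nn_integral_conv[OF assms(1,2)]) (simp_all add: add.assoc)

lemma weakly_majorized_indicator:
  fixes F :: "'a::euclidean_space set"
  assumes [measurable]: "F \<in> sets borel"
  shows "weakly_majorized (indicator F) (indicator (rball (emeasure lborel F)))"
  unfolding weakly_majorized_def
proof (intro allI impI)
  fix E :: "'a set" assume [measurable]: "E \<in> sets borel"
  have "emeasure lborel (E \<inter> F) \<le> min (emeasure lborel E) (emeasure lborel F)"
    by (intro min.boundedI emeasure_mono) auto
  also have "\<dots> = emeasure lborel (rball (emeasure lborel E) \<inter> rball (emeasure lborel F) :: 'a set)"
    by (simp add: rball_Int)
  finally show "(\<integral>\<^sup>+ x. indicator E x * indicator F x \<partial>lborel) \<le>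
      (\<integral>\<^sup>+ x. indicator (rball (emeasure lborel E)) x * indicator (rball (emeasure lborel F) :: 'a set) x \<partial>lborel)"
    by (simp flip: indicator_inter_arith)
qed

lemma radially_decreasing_rball: "radially_decreasing (indicator (rball v))"
  unfolding radially_decreasing_def by (auto split: split_indicator intro: rball_radial)

lemma nn_integral_overlap:
  assumes "borel_prob \<mu>" and [measurable]: "E \<in> sets borel" "F \<in> sets borel"
  shows "(\<integral>\<^sup>+ u. overlap E F u \<partial>\<mu>) = (\<integral>\<^sup>+ x. indicator E x * shift_avg \<mu> (indicator F) x \<partial>lborel)"
proof -
  interpret \<mu>: borel_prob \<mu> by fact
  interpret P: pair_sigma_finite lborel \<mu> ..
  have "(\<integral>\<^sup>+ u. overlap E F u \<partial>\<mu>) = (\<integral>\<^sup>+ x. \<integral>\<^sup>+ u. indicator E x * indicator F (x + u) \<partial>\<mu> \<partial>lborel)"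
    unfolding overlap_def by (rule P.Fubini') measurable
  also have "\<dots> = (\<integral>\<^sup>+ x. indicator E x * shift_avg \<mu> (indicator F) x \<partial>lborel)"
    unfolding shift_avg_def by (intro nn_integral_cong nn_integral_cmult) measurable
  finally show ?thesis .
qed

lemma symm_dominatedI:
  assumes \<mu>: "borel_prob \<mu>" and \<mu>': "borel_prob \<mu>'"
    and maj: "\<And>F. F \<in> sets borel \<Longrightarrow> weakly_majorized (shift_avg \<mu> (indicator F)) (shift_avg \<mu>' (indicator (rball (emeasure lborel F))))"
  shows "symm_dominated \<mu> \<mu>'"
  unfolding symm_dominated_def
  using weakly_majorizedD[OF maj] by (simp add: nn_integral_overlap[OF \<mu>] nn_integral_overlap[OF \<mu>'])

text \<open>Domination can be read as majorization of averaged indicators. Averaging over a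
  convolution is averaging twice, so the majorization theorem is applied once for each
  factor.\<close>

lemma rearrangement_dominated_conv:
  fixes \<mu> \<mu>' :: "'a::euclidean_space measure"
  assumes 1: "rearrangement_dominated \<mu> \<mu>'" and 2: "rearrangement_dominated \<nu> \<nu>'"
  shows "rearrangement_dominated (conv \<mu> \<nu>) (conv \<mu>' \<nu>')"
proof -
  have pr: "borel_prob \<mu>" "borel_prob \<nu>" "borel_prob \<mu>'" "borel_prob \<nu>'"
    using assms by (auto simp: rearrangement_dominated_def)
  then have fin: "borel_finite \<mu>" "borel_finite \<nu>" "borel_finite \<mu>'" "borel_finite \<nu>'"
    by (simp_all add: borel_prob_finite)
  have dom: "symm_dominated \<mu> \<mu>'" "symm_dominated \<nu> \<nu>'" and uni: "unimodal \<mu>'" "unimodal \<nu>'"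
    using assms by (auto simp: rearrangement_dominated_def)
  have "symm_dominated (conv \<mu> \<nu>) (conv \<mu>' \<nu>')"
  proof (rule symm_dominatedI)
    fix F :: "'a set" assume [measurable]: "F \<in> sets borel"
    let ?F = "indicator (rball (emeasure lborel F)) :: 'a \<Rightarrow> ennreal"
    have "weakly_majorized (shift_avg \<nu> (indicator F)) (shift_avg \<nu>' ?F)"
      by (rule weakly_majorized_shift_avg[OF fin(2,4) dom(2) uni(2)])
         (auto intro: weakly_majorized_indicator radially_decreasing_rball)
    then have "weakly_majorized (shift_avg \<mu> (shift_avg \<nu> (indicator F))) (shift_avg \<mu>' (shift_avg \<nu>' ?F))"
      by (intro weakly_majorized_shift_avg[OF fin(1,3) dom(1) uni(1)] borel_finite.shift_avg_measurable fin
          radially_decreasing_shift_avg uni radially_decreasing_rball borel_measurable_indicator) auto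
    then show "weakly_majorized (shift_avg (conv \<mu> \<nu>) (indicator F)) (shift_avg (conv \<mu>' \<nu>') ?F)"
      by (simp add: shift_avg_conv pr)
  qed (intro borel_prob_conv pr)+
  moreover have "unimodal (conv \<mu>' \<nu>')"
    unfolding unimodal_def
  proof
    fix v
    have m: "{u. x + u \<in> rball v} \<in> sets borel" for x :: 'a by measurable
    have "emeasure (conv \<mu>' \<nu>') {u. x + u \<in> rball v} = shift_avg (conv \<mu>' \<nu>') (indicator (rball v)) x" for x
    proof -
      have "shift_avg (conv \<mu>' \<nu>') (indicator (rball v)) x = (\<integral>\<^sup>+ u. indicator {u. x + u \<in> rball v} u \<partial>conv \<mu>' \<nu>')"
        by (simp add: shift_avg_def indicator_def)
      also have "\<dots> = emeasure (conv \<mu>' \<nu>') {u. x + u \<in> rball v}"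
        using m[of x] borel_prob.sets_eq_borel[OF borel_prob_conv[OF pr(3,4)]] by (intro nn_integral_indicator) simp
      finally show ?thesis ..
    qed
    then show "radially_decreasing (\<lambda>x. emeasure (conv \<mu>' \<nu>') {u. x + u \<in> rball v})"
      using radially_decreasing_shift_avg[OF fin(3) uni(1) radially_decreasing_shift_avg[OF fin(4) uni(2) radially_decreasing_rball]]
      by (simp add: shift_avg_conv pr)
  qed
  ultimately show ?thesis by (simp add: rearrangement_dominated_def borel_prob_conv pr)
qed

lemma borel_prob_jump_mixture: "borel_prob \<mu> \<Longrightarrow> borel_prob (jump_mixture p \<mu>)"
proof -
  assume "borel_prob \<mu>"
  then interpret \<mu>: borel_prob \<mu> .
  interpret P: pair_prob_space "measure_pmf (bernoulli_pmf p)" \<mu> ..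
  show ?thesis
    by (intro borel_prob.intro borel_prob_axioms.intro) (auto simp: jump_mixture_def intro!: P.prob_space_distr)
qed

lemma nn_integral_jump_mixture:
  assumes "borel_prob \<mu>" and p: "0 \<le> p" "p \<le> 1" and [measurable]: "f \<in> borel_measurable borel"
  shows "(\<integral>\<^sup>+ x. f x \<partial>jump_mixture p \<mu>) = (\<integral>\<^sup>+ x. f x \<partial>\<mu>) * p + f 0 * (1 - p)"
proof -
  interpret \<mu>: borel_prob \<mu> by fact
  interpret P: pair_prob_space "measure_pmf (bernoulli_pmf p)" \<mu> ..
  show ?thesis unfolding jump_mixture_def using p
    by (simp add: nn_integral_distr \<mu>.nn_integral_fst[symmetric] split_beta' \<mu>.emeasure_space_1[simplified])
qed

text \<open>Both inequalities in the definition of domination are linear in the measures, and the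
  point mass at 0 dominates itself.\<close>

lemma rearrangement_dominated_jump_mixture:
  fixes \<mu> \<mu>' :: "'a::euclidean_space measure"
  assumes 1: "rearrangement_dominated \<mu> \<mu>'" and p: "0 \<le> p" "p \<le> 1"
  shows "rearrangement_dominated (jump_mixture p \<mu>) (jump_mixture p \<mu>')"
proof -
  have pr: "borel_prob \<mu>" "borel_prob \<mu>'" and dom: "symm_dominated \<mu> \<mu>'" and uni: "unimodal \<mu>'"
    using assms by (auto simp: rearrangement_dominated_def)
  have pr0: "borel_prob (return borel (0::'a))" and uni0: "unimodal (return borel (0::'a))"
    and dom0: "symm_dominated (return borel (0::'a)) (return borel 0)"
    using rearrangement_dominated_return[OF pr(1)] rearrangement_dominated_return[of "return borel (0::'a)"]
    by (auto simp: rearrangement_dominated_def)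
  have eq: "(\<integral>\<^sup>+ x. f x \<partial>jump_mixture p \<nu>) = (\<integral>\<^sup>+ x. f x \<partial>\<nu>) * p + (\<integral>\<^sup>+ x. f x \<partial>return borel 0) * (1 - p)"
    if "borel_prob \<nu>" "f \<in> borel_measurable borel" for f and \<nu> :: "'a measure"
    using that p by (simp add: nn_integral_jump_mixture nn_integral_return)
  have "symm_dominated (jump_mixture p \<mu>) (jump_mixture p \<mu>')"
    using dom dom0 unfolding symm_dominated_def
    by (auto simp: eq pr overlap_measurable intro!: add_mono mult_right_mono)
  moreover have "unimodal (jump_mixture p \<mu>')"
    unfolding unimodal_def radially_decreasing_def
  proof (intro allI impI)
    fix v and x y :: 'a assume xy: "norm y \<le> norm x"
    have m: "{u. z + u \<in> rball v} \<in> sets borel" for z :: 'a by measurable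
    have em: "emeasure (jump_mixture p \<mu>') {u. z + u \<in> rball v} =
      emeasure \<mu>' {u. z + u \<in> rball v} * p + emeasure (return borel 0) {u. z + u \<in> rball v} * (1 - p)" for z
      using eq[OF pr(2), of "indicator {u. z + u \<in> rball v}"] m[of z]
        borel_prob.sets_eq_borel[OF borel_prob_jump_mixture[OF pr(2), of p]] borel_prob.sets_eq_borel[OF pr(2)]
      by simp
    show "emeasure (jump_mixture p \<mu>') {u. x + u \<in> rball v} \<le> emeasure (jump_mixture p \<mu>') {u. y + u \<in> rball v}"
      unfolding em using uni uni0 xy by (intro add_mono mult_right_mono) (auto simp: unimodal_def radially_decreasing_def)
  qed
  ultimately show ?thesis by (simp add: rearrangement_dominated_def borel_prob_jump_mixture pr)
qed

section \<open>Linear images and Gaussian measures\<close>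

lemma borel_measurable_linear:
  fixes f :: "'a::euclidean_space \<Rightarrow> 'b::euclidean_space"
  shows "linear f \<Longrightarrow> f \<in> borel_measurable borel"
  using linear_continuous_on[of f] by (intro borel_measurable_continuous_onI) (simp add: linear_conv_bounded_linear)

text \<open>Induction over elementary maps. A map with a vanishing coordinate has determinant 0, so
  the claim \<open>P\<close> is vacuous there; a swap of coordinates is orthogonal; and the shear is
  a translation on every line parallel to the changed coordinate.\<close>

lemma nn_integral_linear:
  fixes f :: "real ^ 'n \<Rightarrow> real ^ 'n" and h :: "real ^ 'n \<Rightarrow> ennreal"
  assumes f: "linear f" and det: "det (matrix f) \<noteq> 0" and h: "h \<in> borel_measurable borel"
  shows "(\<integral>\<^sup>+ x. h x \<partial>lborel) = ennreal \<bar>det (matrix f)\<bar> * (\<integral>\<^sup>+ x. h (f x) \<partial>lborel)"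
proof -
  define P where "P f \<longleftrightarrow> (det (matrix f) \<noteq> 0 \<longrightarrow> (\<forall>h. h \<in> borel_measurable borel \<longrightarrow>
     (\<integral>\<^sup>+ x. h x \<partial>lborel) = ennreal \<bar>det (matrix f)\<bar> * (\<integral>\<^sup>+ x. h (f x) \<partial>lborel)))"
    for f :: "real ^ 'n \<Rightarrow> real ^ 'n"
  have "P f"
  proof (rule induct_linear_elementary[OF f])
    fix f g :: "real ^ 'n \<Rightarrow> real ^ 'n" assume lin: "linear f" "linear g" and P: "P f" "P g"
    note [measurable] = borel_measurable_linear[OF lin(1)] borel_measurable_linear[OF lin(2)]
    have m: "det (matrix (f \<circ> g)) = det (matrix f) * det (matrix g)"
      by (simp add: matrix_compose[OF lin(2,1)] det_mul)
    show "P (f \<circ> g)"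
      unfolding P_def
    proof (intro impI allI)
      fix h :: "real ^ 'n \<Rightarrow> ennreal" assume [measurable]: "h \<in> borel_measurable borel"
      assume "det (matrix (f \<circ> g)) \<noteq> 0"
      then have nz: "det (matrix f) \<noteq> 0" "det (matrix g) \<noteq> 0" by (auto simp: m)
      have "(\<integral>\<^sup>+ x. h x \<partial>lborel) = ennreal \<bar>det (matrix f)\<bar> * (\<integral>\<^sup>+ x. h (f x) \<partial>lborel)"
        by (rule P(1)[unfolded P_def, rule_format, OF nz(1)]) measurable
      also have "(\<integral>\<^sup>+ x. h (f x) \<partial>lborel) = ennreal \<bar>det (matrix g)\<bar> * (\<integral>\<^sup>+ x. h (f (g x)) \<partial>lborel)"
        by (rule P(2)[unfolded P_def, rule_format, OF nz(2), of "\<lambda>x. h (f x)"]) measurable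
      finally show "(\<integral>\<^sup>+ x. h x \<partial>lborel) = ennreal \<bar>det (matrix (f \<circ> g))\<bar> * (\<integral>\<^sup>+ x. h ((f \<circ> g) x) \<partial>lborel)"
        by (simp add: m abs_mult ennreal_mult mult.assoc)
    qed
  next
    fix f :: "real ^ 'n \<Rightarrow> real ^ 'n" and i assume lin: "linear f" and 0: "\<And>x. f x $ i = 0"
    have "\<not> surj f"
    proof
      assume "surj f"
      then obtain x where "f x = axis i 1" by (metis surjD)
      then show False using 0[of x] by simp
    qed
    then have "\<not> inj f" using linear_injective_imp_surjective[OF lin] by blast
    then show "P f" using det_nz_iff_inj[OF lin] by (simp add: P_def)
  next
    fix c :: "'n \<Rightarrow> real"
    let ?f = "\<lambda>x :: real ^ 'n. \<chi> i. c i * x $ i"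
    have det: "det (matrix ?f) = (\<Prod>i\<in>UNIV. c i)"
      by (subst det_diagonal) (auto simp: matrix_def axis_def)
    show "P ?f"
      unfolding P_def det
    proof (intro impI allI)
      fix h :: "real ^ 'n \<Rightarrow> ennreal" assume [measurable]: "h \<in> borel_measurable borel"
      assume "(\<Prod>i\<in>UNIV. c i) \<noteq> 0"
      then have nz: "c i \<noteq> 0" for i by auto
      \<comment> \<open>Carries the factors \<open>c\<close> from coordinate indices to basis
        vectors, the indexing of the affine change of variables used below.\<close>
      define C where "C b = (\<Sum>i\<in>UNIV. c i * b $ i)" for b :: "real ^ 'n"
      have C: "C (axis i 1) = c i" for i by (simp add: C_def axis_def if_distrib cong: if_cong)
      have Cnz: "C b \<noteq> 0" if "b \<in> Basis" for b
        using that nz by (auto simp: Basis_vec_def C)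
      have "(\<Sum>j\<in>Basis. (C j * (x \<bullet> j)) *\<^sub>R j) = ?f x" for x
      proof (rule euclidean_eqI)
        fix b :: "real ^ 'n" assume b: "b \<in> Basis"
        then obtain i where "b = axis i 1" by (auto simp: Basis_vec_def)
        then show "(\<Sum>j\<in>Basis. (C j * (x \<bullet> j)) *\<^sub>R j) \<bullet> b = ?f x \<bullet> b"
          unfolding inner_sum_left_Basis[OF b] by (simp add: C inner_axis)
      qed
      then have eq: "lborel = density (distr lborel borel ?f) (\<lambda>_. ennreal (\<Prod>j\<in>Basis. \<bar>C j\<bar>))"
        using lborel_affine_euclidean[of C 0] Cnz by simp
      have [measurable]: "?f \<in> borel_measurable borel" by (rule borel_measurable_linear, rule linearI) (simp_all add: vec_eq_iff algebra_simps)
      have B: "Basis = (\<lambda>i. axis i 1 :: real ^ 'n) ` UNIV" by (auto simp: Basis_vec_def)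
      have pr: "(\<Prod>j\<in>(Basis :: (real ^ 'n) set). \<bar>C j\<bar>) = \<bar>\<Prod>i\<in>UNIV. c i\<bar>"
        unfolding B by (simp add: prod.reindex inj_on_def axis_eq_axis C abs_prod)
      show "(\<integral>\<^sup>+ x. h x \<partial>lborel) = ennreal \<bar>\<Prod>i\<in>UNIV. c i\<bar> * (\<integral>\<^sup>+ x. h (?f x) \<partial>lborel)"
        by (subst eq) (simp add: nn_integral_density nn_integral_distr nn_integral_cmult pr)
    qed
  next
    fix m n :: 'n assume "m \<noteq> n"
    let ?f = "\<lambda>x :: real ^ 'n. \<chi> i. x $ Transposition.transpose m n i"
    have lin: "linear ?f" by (rule linearI) (simp_all add: vec_eq_iff)
    have "?f v \<bullet> ?f w = v \<bullet> w" for v w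
      unfolding inner_vec_def
      using sum.permute[OF permutes_swap_id[of m UNIV n], of "\<lambda>i. v $ i * w $ i"] by (simp add: o_def)
    then have orth: "orthogonal_transformation ?f" using lin by (simp add: orthogonal_transformation_def)
    then show "P ?f"
      unfolding P_def orthogonal_transformation_det[OF orth] by (simp add: nn_integral_lborel_orthogonal[OF orth])
  next
    fix m n :: 'n assume mn: "m \<noteq> n"
    let ?f = "\<lambda>x :: real ^ 'n. \<chi> i. if i = m then x $ m + x $ n else x $ i"
    have lin: "linear ?f" by (rule linearI) (auto simp: vec_eq_iff algebra_simps)
    note [measurable] = borel_measurable_linear[OF lin]
    have "matrix ?f = (\<chi> k. if k = m then row m (mat 1) + 1 *s row n (mat 1) else row k (mat 1))"
      using mn by (auto simp: vec_eq_iff matrix_def row_def mat_def axis_def)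
    then have det: "det (matrix ?f) = 1"
      using mn by (simp only: det_row_operation[OF mn] det_I)
    define b where "b = (axis m 1 :: real ^ 'n)"
    have b: "b \<in> Basis" by (auto simp: b_def Basis_vec_def)
    have f: "?f (s *\<^sub>R b + y) = (y $ n + s) *\<^sub>R b + y" for s y
      using mn by (auto simp: vec_eq_iff b_def axis_def)
    have "(\<integral>\<^sup>+ x. h (?f x) \<partial>lborel) = (\<integral>\<^sup>+ x. h x \<partial>lborel)"
      if [measurable]: "h \<in> borel_measurable borel" for h :: "real ^ 'n \<Rightarrow> ennreal"
    proof -
      have 1: "(\<integral>\<^sup>+ s. h ((y $ n + s) *\<^sub>R b + y) \<partial>lborel) = (\<integral>\<^sup>+ s. h (s *\<^sub>R b + y) \<partial>lborel)" for y
        by (rule nn_integral_lborel_translate[of "\<lambda>s. h (s *\<^sub>R b + y)"]) measurable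
      show ?thesis
        by (subst (1 2) nn_integral_lborel_slices[OF _ b], measurable) (simp only: f 1)
    qed
    then show "P ?f" by (simp add: P_def det)
  qed
  then show ?thesis unfolding P_def using det h by blast
qed

text \<open>Elimination for a nonnegative form: subtracting \<open>v $ i * v $ j\<close>, with
  \<open>v\<close> the column of index \<open>k\<close> divided by the square root of the pivot,
  clears row and column \<open>k\<close> and keeps the form nonnegative. The induction is over an
  index set \<open>J\<close> outside of which the rows vanish.\<close>

lemma psd_factorization:
  fixes A :: "real ^ 'n ^ 'n"
  assumes sym: "transpose A = A" and psd: "\<And>x. 0 \<le> (A *v x) \<bullet> x"
  obtains V :: "real ^ 'n ^ 'n" where "A = V ** transpose V"
proof -
  have "\<exists>V :: real ^ 'n ^ 'n. (\<forall>i l. A $ i $ l = (\<Sum>j\<in>UNIV. V $ i $ j * V $ l $ j)) \<and> (\<forall>i j. j \<notin> J \<longrightarrow> V $ i $ j = 0)"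
    if "finite J" "transpose A = A" "\<And>x. 0 \<le> (A *v x) \<bullet> x" "\<And>i j. i \<notin> J \<Longrightarrow> A $ i $ j = 0"
    for J :: "'n set" and A :: "real ^ 'n ^ 'n"
    using that
  proof (induction J arbitrary: A rule: finite_induct)
    case empty
    then show ?case by (intro exI[of _ 0]) simp
  next
    case (insert k J)
    note S = insert.prems(1) and psd = insert.prems(2) and zero = insert.prems(3)
    have s: "A $ i $ j = A $ j $ i" for i j
      using arg_cong[OF S, of "\<lambda>M. M $ j $ i"] by (simp add: transpose_def)
    have selfadj: "(A *v x) \<bullet> y = (A *v y) \<bullet> x" for x y
    proof -
      have "(A *v x) \<bullet> y = (x v* A) \<bullet> y" using S transpose_matrix_vector[of A x] by simp
      also have "\<dots> = x \<bullet> (A *v y)" by (rule dot_lmul_matrix)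
      finally show ?thesis by (simp add: inner_commute)
    qed
    define w where "w = A *v axis k 1"
    have wi: "w $ i = A $ i $ k" for i by (simp add: w_def matrix_vector_mult_basis column_def)
    define a where "a = A $ k $ k"
    have a: "(A *v axis k 1) \<bullet> axis k 1 = a" by (simp add: wi[unfolded w_def] a_def inner_axis)
    have a0: "0 \<le> a" using psd[of "axis k 1"] by (simp add: a)
    have expand: "(A *v (x + r *\<^sub>R axis k 1)) \<bullet> (x + r *\<^sub>R axis k 1) = (A *v x) \<bullet> x + 2 * r * (w \<bullet> x) + r\<^sup>2 * a" for x r
      using selfadj[of x "axis k 1"] a
      by (simp add: matrix_vector_right_distrib matrix_vector_mult_scaleR inner_add_left inner_add_right w_def power2_eq_square algebra_simps)
    \<comment> \<open>For \<open>a = 0\<close> division by zero gives \<open>v = 0\<close>, the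
      right choice because \<open>w\<close> vanishes as well.\<close>
    define v where "v = (1 / sqrt a) *\<^sub>R w"
    define B where "B = (\<chi> i j. A $ i $ j - v $ i * v $ j)"
    \<comment> \<open>With a vanishing pivot the form is affine in \<open>r\<close> along the axis
      of index \<open>k\<close>; a nonzero \<open>w\<close> would give it a nonzero slope at
      \<open>x = w\<close> and hence a negative value.\<close>
    have w0: "w = 0" if "a = 0"
    proof (rule ccontr)
      assume "w \<noteq> 0"
      then have ww: "0 < w \<bullet> w" by simp
      define r where "r = - ((A *v w) \<bullet> w + 1) / (2 * (w \<bullet> w))"
      have "(A *v w) \<bullet> w + 2 * r * (w \<bullet> w) = - 1" using ww by (simp add: r_def field_simps)
      then show False using psd[of "w + r *\<^sub>R axis k 1"] unfolding expand that by simp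
    qed
    have vv: "v $ i * v $ j = w $ i * w $ j / a" for i j
      using a0 by (simp add: v_def real_sqrt_mult[symmetric])
    have Bx: "(B *v x) \<bullet> x = (A *v x) \<bullet> x - (v \<bullet> x)\<^sup>2" for x
    proof -
      have "B *v x = A *v x - (v \<bullet> x) *\<^sub>R v"
        by (simp add: vec_eq_iff B_def matrix_vector_mult_def inner_vec_def left_diff_distrib sum_subtractf
            sum_distrib_right mult.assoc mult.commute[of "v $ _" "v $ _ * x $ _"] mult.commute[of "v $ _" "_ * _"])
      then show ?thesis by (simp add: inner_diff_left power2_eq_square)
    qed
    have "\<exists>V :: real ^ 'n ^ 'n. (\<forall>i l. B $ i $ l = (\<Sum>j\<in>UNIV. V $ i $ j * V $ l $ j)) \<and> (\<forall>i j. j \<notin> J \<longrightarrow> V $ i $ j = 0)"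
    proof (rule insert.IH)
      show "transpose B = B" by (simp add: vec_eq_iff transpose_def B_def s mult.commute)
      show "0 \<le> (B *v x) \<bullet> x" for x
      proof (cases "a = 0")
        case True
        then show ?thesis using psd[of x] by (simp add: Bx v_def)
      next
        case False
        then have apos: "0 < a" using a0 by simp
        \<comment> \<open>Completing the square: this multiple of the axis vector minimizes the form
          on the line through \<open>x\<close>.\<close>
        have "0 \<le> (A *v x) \<bullet> x + 2 * (- (w \<bullet> x) / a) * (w \<bullet> x) + (- (w \<bullet> x) / a)\<^sup>2 * a"
          using psd[of "x + (- (w \<bullet> x) / a) *\<^sub>R axis k 1"] unfolding expand .
        also have "\<dots> = (A *v x) \<bullet> x - (w \<bullet> x)\<^sup>2 / a"
          using apos by (simp add: power2_eq_square field_simps)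
        also have "(w \<bullet> x)\<^sup>2 / a = (v \<bullet> x)\<^sup>2"
          using apos by (simp add: v_def power_mult_distrib power_divide)
        finally show ?thesis by (simp add: Bx)
      qed
      show "B $ i $ j = 0" if "i \<notin> J" for i j
      proof (cases "i = k")
        case True
        show ?thesis
        proof (cases "a = 0")
          case True
          then have "A $ k $ j = 0" using w0 wi[of j] s[of k j] by simp
          then show ?thesis using True \<open>i = k\<close> by (simp add: B_def vv)
        next
          case False
          then show ?thesis using \<open>i = k\<close> by (simp add: B_def vv wi a_def s[of k j])
        qed
      next
        case False
        then have "A $ i $ j = 0" "w $ i = 0" using zero[of i] that by (auto simp: wi)
        then show ?thesis by (simp add: B_def vv)
      qed
    qed
    then obtain U :: "real ^ 'n ^ 'n" where U: "\<And>i l. B $ i $ l = (\<Sum>j\<in>UNIV. U $ i $ j * U $ l $ j)"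
      "\<And>i j. j \<notin> J \<Longrightarrow> U $ i $ j = 0" by blast
    \<comment> \<open>Column \<open>k\<close> of \<open>U\<close> is zero because \<open>k\<close>
      lies outside \<open>J\<close>, so it is free to hold the vector \<open>v\<close>.\<close>
    define V where "V = (\<chi> i j. if j = k then v $ i else U $ i $ j)"
    have "A $ i $ l = (\<Sum>j\<in>UNIV. V $ i $ j * V $ l $ j)" for i l
    proof -
      have "(\<Sum>j\<in>UNIV. V $ i $ j * V $ l $ j) = v $ i * v $ l + (\<Sum>j\<in>UNIV - {k}. V $ i $ j * V $ l $ j)"
        by (subst sum.remove[of _ k]) (simp_all add: V_def)
      also have "(\<Sum>j\<in>UNIV - {k}. V $ i $ j * V $ l $ j) = (\<Sum>j\<in>UNIV - {k}. U $ i $ j * U $ l $ j)"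
        by (intro sum.cong) (auto simp: V_def)
      also have "\<dots> = (\<Sum>j\<in>UNIV. U $ i $ j * U $ l $ j)"
        using U(2)[of k] insert.hyps(2) by (subst (2) sum.remove[of _ k]) simp_all
      also have "v $ i * v $ l + \<dots> = A $ i $ l" unfolding U(1)[symmetric] by (simp add: B_def)
      finally show ?thesis ..
    qed
    moreover have "V $ i $ j = 0" if "j \<notin> insert k J" for i j
      using that U(2) by (simp add: V_def)
    ultimately show ?case by blast
  qed
  from this[of UNIV A] sym psd
  obtain V :: "real ^ 'n ^ 'n" where "\<And>i l. A $ i $ l = (\<Sum>j\<in>UNIV. V $ i $ j * V $ l $ j)" by auto
  then have "A = V ** transpose V" by (simp add: vec_eq_iff matrix_matrix_mult_def transpose_def)
  then show thesis by (rule that)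
qed

section \<open>Characteristic functions\<close>

definition cfun :: "'a::euclidean_space measure \<Rightarrow> 'a \<Rightarrow> complex" where
  "cfun \<mu> \<xi> = (LINT x|\<mu>. exp (\<i> * of_real (\<xi> \<bullet> x)))"

lemma (in borel_prob) norm_cfun_le: "norm (cfun \<mu> \<xi>) \<le> 1"
proof -
  have "norm (cfun \<mu> \<xi>) \<le> (LINT x|\<mu>. norm (exp (\<i> * of_real (\<xi> \<bullet> x))))"
    unfolding cfun_def by (rule integral_norm_bound)
  then show ?thesis by (simp add: prob_space[simplified])
qed

lemma cfun_return: "cfun (return borel c) \<xi> = exp (\<i> * of_real (\<xi> \<bullet> c))"
  unfolding cfun_def by (subst integral_return) auto

lemma cfun_distr_linear:
  fixes f :: "'a::euclidean_space \<Rightarrow> 'b::euclidean_space"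
  assumes "borel_prob \<mu>" and [measurable]: "f \<in> borel_measurable borel" and adj: "\<And>x. \<xi> \<bullet> f x = \<eta> \<bullet> x"
  shows "cfun (distr \<mu> borel f) \<xi> = cfun \<mu> \<eta>"
proof -
  interpret borel_prob \<mu> by fact
  show ?thesis unfolding cfun_def by (simp add: integral_distr adj)
qed

lemma cfun_conv:
  assumes "borel_prob \<mu>" "borel_prob \<nu>"
  shows "cfun (conv \<mu> \<nu>) \<xi> = cfun \<mu> \<xi> * cfun \<nu> \<xi>"
proof -
  interpret \<mu>: borel_prob \<mu> by fact
  interpret \<nu>: borel_prob \<nu> by fact
  interpret P: pair_prob_space \<mu> \<nu> ..
  let ?e = "\<lambda>x. exp (\<i> * complex_of_real (\<xi> \<bullet> x))"
  have "cfun (conv \<mu> \<nu>) \<xi> = (LINT p|(\<mu> \<Otimes>\<^sub>M \<nu>). ?e (fst p) * ?e (snd p))"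
    unfolding cfun_def conv_def
    by (subst integral_distr) (auto simp: split_beta' inner_add_right distrib_left exp_add)
  also have "\<dots> = (LINT x|\<mu>. LINT y|\<nu>. ?e x * ?e y)"
    by (subst P.integral_fst'[symmetric]) (auto intro!: P.integrable_const_bound[where B=1] simp: norm_mult)
  also have "\<dots> = cfun \<mu> \<xi> * cfun \<nu> \<xi>"
    by (simp add: cfun_def)
  finally show ?thesis .
qed

lemma cfun_jump_mixture:
  assumes "borel_prob \<mu>" and p: "0 \<le> p" "p \<le> 1"
  shows "cfun (jump_mixture p \<mu>) \<xi> = 1 + of_real p * (cfun \<mu> \<xi> - 1)"
proof -
  interpret \<mu>: borel_prob \<mu> by fact
  interpret P: pair_prob_space "measure_pmf (bernoulli_pmf p)" \<mu> ..
  let ?e = "\<lambda>x. exp (\<i> * complex_of_real (\<xi> \<bullet> x))"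
  have "cfun (jump_mixture p \<mu>) \<xi> = (LINT q|(measure_pmf (bernoulli_pmf p) \<Otimes>\<^sub>M \<mu>). ?e (if fst q then snd q else 0))"
    unfolding cfun_def jump_mixture_def by (subst integral_distr) (auto simp: split_beta')
  also have "\<dots> = (LINT b|measure_pmf (bernoulli_pmf p). LINT x|\<mu>. ?e (if b then x else 0))"
    by (subst P.integral_fst'[symmetric]) (auto intro!: P.integrable_const_bound[where B=1] cong: if_cong)
  also have "\<dots> = (\<Sum>b\<in>UNIV. pmf (bernoulli_pmf p) b *\<^sub>R (LINT x|\<mu>. ?e (if b then x else 0)))"
    by (rule integral_measure_pmf) auto
  also have "\<dots> = 1 + of_real p * (cfun \<mu> \<xi> - 1)"
    using p by (simp add: UNIV_bool cfun_def \<mu>.prob_space[simplified] scaleR_conv_of_real algebra_simps)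
  finally show ?thesis .
qed

section \<open>The standard Gaussian measure and its linear images\<close>

definition gauss_density :: "'a::euclidean_space \<Rightarrow> real" where
  "gauss_density x = (\<Prod>b\<in>Basis. std_normal_density (x \<bullet> b))"

definition gauss :: "'a::euclidean_space measure" where
  "gauss = density lborel (\<lambda>x. ennreal (gauss_density x))"

text \<open>The product form serves the characteristic function, where coordinates separate; this
  radial form serves the superlevel sets.\<close>

lemma gauss_density_eq:
  fixes x :: "'a::euclidean_space"
  shows "gauss_density x = (1 / sqrt (2 * pi)) ^ DIM('a) * exp (- (norm x)\<^sup>2 / 2)"
proof -
  have "(norm x)\<^sup>2 = (\<Sum>b\<in>Basis. (x \<bullet> b)\<^sup>2)"
    unfolding power2_norm_eq_inner by (subst euclidean_inner) (simp add: power2_eq_square)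
  then have "exp (- (norm x)\<^sup>2 / 2) = (\<Prod>b\<in>Basis. exp (- (x \<bullet> b)\<^sup>2 / 2))"
    by (simp add: exp_sum[symmetric] sum_negf sum_divide_distrib)
  then show ?thesis
    by (simp add: gauss_density_def std_normal_density_def prod.distrib prod_dividef power_one_over)
qed

lemma gauss_density_pos: "0 < gauss_density x"
  by (simp add: gauss_density_eq)

lemma gauss_density_mono: "norm x \<le> norm (y :: 'a::euclidean_space) \<Longrightarrow> gauss_density y \<le> gauss_density (x :: 'a)"
  by (simp add: gauss_density_eq divide_right_mono power_mono)

lemma continuous_gauss_density: "continuous_on UNIV gauss_density"
  unfolding gauss_density_eq[abs_def] by (intro continuous_intros) auto

lemma gauss_density_measurable [measurable]: "gauss_density \<in> borel_measurable borel"
  by (intro borel_measurable_continuous_onI continuous_gauss_density)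

lemma borel_prob_gauss: "borel_prob (gauss :: 'a::euclidean_space measure)"
proof (intro borel_prob.intro borel_prob_axioms.intro prob_spaceI)
  have "emeasure (gauss :: 'a measure) (space gauss) = (\<integral>\<^sup>+ x. (\<Prod>b\<in>Basis. ennreal (std_normal_density ((x::'a) \<bullet> b))) \<partial>lborel)"
    unfolding gauss_def gauss_density_def by (simp add: emeasure_density prod_ennreal)
  also have "\<dots> = (\<Prod>b\<in>(Basis :: 'a set). \<integral>\<^sup>+ x. ennreal (std_normal_density x) \<partial>lborel)"
    by (rule nn_integral_lborel_prod) auto
  also have "(\<integral>\<^sup>+ x. ennreal (std_normal_density x) \<partial>lborel) = 1"
    by (simp add: nn_integral_eq_integral)
  finally show "emeasure (gauss :: 'a measure) (space gauss) = 1" by simp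
qed (simp add: gauss_def)

lemma cfun_gauss: "cfun gauss (\<xi> :: 'a::euclidean_space) = exp (- of_real ((norm \<xi>)\<^sup>2) / 2)"
proof -
  interpret product_sigma_finite "\<lambda>_::'a. lborel :: real measure" by standard
  let ?f = "\<lambda>b s. complex_of_real (std_normal_density s) * iexp ((\<xi> \<bullet> b) * s)"
  have "integrable lborel std_normal_density" by simp
  then have int: "integrable lborel (?f b)" for b
    by (rule Bochner_Integration.integrable_bound) (auto simp: norm_mult)
  have "cfun gauss \<xi> = (LINT x|lborel. gauss_density x *\<^sub>R iexp (\<xi> \<bullet> x))"
    unfolding cfun_def gauss_def
    by (subst integral_density) (auto simp: less_imp_le[OF gauss_density_pos])
  also have "\<dots> = (LINT y|(\<Pi>\<^sub>M b\<in>Basis. lborel). (\<Prod>b\<in>Basis. ?f b (y b)))"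
  proof (subst lborel_eq, subst integral_distr)
    have "(\<Sum>b\<in>Basis. y b *\<^sub>R b) \<bullet> c = y c" if "c \<in> Basis" for y and c :: 'a
      using that by (rule inner_sum_left_Basis)
    then have "gauss_density (\<Sum>b\<in>Basis. y b *\<^sub>R b :: 'a) = (\<Prod>b\<in>Basis. std_normal_density (y b))" for y
      unfolding gauss_density_def by simp
    moreover have "iexp (\<xi> \<bullet> (\<Sum>b\<in>Basis. y b *\<^sub>R b)) = (\<Prod>b\<in>Basis. iexp ((\<xi> \<bullet> b) * y b))" for y
      by (simp add: inner_sum_right exp_sum[symmetric] sum_distrib_left mult.commute)
    ultimately show "(LINT y|(\<Pi>\<^sub>M b\<in>Basis. lborel). gauss_density (\<Sum>b\<in>Basis. y b *\<^sub>R b :: 'a) *\<^sub>R iexp (\<xi> \<bullet> (\<Sum>b\<in>Basis. y b *\<^sub>R b))) =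
      (LINT y|(\<Pi>\<^sub>M b\<in>Basis. lborel). (\<Prod>b\<in>Basis. ?f b (y b)))"
      by (simp add: scaleR_conv_of_real prod.distrib)
  qed auto
  also have "\<dots> = (\<Prod>b\<in>Basis. (LINT s|lborel. ?f b s))"
    by (rule product_integral_prod) (simp_all only: finite_Basis int)
  also have "\<dots> = (\<Prod>b\<in>Basis. exp (- of_real ((\<xi> \<bullet> b)\<^sup>2) / 2))"
  proof (rule prod.cong)
    fix b :: 'a
    have "(LINT s|lborel. ?f b s) = char std_normal_distribution (\<xi> \<bullet> b)"
      unfolding char_def by (subst integral_density) (auto simp: scaleR_conv_of_real)
    then show "(LINT s|lborel. ?f b s) = exp (- of_real ((\<xi> \<bullet> b)\<^sup>2) / 2)"
      by (simp add: char_std_normal_distribution exp_of_real[symmetric])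
  qed simp
  also have "\<dots> = exp (\<Sum>b\<in>Basis. - of_real ((\<xi> \<bullet> b)\<^sup>2) / 2)" by (simp add: exp_sum)
  also have "(\<Sum>b\<in>Basis. - of_real ((\<xi> \<bullet> b)\<^sup>2) / 2) = - complex_of_real ((norm \<xi>)\<^sup>2) / 2"
    unfolding power2_norm_eq_inner
    by (subst euclidean_inner) (simp add: power2_eq_square sum_negf sum_divide_distrib)
  finally show ?thesis .
qed

text \<open>A radial set can differ from its ball only by the boundary sphere. Openness excludes
  this, since each point of \<open>S\<close> can be pushed a little outwards within
  \<open>S\<close>.\<close>

lemma radial_open_rball:
  fixes S :: "'a::euclidean_space set"
  assumes "open S" and S: "\<And>x y. x \<in> S \<Longrightarrow> norm y \<le> norm x \<Longrightarrow> y \<in> S"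
  shows "S = rball (emeasure lborel S)"
proof (intro equalityI subsetI)
  have [measurable]: "S \<in> sets borel" using assms(1) by simp
  have "rball (emeasure lborel S) \<subseteq> S" by (rule radial_set_rball(1)) (simp_all add: S)
  then show "x \<in> S" if "x \<in> rball (emeasure lborel S)" for x using that by blast
  fix x assume x: "x \<in> S"
  obtain e where e: "0 < e" "ball x e \<subseteq> S" using assms(1) x by (auto simp: open_contains_ball)
  obtain b :: 'a where b: "b \<in> Basis" using nonempty_Basis by blast
  define r where "r = norm x + e / 2"
  have "ball 0 r \<subseteq> S"
  proof
    fix y :: 'a assume "y \<in> ball 0 r"
    then have y: "norm y < norm x + e / 2" by (simp add: r_def)
    \<comment> \<open>\<open>x\<close> pushed outwards by \<open>e / 2\<close>. The origin has no
      outward direction of its own, so a basis vector is used there.\<close>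
    define z where "z = (if x = 0 then (e / 2) *\<^sub>R b else (1 + e / (2 * norm x)) *\<^sub>R x)"
    have "norm z = norm x + e / 2" using e b by (auto simp: z_def field_simps)
    moreover have "z \<in> ball x e" using e b by (auto simp: z_def dist_norm algebra_simps)
    ultimately show "y \<in> S" using S[of z y] e y by auto
  qed
  then have "emeasure lborel (ball (0::'a) r) \<le> emeasure lborel S" by (rule emeasure_mono) simp
  moreover have "emeasure lborel (ball 0 (norm x) :: 'a set) < emeasure lborel (ball 0 r :: 'a set)"
    using e by (subst emeasure_lborel_ball_mono_iff) (auto simp: r_def)
  ultimately show "x \<in> rball (emeasure lborel S)" by (simp add: rball_def)
qed

lemma distr_gauss_linear:
  fixes f h :: "real ^ 'n \<Rightarrow> real ^ 'n"
  assumes lin: "linear f" "linear h" and inv: "\<And>x. h (f x) = x" and det: "det (matrix f) \<noteq> 0"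
  shows "distr gauss borel f = density lborel (\<lambda>y. ennreal (gauss_density (h y) / \<bar>det (matrix f)\<bar>))"
proof (rule measure_eqI)
  note [measurable] = borel_measurable_linear[OF lin(1)] borel_measurable_linear[OF lin(2)]
  interpret g: borel_prob "gauss :: (real ^ 'n) measure" by (rule borel_prob_gauss)
  fix S assume "S \<in> sets (distr (gauss :: (real ^ 'n) measure) borel f)"
  then have [measurable]: "S \<in> sets borel" by simp
  let ?D = "\<bar>det (matrix f)\<bar>"
  have D: "0 < ?D" using det by simp
  have "emeasure (distr gauss borel f) S = (\<integral>\<^sup>+ x. indicator S x \<partial>distr gauss borel f)" by simp
  also have "\<dots> = (\<integral>\<^sup>+ x. indicator S (f x) \<partial>gauss)" by (rule nn_integral_distr) measurable
  also have "\<dots> = (\<integral>\<^sup>+ x. ennreal (gauss_density (h (f x))) * indicator S (f x) \<partial>lborel)"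
    unfolding gauss_def by (subst nn_integral_density) (auto simp: inv)
  also have "\<dots> = (\<integral>\<^sup>+ x. ennreal ?D * (ennreal (gauss_density (h (f x)) / ?D) * indicator S (f x)) \<partial>lborel)"
  proof -
    have "ennreal (gauss_density z) = ennreal ?D * ennreal (gauss_density z / ?D)" for z :: "real ^ 'n"
      using D gauss_density_pos[of z] by (subst ennreal_mult[symmetric]) (simp_all add: less_imp_le)
    then show ?thesis by (simp only: mult.assoc)
  qed
  also have "\<dots> = ennreal ?D * (\<integral>\<^sup>+ x. ennreal (gauss_density (h (f x)) / ?D) * indicator S (f x) \<partial>lborel)"
    by (rule nn_integral_cmult) measurable
  also have "\<dots> = (\<integral>\<^sup>+ y. ennreal (gauss_density (h y) / ?D) * indicator S y \<partial>lborel)"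
    by (rule nn_integral_linear[OF lin(1) det, symmetric]) measurable
  also have "\<dots> = emeasure (density lborel (\<lambda>y. ennreal (gauss_density (h y) / ?D))) S"
    by (rule emeasure_density[symmetric]) auto
  finally show "emeasure (distr gauss borel f) S = \<dots>" .
qed simp

lemma det_matrix_scaleR: "det (matrix ((*\<^sub>R) c :: real ^ 'n \<Rightarrow> real ^ 'n)) = c ^ CARD('n)"
  by (subst det_diagonal) (auto simp: matrix_def axis_def)

text \<open>The superlevel sets of the density of a linear image are the images under
  \<open>f\<close> of those of the standard density, so their volumes are scaled by the determinant.
  A dilation by \<open>c\<close> scales volumes equally, which identifies the rearranged density;
  this is where the root of the determinant in the symmetrized matrix comes from.\<close>

lemma rearrangement_dominated_gauss:
  fixes f h :: "real ^ 'n \<Rightarrow> real ^ 'n"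
  assumes lin: "linear f" "linear h" and inv: "\<And>x. h (f x) = x" and det: "det (matrix f) \<noteq> 0"
    and c: "0 < c" "c ^ CARD('n) = \<bar>det (matrix f)\<bar>"
  shows "rearrangement_dominated (distr gauss borel f) (distr gauss borel ((*\<^sub>R) c))"
proof -
  note [measurable] = borel_measurable_linear[OF lin(1)] borel_measurable_linear[OF lin(2)]
  define D where "D = \<bar>det (matrix f)\<bar>"
  have D: "0 < D" using det by (simp add: D_def)
  let ?\<phi> = "\<lambda>y. ennreal (gauss_density (h y) / D)"
  let ?\<phi>' = "\<lambda>y :: real ^ 'n. ennreal (gauss_density ((1 / c) *\<^sub>R y) / D)"
  have lins: "linear ((*\<^sub>R) r :: real ^ 'n \<Rightarrow> real ^ 'n)" for r by (simp add: linear_iff scaleR_add_right)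
  have d1: "distr gauss borel f = density lborel ?\<phi>"
    unfolding D_def by (rule distr_gauss_linear[OF lin inv det])
  have d2: "distr gauss borel ((*\<^sub>R) c) = density lborel ?\<phi>'"
    using distr_gauss_linear[OF lins lins, of "1 / c" c] c det by (simp add: det_matrix_scaleR D_def)
  have vol: "emeasure lborel {y. ennreal t < ennreal (gauss_density (k y) / D)} = ennreal D * emeasure lborel {x :: real ^ 'n. ennreal t < ennreal (gauss_density x / D)}"
    if l: "linear l" "linear k" "\<And>x. k (l x) = x" "det (matrix l) \<noteq> 0" "\<bar>det (matrix l)\<bar> = D"
    for t and k l :: "real ^ 'n \<Rightarrow> real ^ 'n"
  proof -
    note [measurable] = borel_measurable_linear[OF l(1)] borel_measurable_linear[OF l(2)]
    have "emeasure lborel {y. ennreal t < ennreal (gauss_density (k y) / D)} = (\<integral>\<^sup>+ y. indicator {x. ennreal t < ennreal (gauss_density x / D)} (k y) \<partial>lborel)"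
    proof -
      have "emeasure lborel {y. ennreal t < ennreal (gauss_density (k y) / D)} = (\<integral>\<^sup>+ y. indicator {y. ennreal t < ennreal (gauss_density (k y) / D)} y \<partial>lborel)"
        by (rule nn_integral_indicator[symmetric]) measurable
      then show ?thesis by (simp add: indicator_def)
    qed
    also have "\<dots> = ennreal D * (\<integral>\<^sup>+ x. indicator {x. ennreal t < ennreal (gauss_density x / D)} (k (l x)) \<partial>lborel)"
      unfolding l(5)[symmetric] by (rule nn_integral_linear[OF l(1,4)]) measurable
    finally show ?thesis by (simp add: l(3))
  qed
  show ?thesis
    unfolding d1 d2
  proof (rule rearrangement_dominated_density)
    fix t :: real assume "0 \<le> t"
    have "{x. ennreal t < ?\<phi>' x} = rball (emeasure lborel {x. ennreal t < ?\<phi>' x})"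
    proof (rule radial_open_rball)
      have "continuous_on UNIV (\<lambda>y :: real ^ 'n. gauss_density ((1 / c) *\<^sub>R y) / D)"
        using D by (intro continuous_on_divide continuous_on_compose2[OF continuous_gauss_density] continuous_intros) auto
      then have "open {x :: real ^ 'n. t < gauss_density ((1 / c) *\<^sub>R x) / D}"
        by (intro open_Collect_less) auto
      then show "open {x. ennreal t < ?\<phi>' x}" using \<open>0 \<le> t\<close> by (simp add: ennreal_less_iff)
      show "y \<in> {x. ennreal t < ?\<phi>' x}" if x: "x \<in> {x. ennreal t < ?\<phi>' x}" and xy: "norm y \<le> norm x" for x y
      proof -
        have "gauss_density ((1 / c) *\<^sub>R x) / D \<le> gauss_density ((1 / c) *\<^sub>R y) / D"
          using c D xy by (intro divide_right_mono gauss_density_mono) (auto simp: divide_right_mono)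
        then have "?\<phi>' x \<le> ?\<phi>' y" by (rule ennreal_leI)
        with x show ?thesis by (auto intro: less_le_trans)
      qed
    qed
    also have "emeasure lborel {x. ennreal t < ?\<phi>' x} = ennreal D * emeasure lborel {x :: real ^ 'n. ennreal t < ennreal (gauss_density x / D)}"
      by (rule vol[OF lins[of c] lins]) (use c D in \<open>auto simp: det_matrix_scaleR D_def\<close>)
    also have "\<dots> = emeasure lborel {x. ennreal t < ?\<phi> x}"
      by (rule vol[OF lin inv det, symmetric]) (simp add: D_def)
    finally show "{x. ennreal t < ?\<phi>' x} = rball (emeasure lborel {x. ennreal t < ?\<phi> x})" .
  next
    interpret g: borel_prob "gauss :: (real ^ 'n) measure" by (rule borel_prob_gauss)
    have "prob_space (distr (gauss :: (real ^ 'n) measure) borel f)" by (rule g.prob_space_distr) simp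
    then have "emeasure (density lborel ?\<phi>) UNIV = 1"
      unfolding d1[symmetric] by (drule_tac prob_space.emeasure_space_1) simp
    then show "(\<integral>\<^sup>+ x. ?\<phi> x \<partial>lborel) = 1" by (simp add: emeasure_density)
  qed measurable
qed

section \<open>Weak limits\<close>

definition lower_semicont :: "('a::topological_space \<Rightarrow> ennreal) \<Rightarrow> bool" where
  "lower_semicont f \<longleftrightarrow> (\<forall>x u. u \<longlonglongrightarrow> x \<longrightarrow> f x \<le> liminf (\<lambda>n. f (u n)))"

lemma lower_semicontD: "lower_semicont f \<Longrightarrow> u \<longlonglongrightarrow> x \<Longrightarrow> f x \<le> liminf (\<lambda>n. f (u n))"
  by (auto simp: lower_semicont_def)

lemma Liminf_add_superadditive_ennreal:
  fixes a b :: "nat \<Rightarrow> ennreal"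
  shows "liminf a + liminf b \<le> liminf (\<lambda>n. a n + b n)"
proof -
  have inc: "incseq (\<lambda>n. INF m\<in>{n..}. x m)" for x :: "nat \<Rightarrow> ennreal"
    by (intro incseq_SucI INF_superset_mono) auto
  have "liminf a + liminf b = (SUP n. (INF m\<in>{n..}. a m) + (INF m\<in>{n..}. b m))"
    unfolding liminf_SUP_INF by (rule ennreal_SUP_add[OF inc inc, symmetric])
  also have "\<dots> \<le> (SUP n. INF m\<in>{n..}. a m + b m)"
    by (intro SUP_mono bexI[of _ "_ :: nat"] INF_greatest add_mono INF_lower) auto
  also have "\<dots> = liminf (\<lambda>n. a n + b n)" unfolding liminf_SUP_INF ..
  finally show ?thesis .
qed

text \<open>For open \<open>F\<close> this is Fatou's lemma. In general \<open>F\<close> is replaced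
  by an open superset of excess volume below \<open>e\<close>, and translations do not change the
  excess.\<close>

lemma lower_semicont_overlap:
  fixes E F :: "'a::euclidean_space set"
  assumes [measurable]: "E \<in> sets borel" "F \<in> sets borel"
  shows "lower_semicont (overlap E F)"
  unfolding lower_semicont_def
proof (intro allI impI)
  fix u :: "nat \<Rightarrow> 'a" and z assume u: "u \<longlonglongrightarrow> z"
  show "overlap E F z \<le> liminf (\<lambda>n. overlap E F (u n))"
  proof (rule ennreal_le_epsilon)
    fix e :: real assume e: "0 < e"
    obtain U where U: "open U" "F \<subseteq> U" "emeasure lborel (U - F) < ennreal e"
      using outer_regular_lborel[OF assms(2) e] by blast
    have [measurable]: "U \<in> sets borel" using U(1) by simp
    have "overlap E F z \<le> (\<integral>\<^sup>+ x. liminf (\<lambda>n. indicator E x * indicator U (x + u n)) \<partial>lborel)"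
      unfolding overlap_def
    proof (rule nn_integral_mono)
      fix x
      show "(indicator E x * indicator F (x + z) :: ennreal) \<le> liminf (\<lambda>n. indicator E x * indicator U (x + u n))"
      proof (cases "x + z \<in> F")
        case True
        have "(\<lambda>n. x + u n) \<longlonglongrightarrow> x + z" by (intro tendsto_intros u)
        then have "\<forall>\<^sub>F n in sequentially. x + u n \<in> U" using U True by (auto dest: topological_tendstoD)
        then have "\<forall>\<^sub>F n in sequentially. indicator E x * indicator F (x + z) \<le> (indicator E x * indicator U (x + u n) :: ennreal)"
          by eventually_elim (auto split: split_indicator)
        then show ?thesis by (rule Liminf_bounded)
      qed simp
    qed
    also have "\<dots> \<le> liminf (\<lambda>n. overlap E U (u n))"
      unfolding overlap_def by (rule nn_integral_liminf) measurable
    also have "\<dots> \<le> liminf (\<lambda>n. overlap E F (u n) + ennreal e)"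
    proof (intro Liminf_mono always_eventually allI)
      fix n
      have "overlap E U (u n) \<le> (\<integral>\<^sup>+ x. indicator E x * indicator F (x + u n) + indicator (U - F) (u n + x) \<partial>lborel)"
        unfolding overlap_def by (intro nn_integral_mono) (auto simp: add.commute split: split_indicator)
      also have "\<dots> = overlap E F (u n) + emeasure lborel (U - F)"
        unfolding overlap_def by (subst nn_integral_add, simp, simp) (subst nn_integral_lborel_translate, simp_all)
      also have "\<dots> \<le> overlap E F (u n) + ennreal e" using U(3) by (intro add_left_mono) simp
      finally show "overlap E U (u n) \<le> overlap E F (u n) + ennreal e" .
    qed
    also have "\<dots> \<le> liminf (\<lambda>n. overlap E F (u n)) + ennreal e" by (simp add: Liminf_add_const)
    finally show "overlap E F z \<le> liminf (\<lambda>n. overlap E F (u n)) + ennreal e" .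
  qed
qed

text \<open>Both summands are lower semicontinuous and their sum is constant, so for
  \<open>E\<close> of finite volume each of them is controlled from above as well.\<close>

lemma overlap_complement:
  assumes [measurable]: "E \<in> sets borel" "F \<in> sets borel"
  shows "overlap E F u + overlap E (- F) u = emeasure lborel E"
proof -
  have "overlap E F u + overlap E (- F) u =
      (\<integral>\<^sup>+ x. indicator E x * indicator F (x + u) + indicator E x * indicator (- F) (x + u) \<partial>lborel)"
    unfolding overlap_def by (rule nn_integral_add[symmetric]) measurable
  also have "\<dots> = (\<integral>\<^sup>+ x. indicator E x \<partial>lborel)"
    by (intro nn_integral_cong) (auto split: split_indicator)
  finally show ?thesis by simp
qed

lemma nn_integral_overlap_finite:
  assumes [measurable]: "E \<in> sets borel" "F \<in> sets borel"
  shows "(\<integral>\<^sup>+ u. overlap E F u \<partial>lborel) = emeasure lborel E * emeasure lborel F"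
proof -
  have "(\<integral>\<^sup>+ u. overlap E F u \<partial>lborel) = (\<integral>\<^sup>+ x. \<integral>\<^sup>+ u. indicator E x * indicator F (x + u) \<partial>lborel \<partial>lborel)"
    unfolding overlap_def by (rule lborel_pair.Fubini') measurable
  also have "\<dots> = (\<integral>\<^sup>+ x. indicator E x * emeasure lborel F \<partial>lborel)"
    by (intro nn_integral_cong) (subst nn_integral_cmult, simp, subst nn_integral_lborel_translate, simp_all)
  also have "\<dots> = emeasure lborel E * emeasure lborel F"
    by (subst nn_integral_multc) simp_all
  finally show ?thesis .
qed

section \<open>Gaussian smoothing and passage to the limit\<close>

abbreviation small_gauss :: "real \<Rightarrow> 'a::euclidean_space measure" where
  "small_gauss \<delta> \<equiv> distr gauss borel ((*\<^sub>R) \<delta>)"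

lemma borel_prob_distr_gauss: "f \<in> borel_measurable borel \<Longrightarrow> borel_prob (distr gauss borel f)"
proof -
  assume [measurable]: "f \<in> borel_measurable borel"
  interpret g: borel_prob gauss by (rule borel_prob_gauss)
  show ?thesis by (intro borel_prob.intro borel_prob_axioms.intro g.prob_space_distr) auto
qed

lemma lower_semicont_smoothing:
  fixes f :: "'a::euclidean_space \<Rightarrow> ennreal"
  assumes \<mu>: "borel_prob \<mu>" and [measurable]: "f \<in> borel_measurable borel" and f: "lower_semicont f"
  shows "(\<integral>\<^sup>+ x. f x \<partial>\<mu>) \<le> liminf (\<lambda>k. \<integral>\<^sup>+ x. f x \<partial>conv \<mu> (small_gauss (1 / real (Suc k))))"
proof -
  interpret \<mu>: borel_prob \<mu> by fact
  interpret g: borel_prob "gauss :: 'a measure" by (rule borel_prob_gauss)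
  have "(\<integral>\<^sup>+ x. f x \<partial>\<mu>) = (\<integral>\<^sup>+ x. \<integral>\<^sup>+ w. f x \<partial>(gauss :: 'a measure) \<partial>\<mu>)"
    by (simp add: g.emeasure_space_1[simplified])
  also have "\<dots> \<le> (\<integral>\<^sup>+ x. \<integral>\<^sup>+ w. liminf (\<lambda>k. f (x + (1 / real (Suc k)) *\<^sub>R w)) \<partial>gauss \<partial>\<mu>)"
  proof (intro nn_integral_mono lower_semicontD[OF f])
    fix x w :: 'a
    have "(\<lambda>k. x + (1 / real (Suc k)) *\<^sub>R w) \<longlonglongrightarrow> x + 0 *\<^sub>R w"
      using LIMSEQ_inverse_real_of_nat by (intro tendsto_intros) (simp add: inverse_eq_divide)
    then show "(\<lambda>k. x + (1 / real (Suc k)) *\<^sub>R w) \<longlonglongrightarrow> x" by simp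
  qed
  also have "\<dots> \<le> (\<integral>\<^sup>+ x. liminf (\<lambda>k. \<integral>\<^sup>+ w. f (x + (1 / real (Suc k)) *\<^sub>R w) \<partial>gauss) \<partial>\<mu>)"
    by (intro nn_integral_mono nn_integral_liminf) measurable
  also have "\<dots> \<le> liminf (\<lambda>k. \<integral>\<^sup>+ x. \<integral>\<^sup>+ w. f (x + (1 / real (Suc k)) *\<^sub>R w) \<partial>gauss \<partial>\<mu>)"
    by (intro nn_integral_liminf) measurable
  also have "(\<lambda>k. \<integral>\<^sup>+ x. \<integral>\<^sup>+ w. f (x + (1 / real (Suc k)) *\<^sub>R w) \<partial>gauss \<partial>\<mu>) =
      (\<lambda>k. \<integral>\<^sup>+ x. f x \<partial>conv \<mu> (small_gauss (1 / real (Suc k))))"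
    by (subst nn_integral_conv[OF \<mu> borel_prob_distr_gauss]) (simp_all add: nn_integral_distr)
  finally show ?thesis .
qed

text \<open>Removes the noise on both sides. The integral of \<open>f\<close> can only drop in the
  limit; that of \<open>f'\<close> can only rise, because its complement \<open>h\<close> is lower
  semicontinuous. The two Fatou estimates are added, and the finite integral of \<open>h\<close>
  cancels.\<close>

lemma smoothing_compare:
  fixes f f' h :: "'a::euclidean_space \<Rightarrow> ennreal"
  assumes \<mu>: "borel_prob \<mu>" and \<mu>': "borel_prob \<mu>'"
    and [measurable]: "f \<in> borel_measurable borel" "f' \<in> borel_measurable borel" "h \<in> borel_measurable borel"
    and lsc: "lower_semicont f" "lower_semicont h" and sum: "\<And>x. f' x + h x = C" and C: "C < \<top>"
    and le: "\<And>k. (\<integral>\<^sup>+ x. f x \<partial>conv \<mu> (small_gauss (1 / real (Suc k)))) \<le> (\<integral>\<^sup>+ x. f' x \<partial>conv \<mu>' (small_gauss (1 / real (Suc k))))"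
  shows "(\<integral>\<^sup>+ x. f x \<partial>\<mu>) \<le> (\<integral>\<^sup>+ x. f' x \<partial>\<mu>')"
proof -
  define c where "c k = conv \<mu>' (small_gauss (1 / real (Suc k)) :: 'a measure)" for k
  have tot: "(\<integral>\<^sup>+ x. f' x \<partial>\<nu>) + (\<integral>\<^sup>+ x. h x \<partial>\<nu>) = C" if "borel_prob \<nu>" for \<nu>
  proof -
    interpret \<nu>: borel_prob \<nu> by fact
    have "(\<integral>\<^sup>+ x. f' x \<partial>\<nu>) + (\<integral>\<^sup>+ x. h x \<partial>\<nu>) = (\<integral>\<^sup>+ x. C \<partial>\<nu>)"
      by (subst nn_integral_add[symmetric]) (simp_all add: sum)
    then show ?thesis by (simp add: \<nu>.emeasure_space_1[simplified])
  qed
  have "(\<integral>\<^sup>+ x. f x \<partial>\<mu>) + (\<integral>\<^sup>+ x. h x \<partial>\<mu>') \<le>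
     liminf (\<lambda>k. \<integral>\<^sup>+ x. f x \<partial>conv \<mu> (small_gauss (1 / real (Suc k)))) + liminf (\<lambda>k. \<integral>\<^sup>+ x. h x \<partial>c k)"
    unfolding c_def by (intro add_mono lower_semicont_smoothing \<mu> \<mu>' lsc) measurable
  also have "\<dots> \<le> liminf (\<lambda>k. \<integral>\<^sup>+ x. f' x \<partial>c k) + liminf (\<lambda>k. \<integral>\<^sup>+ x. h x \<partial>c k)"
    unfolding c_def by (intro add_right_mono Liminf_mono always_eventually allI le)
  also have "\<dots> \<le> liminf (\<lambda>k. (\<integral>\<^sup>+ x. f' x \<partial>c k) + (\<integral>\<^sup>+ x. h x \<partial>c k))"
    by (rule Liminf_add_superadditive_ennreal)
  also have "\<dots> = C"
  proof -
    have "(\<integral>\<^sup>+ x. f' x \<partial>c k) + (\<integral>\<^sup>+ x. h x \<partial>c k) = C" for k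
      unfolding c_def by (intro tot borel_prob_conv \<mu>' borel_prob_distr_gauss) measurable
    then show ?thesis by (simp add: Liminf_const)
  qed
  also have "\<dots> = (\<integral>\<^sup>+ x. f' x \<partial>\<mu>') + (\<integral>\<^sup>+ x. h x \<partial>\<mu>')" using tot[OF \<mu>'] by simp
  finally have le: "(\<integral>\<^sup>+ x. h x \<partial>\<mu>') + (\<integral>\<^sup>+ x. f x \<partial>\<mu>) \<le> (\<integral>\<^sup>+ x. h x \<partial>\<mu>') + (\<integral>\<^sup>+ x. f' x \<partial>\<mu>')"
    by (simp add: add.commute)
  have "(\<integral>\<^sup>+ x. h x \<partial>\<mu>') \<le> C" unfolding tot[OF \<mu>', symmetric] by simp
  then have "(\<integral>\<^sup>+ x. h x \<partial>\<mu>') \<noteq> \<top>" using C by auto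
  with le show ?thesis unfolding ennreal_add_left_cancel_le by simp
qed

text \<open>No tightness is involved: the smoothed law has a bounded density \<open>H\<close>, which
  is a Gaussian integral of the characteristic function. Pointwise convergence of characteristic
  functions thus gives pointwise convergence of densities with a common bound.\<close>

lemma smoothing_tendsto:
  fixes \<mu> :: "(real ^ 'n) measure" and f :: "real ^ 'n \<Rightarrow> ennreal"
  assumes \<mu>: "borel_prob \<mu>" and M: "\<And>n. borel_prob (M n)" and [measurable]: "f \<in> borel_measurable borel"
    and fin: "(\<integral>\<^sup>+ x. f x \<partial>lborel) < \<top>" and lim: "\<And>\<xi>. (\<lambda>n. cfun (M n) \<xi>) \<longlonglongrightarrow> cfun \<mu> \<xi>" and \<delta>: "0 < \<delta>"
  shows "(\<lambda>n. \<integral>\<^sup>+ x. f x \<partial>conv (M n) (small_gauss \<delta>)) \<longlonglongrightarrow> (\<integral>\<^sup>+ x. f x \<partial>conv \<mu> (small_gauss \<delta>))"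
proof -
  interpret g: borel_prob "gauss :: (real ^ 'n) measure" by (rule borel_prob_gauss)
  define D where "D = \<delta> ^ CARD('n)"
  have D: "0 < D" using \<delta> by (simp add: D_def)
  define K where "K = (1 / sqrt (2 * pi)) ^ DIM(real ^ 'n)"
  have K: "0 < K" by (simp add: K_def)
  define \<psi> where "\<psi> x = gauss_density ((1 / \<delta>) *\<^sub>R x) / D" for x :: "real ^ 'n"
  have [measurable]: "\<psi> \<in> borel_measurable borel" unfolding \<psi>_def[abs_def] by measurable
  have \<psi>0: "0 \<le> \<psi> x" and \<psi>K: "\<psi> x \<le> K / D" for x
  proof -
    show "0 \<le> \<psi> x" unfolding \<psi>_def using D gauss_density_pos by (intro divide_nonneg_nonneg) (auto intro: less_imp_le)
    have "gauss_density ((1 / \<delta>) *\<^sub>R x) \<le> gauss_density (0 :: real ^ 'n)" by (rule gauss_density_mono) simp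
    also have "\<dots> = K" by (simp add: gauss_density_eq K_def)
    finally show "\<psi> x \<le> K / D" unfolding \<psi>_def using D by (intro divide_right_mono) auto
  qed
  have lins: "linear ((*\<^sub>R) r :: real ^ 'n \<Rightarrow> real ^ 'n)" for r by (simp add: linear_iff scaleR_add_right)
  have sg: "small_gauss \<delta> = density lborel (\<lambda>x :: real ^ 'n. ennreal (\<psi> x))"
    using distr_gauss_linear[OF lins lins, of "1 / \<delta>" \<delta>] \<delta> by (simp add: det_matrix_scaleR D_def \<psi>_def)
  define H where "H \<nu> y = (LINT u|\<nu>. \<psi> (y - u))" for \<nu> :: "(real ^ 'n) measure" and y
  have eq: "(\<integral>\<^sup>+ x. f x \<partial>conv \<nu> (small_gauss \<delta>)) = (\<integral>\<^sup>+ y. f y * ennreal (H \<nu> y) \<partial>lborel)"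
    and Hm: "H \<nu> \<in> borel_measurable borel" and HK: "H \<nu> y \<le> K / D" and H0: "0 \<le> H \<nu> y"
    if \<nu>: "borel_prob \<nu>" for \<nu> y
  proof -
    interpret \<nu>: borel_prob \<nu> by fact
    interpret P: pair_sigma_finite lborel \<nu> ..
    have int: "integrable \<nu> (\<lambda>u. \<psi> (y - u))" for y
      by (rule \<nu>.integrable_const_bound[where B="K / D"]) (auto simp: \<psi>0 \<psi>K)
    have "(\<integral>\<^sup>+ x. f x \<partial>conv \<nu> (small_gauss \<delta>)) = (\<integral>\<^sup>+ u. \<integral>\<^sup>+ w. ennreal (\<psi> w) * f (u + w) \<partial>lborel \<partial>\<nu>)"
      by (subst nn_integral_conv[OF \<nu> borel_prob_distr_gauss]) (simp_all add: sg nn_integral_density)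
    also have "\<dots> = (\<integral>\<^sup>+ u. \<integral>\<^sup>+ y. f y * ennreal (\<psi> (y - u)) \<partial>lborel \<partial>\<nu>)"
    proof (rule nn_integral_cong)
      fix u :: "real ^ 'n"
      show "(\<integral>\<^sup>+ w. ennreal (\<psi> w) * f (u + w) \<partial>lborel) = (\<integral>\<^sup>+ y. f y * ennreal (\<psi> (y - u)) \<partial>lborel)"
        using nn_integral_lborel_translate[of "\<lambda>y. f y * ennreal (\<psi> (y - u))" u] by (simp add: mult.commute)
    qed
    also have "\<dots> = (\<integral>\<^sup>+ y. \<integral>\<^sup>+ u. f y * ennreal (\<psi> (y - u)) \<partial>\<nu> \<partial>lborel)"
      by (rule P.Fubini') measurable
    also have "\<dots> = (\<integral>\<^sup>+ y. f y * ennreal (H \<nu> y) \<partial>lborel)"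
      unfolding H_def using int \<psi>0 by (intro nn_integral_cong) (simp add: nn_integral_cmult nn_integral_eq_integral)
    finally show "(\<integral>\<^sup>+ x. f x \<partial>conv \<nu> (small_gauss \<delta>)) = (\<integral>\<^sup>+ y. f y * ennreal (H \<nu> y) \<partial>lborel)" .
    show "H \<nu> \<in> borel_measurable borel" unfolding H_def[abs_def] by measurable
    have "H \<nu> y \<le> (LINT u|\<nu>. K / D)" unfolding H_def by (intro integral_mono int) (auto simp: \<psi>K)
    then show "H \<nu> y \<le> K / D" by (simp add: \<nu>.prob_space[simplified])
    show "0 \<le> H \<nu> y" unfolding H_def by (intro integral_nonneg_AE) (simp add: \<psi>0)
  qed
  \<comment> \<open>Up to a constant the Gaussian density is its own characteristic function.
    Writing it as such and exchanging the integrals brings out \<open>cfun \<nu>\<close>.\<close>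
  have Hc: "complex_of_real (H \<nu> y) = of_real (K / D) * (LINT w|gauss. iexp (((1 / \<delta>) *\<^sub>R y) \<bullet> w) * cfun \<nu> (- ((1 / \<delta>) *\<^sub>R w)))"
    if \<nu>: "borel_prob \<nu>" for \<nu> y
  proof -
    interpret \<nu>: borel_prob \<nu> by fact
    interpret P: pair_prob_space \<nu> "gauss :: (real ^ 'n) measure" ..
    have "complex_of_real (H \<nu> y) = (LINT u|\<nu>. complex_of_real (\<psi> (y - u)))"
      unfolding H_def by simp
    also have "\<dots> = (LINT u|\<nu>. of_real (K / D) * (LINT w|gauss. iexp (((1 / \<delta>) *\<^sub>R (y - u)) \<bullet> w)))"
    proof (intro Bochner_Integration.integral_cong refl)
      fix u
      have "(LINT w|gauss. iexp (((1 / \<delta>) *\<^sub>R (y - u)) \<bullet> w)) = cfun gauss ((1 / \<delta>) *\<^sub>R (y - u))"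
        by (simp add: cfun_def)
      then show "complex_of_real (\<psi> (y - u)) = of_real (K / D) * (LINT w|gauss. iexp (((1 / \<delta>) *\<^sub>R (y - u)) \<bullet> w))"
        unfolding cfun_gauss \<psi>_def gauss_density_eq K_def by (simp add: exp_of_real[symmetric])
    qed
    also have "\<dots> = of_real (K / D) * (LINT u|\<nu>. LINT w|gauss. iexp (((1 / \<delta>) *\<^sub>R (y - u)) \<bullet> w))"
      by simp
    also have "(LINT u|\<nu>. LINT w|gauss. iexp (((1 / \<delta>) *\<^sub>R (y - u)) \<bullet> w)) = (LINT w|gauss. LINT u|\<nu>. iexp (((1 / \<delta>) *\<^sub>R (y - u)) \<bullet> w))"
      by (rule P.Fubini_integral[symmetric]) (rule P.integrable_const_bound[where B=1], auto simp: split_beta')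
    also have "\<dots> = (LINT w|gauss. iexp (((1 / \<delta>) *\<^sub>R y) \<bullet> w) * cfun \<nu> (- ((1 / \<delta>) *\<^sub>R w)))"
    proof (intro Bochner_Integration.integral_cong refl)
      fix w :: "real ^ 'n"
      have "iexp (((1 / \<delta>) *\<^sub>R (y - u)) \<bullet> w) = iexp (((1 / \<delta>) *\<^sub>R y) \<bullet> w) * iexp ((- ((1 / \<delta>) *\<^sub>R w)) \<bullet> u)" for u
        by (simp add: exp_add[symmetric] inner_diff_left inner_commute[of w u] right_diff_distrib diff_divide_distrib)
      then show "(LINT u|\<nu>. iexp (((1 / \<delta>) *\<^sub>R (y - u)) \<bullet> w)) = iexp (((1 / \<delta>) *\<^sub>R y) \<bullet> w) * cfun \<nu> (- ((1 / \<delta>) *\<^sub>R w))"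
        by (simp add: cfun_def)
    qed
    finally show ?thesis .
  qed
  have Hlim: "(\<lambda>n. H (M n) y) \<longlonglongrightarrow> H \<mu> y" for y
  proof -
    have cm: "(\<lambda>w. cfun \<nu> (- ((1 / \<delta>) *\<^sub>R w))) \<in> borel_measurable borel" if "borel_prob \<nu>" for \<nu> :: "(real ^ 'n) measure"
    proof -
      interpret \<nu>: borel_prob \<nu> by fact
      show ?thesis unfolding cfun_def by measurable
    qed
    note [measurable] = cm[OF \<mu>] cm[OF M]
    have "(\<lambda>n. complex_of_real (H (M n) y)) \<longlonglongrightarrow> complex_of_real (H \<mu> y)"
      unfolding Hc[OF \<mu>] Hc[OF M]
    proof (intro tendsto_mult_left integral_dominated_convergence[where w="\<lambda>_. 1"])
      show "AE w in gauss. (\<lambda>n. iexp (((1 / \<delta>) *\<^sub>R y) \<bullet> w) * cfun (M n) (- ((1 / \<delta>) *\<^sub>R w))) \<longlonglongrightarrow>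
          iexp (((1 / \<delta>) *\<^sub>R y) \<bullet> w) * cfun \<mu> (- ((1 / \<delta>) *\<^sub>R w))"
        by (intro always_eventually allI tendsto_mult_left lim)
      show "AE w in gauss. norm (iexp (((1 / \<delta>) *\<^sub>R y) \<bullet> w) * cfun (M n) (- ((1 / \<delta>) *\<^sub>R w))) \<le> 1" for n
        using borel_prob.norm_cfun_le[OF M] by (simp add: norm_mult)
      show "(\<lambda>w. iexp (((1 / \<delta>) *\<^sub>R y) \<bullet> w) * cfun \<mu> (- ((1 / \<delta>) *\<^sub>R w))) \<in> borel_measurable gauss"
        by (intro borel_measurable_times) (simp_all add: cm[OF \<mu>] measurable_cong_sets[OF g.sets_eq_borel refl])
      show "(\<lambda>w. iexp (((1 / \<delta>) *\<^sub>R y) \<bullet> w) * cfun (M n) (- ((1 / \<delta>) *\<^sub>R w))) \<in> borel_measurable gauss" for n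
        by (intro borel_measurable_times) (simp_all add: cm[OF M] measurable_cong_sets[OF g.sets_eq_borel refl])
    qed simp
    then show ?thesis by (simp only: tendsto_of_real_iff)
  qed
  note [measurable] = Hm[OF \<mu>] Hm[OF M]
  show ?thesis
    unfolding eq[OF \<mu>] eq[OF M]
  proof (rule nn_integral_dominated_convergence[where w="\<lambda>y. f y * ennreal (K / D)"])
    show "AE y in lborel. f y * ennreal (H (M n) y) \<le> f y * ennreal (K / D)" for n
      by (intro always_eventually allI mult_left_mono ennreal_leI HK M) simp
    show "(\<integral>\<^sup>+ y. f y * ennreal (K / D) \<partial>lborel) < \<infinity>"
      using fin by (subst nn_integral_multc) (simp_all add: ennreal_mult_less_top)
    have "AE y in lborel. f y \<noteq> \<infinity>" using fin by (intro nn_integral_PInf_AE) auto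
    then show "AE y in lborel. (\<lambda>n. f y * ennreal (H (M n) y)) \<longlonglongrightarrow> f y * ennreal (H \<mu> y)"
    proof eventually_elim
      case (elim y)
      then show ?case by (intro ennreal_tendsto_cmult tendsto_ennrealI Hlim) (simp add: less_top[symmetric])
    qed
  qed measurable
qed

lemma rearrangement_dominated_small_gauss:
  assumes "0 < \<delta>"
  shows "rearrangement_dominated (small_gauss \<delta> :: (real ^ 'n) measure) (small_gauss \<delta>)"
proof -
  have lins: "linear ((*\<^sub>R) r :: real ^ 'n \<Rightarrow> real ^ 'n)" for r by (simp add: linear_iff scaleR_add_right)
  show ?thesis
    by (rule rearrangement_dominated_gauss[OF lins lins[of "1 / \<delta>"]]) (use assms in \<open>auto simp: det_matrix_scaleR\<close>)
qed

lemma radially_decreasing_overlap: "radially_decreasing (overlap (rball w) (rball v))"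
proof -
  have "overlap (rball w) (rball v) u = emeasure lborel (rball w \<inter> {x. u + x \<in> rball v})" for u :: 'a
  proof -
    have "overlap (rball w) (rball v) u = (\<integral>\<^sup>+ x. indicator (rball w \<inter> {x. u + x \<in> rball v}) x \<partial>lborel)"
      unfolding overlap_def by (intro nn_integral_cong) (auto simp: add.commute split: split_indicator)
    also have "\<dots> = emeasure lborel (rball w \<inter> {x. u + x \<in> rball v})"
      by (rule nn_integral_indicator) measurable
    finally show ?thesis .
  qed
  then show ?thesis by (simp add: radially_decreasing_def ball_intersection_decreasing)
qed

text \<open>Overlaps act as blurred indicators of balls: divided by the volume of the ball of radius
  \<open>e\<close>, the overlap with the ball of radius \<open>r\<close> lies between the indicators
  of the balls of radii \<open>r - e\<close> and \<open>r + e\<close>. The gap between the radii is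
  closed from below, since the balls are open.\<close>

lemma unimodalI_overlap:
  fixes \<mu> :: "'a::euclidean_space measure"
  assumes \<mu>: "borel_prob \<mu>"
    and le: "\<And>w v x y. w < \<top> \<Longrightarrow> v < \<top> \<Longrightarrow> norm y \<le> norm x \<Longrightarrow>
      shift_avg \<mu> (overlap (rball w) (rball v)) x \<le> shift_avg \<mu> (overlap (rball w) (rball v)) y"
  shows "unimodal \<mu>"
  unfolding unimodal_def radially_decreasing_def
proof (intro allI impI)
  interpret \<mu>: borel_prob \<mu> by fact
  fix v and x y :: 'a assume xy: "norm y \<le> norm x"
  have meas[measurable]: "{u. z + u \<in> ball 0 r} \<in> sets borel" for z :: 'a and r
  proof -
    have [measurable]: "ball 0 r \<in> sets (borel :: 'a measure)" by (rule sets_ball_borel)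
    show ?thesis by measurable
  qed
  have gap: "emeasure \<mu> {u. x + u \<in> ball 0 a} \<le> emeasure \<mu> {u. y + u \<in> ball 0 b}" if ab: "a < b" for a b
  proof (cases "0 \<le> a")
    case False
    then have "{u. x + u \<in> ball 0 a} = {}" by (auto dest: le_less_trans[OF norm_ge_zero])
    then show ?thesis by (simp only: emeasure_empty zero_le)
  next
    case True
    define e r where "e = (b - a) / 2" and "r = (a + b) / 2"
    have e: "0 < e" "0 < r" "r - e = a" "r + e = b" using ab True by (auto simp: e_def r_def field_simps)
    let ?E = "ball 0 e :: 'a set" and ?F = "ball 0 r :: 'a set"
    let ?V = "emeasure lborel ?E"
    have rb: "rball ?V = ?E" "rball (emeasure lborel ?F) = ?F" using e by auto
    have V: "?V \<noteq> \<top>" using emeasure_ball_less_top[of "0::'a" e] by (rule less_imp_neq)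
    have "emeasure \<mu> {u. x + u \<in> ball 0 a} * ?V = (\<integral>\<^sup>+ u. indicator {u. x + u \<in> ball 0 a} u * ?V \<partial>\<mu>)"
      by (subst nn_integral_multc) simp_all
    also have "\<dots> \<le> (\<integral>\<^sup>+ u. overlap ?E ?F (x + u) \<partial>\<mu>)"
    proof (rule nn_integral_mono)
      fix u
      show "indicator {u. x + u \<in> ball 0 a} u * ?V \<le> overlap ?E ?F (x + u)"
      proof (cases "x + u \<in> ball 0 a")
        case True
        have "z + (x + u) \<in> ?F" if "z \<in> ?E" for z
          using norm_triangle_ineq[of z "x + u"] that True e by simp
        then have "overlap ?E ?F (x + u) = (\<integral>\<^sup>+ z. indicator ?E z \<partial>lborel)"
          unfolding overlap_def by (intro nn_integral_cong) (auto split: split_indicator)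
        then have "overlap ?E ?F (x + u) = ?V" by (simp add: sets_ball_borel)
        then show ?thesis by (auto split: split_indicator)
      qed simp
    qed
    also have "\<dots> \<le> (\<integral>\<^sup>+ u. overlap ?E ?F (y + u) \<partial>\<mu>)"
      using le[of ?V "emeasure lborel ?F", OF emeasure_ball_less_top emeasure_ball_less_top xy]
      unfolding rb shift_avg_def .
    also have "\<dots> \<le> (\<integral>\<^sup>+ u. indicator {u. y + u \<in> ball 0 b} u * ?V \<partial>\<mu>)"
    proof (rule nn_integral_mono)
      fix u
      show "overlap ?E ?F (y + u) \<le> indicator {u. y + u \<in> ball 0 b} u * ?V"
      proof (cases "y + u \<in> ball 0 b")
        case True
        have "overlap ?E ?F (y + u) \<le> (\<integral>\<^sup>+ z. indicator ?E z \<partial>lborel)"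
          unfolding overlap_def by (intro nn_integral_mono) (auto split: split_indicator)
        then show ?thesis using True by (simp add: sets_ball_borel)
      next
        case False
        have "z + (y + u) \<notin> ?F" if "z \<in> ?E" for z
          using norm_triangle_ineq4[of "z + (y + u)" z] that False e by simp
        then have "overlap ?E ?F (y + u) = (\<integral>\<^sup>+ z. 0 \<partial>(lborel :: 'a measure))"
          unfolding overlap_def by (intro nn_integral_cong) (auto split: split_indicator)
        then show ?thesis by simp
      qed
    qed
    also have "\<dots> = emeasure \<mu> {u. y + u \<in> ball 0 b} * ?V"
      by (subst nn_integral_multc) simp_all
    finally have "?V * emeasure \<mu> {u. x + u \<in> ball 0 a} \<le> ?V * emeasure \<mu> {u. y + u \<in> ball 0 b}"
      by (simp add: mult.commute)
    moreover have "?V \<noteq> 0"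
      using e(1) unit_ball_vol_pos[of "real DIM('a)"] by (auto simp: emeasure_ball less_imp_neq[symmetric])
    ultimately show ?thesis using V ennreal_mult_le_mult_iff by blast
  qed
  show "emeasure \<mu> {u. x + u \<in> rball v} \<le> emeasure \<mu> {u. y + u \<in> rball v}"
  proof (cases "v = \<top>")
    case False
    then have "v < \<top>" by (simp add: less_top)
    then obtain b where b: "0 \<le> b" "rball v = (ball 0 b :: 'a set)" "v = emeasure lborel (ball 0 b :: 'a set)"
      by (rule rball_finite)
    have "{u. x + u \<in> ball 0 b} = (\<Union>k. {u. x + u \<in> ball 0 (b - 1 / real (Suc k))})"
    proof (intro equalityI subsetI)
      fix u assume "u \<in> {u. x + u \<in> ball 0 b}"
      then have "0 < b - norm (x + u)" by simp
      then obtain k where "inverse (real (Suc k)) < b - norm (x + u)" using reals_Archimedean by blast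
      then have "x + u \<in> ball 0 (b - 1 / real (Suc k))" by (simp add: inverse_eq_divide)
      then show "u \<in> (\<Union>k. {u. x + u \<in> ball 0 (b - 1 / real (Suc k))})" by blast
    next
      fix u assume "u \<in> (\<Union>k. {u. x + u \<in> ball 0 (b - 1 / real (Suc k))})"
      then obtain k where "norm (x + u) < b - 1 / real (Suc k)" by auto
      moreover have "0 < 1 / real (Suc k)" by simp
      ultimately have "norm (x + u) < b" by linarith
      then show "u \<in> {u. x + u \<in> ball 0 b}" by simp
    qed
    then have "emeasure \<mu> {u. x + u \<in> ball 0 b} = emeasure \<mu> (\<Union>k. {u. x + u \<in> ball 0 (b - 1 / real (Suc k))})"
      by (rule arg_cong)
    also have "\<dots> = (SUP k. emeasure \<mu> {u. x + u \<in> ball 0 (b - 1 / real (Suc k))})"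
    proof (rule SUP_emeasure_incseq[symmetric])
      show "range (\<lambda>k. {u. x + u \<in> ball 0 (b - 1 / real (Suc k))}) \<subseteq> sets \<mu>" using meas by auto
      show "incseq (\<lambda>k. {u. x + u \<in> ball 0 (b - 1 / real (Suc k))})"
      proof (intro incseq_SucI Collect_mono impI)
        fix k u assume "x + u \<in> ball 0 (b - 1 / real (Suc k))"
        moreover have "1 / real (Suc (Suc k)) \<le> 1 / real (Suc k)" by (intro divide_left_mono) auto
        ultimately show "x + u \<in> ball 0 (b - 1 / real (Suc (Suc k)))" by simp
      qed
    qed
    also have "\<dots> \<le> emeasure \<mu> {u. y + u \<in> ball 0 b}"
      by (intro SUP_least gap) simp
    finally show ?thesis by (simp add: b(2))
  qed simp
qed

text \<open>Both parts of domination are inequalities between integrals of overlaps. Equal noise on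
  both sides preserves domination, so the limit in \<open>n\<close> can be taken at a fixed noise
  level \<open>k\<close>; only afterwards is the noise removed.\<close>

theorem rearrangement_dominated_limit:
  fixes \<mu> \<mu>' :: "(real ^ 'n) measure"
  assumes dom: "\<And>n. rearrangement_dominated (M n) (M' n)" and \<mu>: "borel_prob \<mu>" and \<mu>': "borel_prob \<mu>'"
    and lim: "\<And>\<xi>. (\<lambda>n. cfun (M n) \<xi>) \<longlonglongrightarrow> cfun \<mu> \<xi>" and lim': "\<And>\<xi>. (\<lambda>n. cfun (M' n) \<xi>) \<longlonglongrightarrow> cfun \<mu>' \<xi>"
  shows "rearrangement_dominated \<mu> \<mu>'"
proof -
  have pr: "borel_prob (M n)" "borel_prob (M' n)" for n using dom by (auto simp: rearrangement_dominated_def)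
  let ?g = "\<lambda>k. small_gauss (1 / real (Suc k)) :: (real ^ 'n) measure"
  have dom_g: "rearrangement_dominated (conv (M n) (?g k)) (conv (M' n) (?g k))" for n k
    by (intro rearrangement_dominated_conv dom rearrangement_dominated_small_gauss) simp
  have fin: "(\<integral>\<^sup>+ u. overlap E F (x + u) \<partial>lborel) < \<top>"
    if "E \<in> sets borel" "F \<in> sets borel" "emeasure lborel E < \<top>" "emeasure lborel F < \<top>" for E F and x :: "real ^ 'n"
    using that by (subst nn_integral_lborel_translate) (simp_all add: overlap_measurable nn_integral_overlap_finite ennreal_mult_less_top)
  have "symm_dominated \<mu> \<mu>'"
    unfolding symm_dominated_def
  proof (intro allI impI)
    fix E F :: "(real ^ 'n) set"
    assume [measurable]: "E \<in> sets borel" "F \<in> sets borel" and EF: "emeasure lborel E < \<top>" "emeasure lborel F < \<top>"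
    let ?E = "rball (emeasure lborel E) :: (real ^ 'n) set" and ?F = "rball (emeasure lborel F) :: (real ^ 'n) set"
    show "(\<integral>\<^sup>+ u. overlap E F u \<partial>\<mu>) \<le> (\<integral>\<^sup>+ u. overlap ?E ?F u \<partial>\<mu>')"
    proof (rule smoothing_compare[OF \<mu> \<mu>'])
      fix k
      have "(\<lambda>n. \<integral>\<^sup>+ x. overlap E F x \<partial>conv (M n) (?g k)) \<longlonglongrightarrow> (\<integral>\<^sup>+ x. overlap E F x \<partial>conv \<mu> (?g k))"
        using fin[of E F 0] EF by (intro smoothing_tendsto \<mu> pr lim) auto
      moreover have "(\<lambda>n. \<integral>\<^sup>+ x. overlap ?E ?F x \<partial>conv (M' n) (?g k)) \<longlonglongrightarrow> (\<integral>\<^sup>+ x. overlap ?E ?F x \<partial>conv \<mu>' (?g k))"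
        using fin[of ?E ?F 0] EF by (intro smoothing_tendsto \<mu>' pr lim') auto
      moreover have "(\<integral>\<^sup>+ x. overlap E F x \<partial>conv (M n) (?g k)) \<le> (\<integral>\<^sup>+ x. overlap ?E ?F x \<partial>conv (M' n) (?g k))" for n
        using dom_g[of n k] EF by (auto simp: rearrangement_dominated_def symm_dominated_def)
      ultimately show "(\<integral>\<^sup>+ x. overlap E F x \<partial>conv \<mu> (?g k)) \<le> (\<integral>\<^sup>+ x. overlap ?E ?F x \<partial>conv \<mu>' (?g k))"
        by (intro LIMSEQ_le) auto
    next
      show "overlap ?E ?F x + overlap ?E (- ?F) x = emeasure lborel ?E" for x
        by (rule overlap_complement) simp_all
    qed (use EF in \<open>auto intro: lower_semicont_overlap\<close>)
  qed
  moreover have "unimodal \<mu>'"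
  proof (rule unimodalI_overlap[OF \<mu>'])
    fix w v :: ennreal and x y :: "real ^ 'n" assume wv: "w < \<top>" "v < \<top>" and xy: "norm y \<le> norm x"
    let ?q = "overlap (rball w) (rball v) :: real ^ 'n \<Rightarrow> ennreal"
    have lsc: "lower_semicont (\<lambda>u. overlap (rball w) F (z + u))" if "F \<in> sets borel" for z :: "real ^ 'n" and F
      unfolding lower_semicont_def
    proof (intro allI impI)
      fix p and u :: "nat \<Rightarrow> real ^ 'n" assume "u \<longlonglongrightarrow> p"
      then have "(\<lambda>n. z + u n) \<longlonglongrightarrow> z + p" by (intro tendsto_intros)
      then show "overlap (rball w) F (z + p) \<le> liminf (\<lambda>n. overlap (rball w) F (z + u n))"
        using that by (intro lower_semicontD[OF lower_semicont_overlap]) auto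
    qed
    have "(\<integral>\<^sup>+ u. ?q (x + u) \<partial>\<mu>') \<le> (\<integral>\<^sup>+ u. ?q (y + u) \<partial>\<mu>')"
    proof (rule smoothing_compare[OF \<mu>' \<mu>'])
      fix k
      have lims: "(\<lambda>n. \<integral>\<^sup>+ u. ?q (z + u) \<partial>conv (M' n) (?g k)) \<longlonglongrightarrow> (\<integral>\<^sup>+ u. ?q (z + u) \<partial>conv \<mu>' (?g k))" for z
        using fin[of "rball w" "rball v" z] wv by (intro smoothing_tendsto \<mu>' pr lim') auto
      have le: "(\<integral>\<^sup>+ u. ?q (x + u) \<partial>conv (M' n) (?g k)) \<le> (\<integral>\<^sup>+ u. ?q (y + u) \<partial>conv (M' n) (?g k))" for n
      proof -
        have "radially_decreasing (shift_avg (conv (M' n) (?g k)) ?q)"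
          using dom_g[of n k] by (intro radially_decreasing_shift_avg radially_decreasing_overlap borel_prob_finite)
            (auto simp: rearrangement_dominated_def)
        then show ?thesis using xy by (auto simp: radially_decreasing_def shift_avg_def)
      qed
      show "(\<integral>\<^sup>+ u. ?q (x + u) \<partial>conv \<mu>' (?g k)) \<le> (\<integral>\<^sup>+ u. ?q (y + u) \<partial>conv \<mu>' (?g k))"
        by (rule LIMSEQ_le[OF lims lims]) (use le in blast)
    next
      show "?q (y + u) + overlap (rball w) (- rball v) (y + u) = emeasure lborel (rball w :: (real ^ 'n) set)" for u
        by (rule overlap_complement) simp_all
    qed (use wv in \<open>auto intro: lsc\<close>)
    then show "shift_avg \<mu>' ?q x \<le> shift_avg \<mu>' ?q y" by (simp add: shift_avg_def)
  qed
  ultimately show ?thesis using \<mu> \<mu>' by (simp add: rearrangement_dominated_def)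
qed

section \<open>The symmetric decreasing rearrangement\<close>

text \<open>An explicit form of the function singled out by \<open>decreasing_rearrangement\<close>.
  The supremum over open balls makes its superlevel sets equal to balls exactly, not just up to null
  sets.\<close>

definition rearr :: "('a::euclidean_space \<Rightarrow> ennreal) \<Rightarrow> 'a \<Rightarrow> ennreal" where
  "rearr f x = (SUP t\<in>{t. 0 \<le> t \<and> x \<in> rball (emeasure lborel {y. ennreal t < f y})}. ennreal t)"

lemma superlevel_antimono:
  fixes f :: "'a \<Rightarrow> ennreal"
  shows "s \<le> t \<Longrightarrow> {y. ennreal t < f y} \<subseteq> {y. ennreal s < f y}"
  by (auto intro: le_less_trans ennreal_leI)

lemma superlevel_UN:
  fixes f :: "'a \<Rightarrow> ennreal"
  assumes "0 \<le> s"
  shows "{y. ennreal s < f y} = (\<Union>n. {y. ennreal (s + 1 / real (Suc n)) < f y})"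
proof (intro equalityI subsetI)
  fix x assume "x \<in> {y. ennreal s < f y}"
  then obtain r where r: "ennreal s < r" "r < f x" using dense by auto
  then obtain r' where r': "r = ennreal r'" "0 \<le> r'" by (cases r) auto
  then have "0 < r' - s" using r assms by (simp add: ennreal_less_iff)
  then obtain n :: nat where "inverse (real (Suc n)) < r' - s" using reals_Archimedean by blast
  then have "1 / real (Suc n) < r' - s" by (simp only: inverse_eq_divide)
  then have "ennreal (s + 1 / real (Suc n)) \<le> r" unfolding r' by (intro ennreal_leI) simp
  then show "x \<in> (\<Union>n. {y. ennreal (s + 1 / real (Suc n)) < f y})" using r by (auto intro: le_less_trans)
next
  fix x assume "x \<in> (\<Union>n. {y. ennreal (s + 1 / real (Suc n)) < f y})"
  then obtain n :: nat where "x \<in> {y. ennreal (s + 1 / real (Suc n)) < f y}" by blast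
  then show "x \<in> {y. ennreal s < f y}" using superlevel_antimono[of s "s + 1 / real (Suc n)" f] by auto
qed

text \<open>The volume at level \<open>s\<close> is the supremum of the volumes at higher levels.
  The strict inequality in \<open>rball\<close> therefore already holds at some strictly higher
  level, which yields a strict inequality for the supremum.\<close>

lemma superlevel_rearr:
  fixes f :: "'a::euclidean_space \<Rightarrow> ennreal"
  assumes [measurable]: "f \<in> borel_measurable borel" and s: "0 \<le> s"
  shows "{x. ennreal s < rearr f x} = rball (emeasure lborel {y. ennreal s < f y})"
proof (intro equalityI subsetI)
  fix x assume "x \<in> {x. ennreal s < rearr f x}"
  then obtain t where t: "0 \<le> t" "x \<in> rball (emeasure lborel {y. ennreal t < f y})" "ennreal s < ennreal t"
    by (auto simp: rearr_def less_SUP_iff)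
  then have "emeasure lborel {y. ennreal t < f y} \<le> emeasure lborel {y. ennreal s < f y}"
    using s by (intro emeasure_mono superlevel_antimono) (auto simp: ennreal_less_iff)
  then show "x \<in> rball (emeasure lborel {y. ennreal s < f y})" using rball_mono t(2) by blast
next
  fix x :: 'a assume x: "x \<in> rball (emeasure lborel {y. ennreal s < f y})"
  have "emeasure lborel {y. ennreal s < f y} = (SUP n. emeasure lborel {y. ennreal (s + 1 / real (Suc n)) < f y})"
    unfolding superlevel_UN[OF s, of f]
    by (rule SUP_emeasure_incseq[symmetric]) (auto intro!: incseq_SucI superlevel_antimono divide_left_mono)
  with x obtain n where "x \<in> rball (emeasure lborel {y. ennreal (s + 1 / real (Suc n)) < f y})"
    by (auto simp: rball_def less_SUP_iff)
  then have "ennreal (s + 1 / real (Suc n)) \<le> rearr f x"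
    unfolding rearr_def using s by (intro SUP_upper) auto
  moreover have "ennreal s < ennreal (s + 1 / real (Suc n))" using s by (simp add: ennreal_less_iff del: ennreal_plus)
  ultimately show "x \<in> {x. ennreal s < rearr f x}" by auto
qed

lemma ennreal_eq_by_superlevels:
  fixes a b :: ennreal
  assumes "\<And>s. 0 \<le> s \<Longrightarrow> ennreal s < a \<longleftrightarrow> ennreal s < b"
  shows "a = b"
proof -
  have le: "a \<le> b" if *: "\<And>s. 0 \<le> s \<Longrightarrow> ennreal s < a \<Longrightarrow> ennreal s < b" for a b :: ennreal
  proof (rule dense_le)
    fix y assume y: "y < a"
    then obtain s where "y = ennreal s" "0 \<le> s" by (cases y) auto
    with y show "y \<le> b" using *[of s] by (auto intro: less_imp_le)
  qed
  show ?thesis using assms by (intro antisym le) auto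
qed

lemma radially_decreasing_rearr: "radially_decreasing (rearr f)"
  unfolding radially_decreasing_def rearr_def
  by (intro allI impI SUP_subset_mono) (auto intro: rball_radial)

lemma rearr_measurable [measurable]: "rearr f \<in> borel_measurable borel"
  by (rule radially_decreasing_measurable[OF radially_decreasing_rearr])

lemma decreasing_rearrangement_eq_rearr:
  fixes f :: "real ^ 'n \<Rightarrow> ennreal"
  assumes f[measurable]: "f \<in> borel_measurable borel"
  shows "decreasing_rearrangement f = rearr f"
  unfolding decreasing_rearrangement_def
proof (rule the_equality, intro conjI allI impI)
  show "rearr f x = rearr f y" if "norm x = norm y" for x y
    using that radially_decreasingD[OF radially_decreasing_rearr, of x y f] radially_decreasingD[OF radially_decreasing_rearr, of y x f] by auto
  show "rearr f x \<le> rearr f y" if "norm y \<le> norm x" for x y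
    by (rule radially_decreasingD[OF radially_decreasing_rearr that])
  show "emeasure lborel {x. ennreal t < f x} = emeasure lborel {x. ennreal t < rearr f x}" if "0 \<le> t" for t
    by (simp add: superlevel_rearr that)
  show "(rearr f \<longlongrightarrow> rearr f y) (filtercomap norm (at_right (norm y)))" for y
  proof (rule order_tendstoI)
    fix a assume "a < rearr f y"
    then obtain t where t: "a = ennreal t" "0 \<le> t" by (cases a) auto
    let ?v = "emeasure lborel {y. ennreal t < f y}"
    have y: "y \<in> rball ?v" using \<open>a < rearr f y\<close> superlevel_rearr[OF f t(2)] t by blast
    have "\<forall>\<^sub>F r in at_right (norm y). emeasure lborel (ball 0 r :: (real ^ 'n) set) < ?v"
    proof (cases "?v = \<top>")
      case True then show ?thesis by simp
    next
      case False
      then have "?v < \<top>" by (simp add: less_top)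
      then obtain b where b: "0 \<le> b" "rball ?v = (ball 0 b :: (real ^ 'n) set)" "?v = emeasure lborel (ball 0 b :: (real ^ 'n) set)"
        by (rule rball_finite)
      have "norm y < b" using y b(2) by simp
      then have "\<forall>\<^sub>F r in at_right (norm y). r \<in> {norm y<..<b}" by (rule eventually_at_right_real)
      then show ?thesis
      proof eventually_elim
        case (elim r)
        then have "0 \<le> r" using norm_ge_zero[of y] by (meson greaterThanLessThan_iff less_imp_le order_trans)
        then show ?case using elim b(1) by (subst b(3), subst emeasure_lborel_ball_mono_iff) auto
      qed
    qed
    then show "\<forall>\<^sub>F x in filtercomap norm (at_right (norm y)). a < rearr f x"
      unfolding eventually_filtercomap
    proof (intro exI conjI allI impI)
      fix x :: "real ^ 'n" assume "emeasure lborel (ball 0 (norm x) :: (real ^ 'n) set) < ?v"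
      then have "x \<in> rball ?v" by (simp add: rball_def)
      then show "a < rearr f x" using superlevel_rearr[OF f t(2)] t by blast
    qed
  next
    fix a assume a: "rearr f y < a"
    have "\<forall>\<^sub>F r in at_right (norm y). norm y < r" by (rule eventually_at_right_less)
    then show "\<forall>\<^sub>F x in filtercomap norm (at_right (norm y)). rearr f x < a"
      unfolding eventually_filtercomap
    proof (intro exI conjI allI impI)
      fix x :: "real ^ 'n" assume "norm y < norm x"
      then have "rearr f x \<le> rearr f y" by (intro radially_decreasingD[OF radially_decreasing_rearr]) simp
      with a show "rearr f x < a" by simp
    qed
  qed
next
  fix g :: "real ^ 'n \<Rightarrow> ennreal"
  assume g: "(\<forall>x y. norm x = norm y \<longrightarrow> g x = g y) \<and> (\<forall>x y. norm y \<le> norm x \<longrightarrow> g x \<le> g y) \<and>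
    (\<forall>y. (g \<longlongrightarrow> g y) (filtercomap norm (at_right (norm y)))) \<and>
    (\<forall>t::real. 0 \<le> t \<longrightarrow> emeasure lborel {x. ennreal t < f x} = emeasure lborel {x. ennreal t < g x})"
  note g = g[THEN conjunct2, THEN conjunct1] g[THEN conjunct2, THEN conjunct2, THEN conjunct1, rule_format]
    g[THEN conjunct2, THEN conjunct2, THEN conjunct2, rule_format]
  have rd: "radially_decreasing g" unfolding radially_decreasing_def by (rule g(1))
  have [measurable]: "g \<in> borel_measurable borel" by (rule radially_decreasing_measurable[OF rd])
  have lev: "{x. ennreal t < g x} = rball (emeasure lborel {x. ennreal t < f x})" if t: "0 \<le> t" for t
  proof -
    let ?S = "{x. ennreal t < g x}"
    have S: "emeasure lborel {x. ennreal t < f x} = emeasure lborel ?S" by (rule g(3)[OF t])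
    have "rball (emeasure lborel ?S) \<subseteq> ?S"
    proof (rule radial_set_rball(1))
      show "y \<in> ?S" if "x \<in> ?S" "norm y \<le> norm x" for x y by (rule radially_decreasing_superlevel[OF rd that])
    qed measurable
    \<comment> \<open>The limit from above in the radius keeps values above the level slightly
      farther out than \<open>x\<close>. So the superlevel set cannot be a closed ball, and
      \<open>g\<close> is determined at every point.\<close>
    moreover have "?S \<subseteq> rball (emeasure lborel ?S)"
    proof
      fix x assume x: "x \<in> ?S"
      have "(g \<longlongrightarrow> g x) (filtercomap norm (at_right (norm x)))" by (rule g(2))
      then have "\<forall>\<^sub>F z in filtercomap norm (at_right (norm x)). ennreal t < g z"
        using x by (intro order_tendstoD(1)) auto
      then obtain P where P: "eventually P (at_right (norm x))" "\<And>z. P (norm z) \<Longrightarrow> ennreal t < g z"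
        unfolding eventually_filtercomap by blast
      have "\<forall>\<^sub>F r in at_right (norm x). P r \<and> norm x < r"
        using P(1) eventually_at_right_less by (rule eventually_conj)
      then have "\<exists>r. P r \<and> norm x < r" by (rule eventually_happens'[rotated]) simp
      then obtain r where r: "P r" "norm x < r" by blast
      have r0: "0 \<le> r" using r(2) norm_ge_zero[of x] by linarith
      obtain b :: "real ^ 'n" where "b \<in> Basis" using nonempty_Basis by blast
      then have z: "norm (r *\<^sub>R b) = r" using r0 by simp
      have "ball 0 r \<subseteq> ?S"
      proof
        fix w :: "real ^ 'n" assume "w \<in> ball 0 r"
        moreover have "r *\<^sub>R b \<in> ?S" using P(2)[of "r *\<^sub>R b"] r(1) z by simp
        ultimately show "w \<in> ?S" using radially_decreasing_superlevel[OF rd, of "r *\<^sub>R b" "ennreal t" w] z by auto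
      qed
      then have "emeasure lborel (ball (0 :: real ^ 'n) r) \<le> emeasure lborel ?S" by (rule emeasure_mono) measurable
      moreover have "emeasure lborel (ball 0 (norm x) :: (real ^ 'n) set) < emeasure lborel (ball 0 r :: (real ^ 'n) set)"
        using r r0 by (subst emeasure_lborel_ball_mono_iff) auto
      ultimately show "x \<in> rball (emeasure lborel ?S)" by (simp add: rball_def)
    qed
    ultimately show ?thesis unfolding S by blast
  qed
  show "g = rearr f"
  proof
    fix x show "g x = rearr f x"
    proof (rule ennreal_eq_by_superlevels)
      fix s :: real assume "0 \<le> s"
      then show "ennreal s < g x \<longleftrightarrow> ennreal s < rearr f x" using lev superlevel_rearr[OF f] by blast
    qed
  qed
qed

lemma ball_rearrangement_eq:
  fixes D :: "(real ^ 'n) set"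
  assumes "emeasure lborel D < \<top>"
  shows "ball_rearrangement D = rball (emeasure lborel D)"
  unfolding ball_rearrangement_def
proof (rule the_equality)
  show "(\<exists>r\<ge>0. (rball (emeasure lborel D) :: (real ^ 'n) set) = ball 0 r) \<and> emeasure lborel (rball (emeasure lborel D) :: (real ^ 'n) set) = emeasure lborel D"
    using rball_finite[OF assms, where 'a="real ^ 'n"] by (metis emeasure_rball)
  fix B :: "(real ^ 'n) set" assume "(\<exists>r\<ge>0. B = ball 0 r) \<and> emeasure lborel B = emeasure lborel D"
  then show "B = rball (emeasure lborel D)" using rball_emeasure_ball by metis
qed

text \<open>Only volumes of superlevel sets enter, so convergence almost everywhere of the functions
  gives convergence everywhere of the rearrangements. This carries the truncation of the jumps over
  to the rearranged densities.\<close>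

lemma rearr_mono_limit:
  fixes f :: "'a::euclidean_space \<Rightarrow> ennreal" and F :: "nat \<Rightarrow> 'a \<Rightarrow> ennreal"
  assumes [measurable]: "f \<in> borel_measurable borel" "\<And>n. F n \<in> borel_measurable borel"
    and inc: "\<And>n x. F n x \<le> F (Suc n) x" and lim: "AE x in lborel. (SUP n. F n x) = f x"
  shows "(\<lambda>n. rearr (F n) x) \<longlonglongrightarrow> rearr f x" and "rearr (F n) x \<le> rearr f x"
proof -
  have lev: "emeasure lborel {y. ennreal s < f y} = (SUP n. emeasure lborel {y. ennreal s < F n y})" for s
  proof -
    have "emeasure lborel {y. ennreal s < f y} = emeasure lborel {y. ennreal s < (SUP n. F n y)}"
      by (rule emeasure_eq_AE) (use lim in \<open>auto\<close>)
    also have "{y. ennreal s < (SUP n. F n y)} = (\<Union>n. {y. ennreal s < F n y})"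
      by (auto simp: less_SUP_iff)
    also have "emeasure lborel \<dots> = (SUP n. emeasure lborel {y. ennreal s < F n y})"
      by (rule SUP_emeasure_incseq[symmetric]) (auto intro!: incseq_SucI intro: less_le_trans[OF _ inc])
    finally show ?thesis .
  qed
  have eq: "(SUP n. rearr (F n) x) = rearr f x"
  proof (rule ennreal_eq_by_superlevels)
    fix s :: real assume s: "0 \<le> s"
    have "ennreal s < (SUP n. rearr (F n) x) \<longleftrightarrow> (\<exists>n. x \<in> {x. ennreal s < rearr (F n) x})"
      by (simp add: less_SUP_iff)
    also have "\<dots> \<longleftrightarrow> x \<in> rball (SUP n. emeasure lborel {y. ennreal s < F n y})"
      unfolding superlevel_rearr[OF assms(2) s] by (simp add: rball_def less_SUP_iff)
    also have "\<dots> \<longleftrightarrow> x \<in> {x. ennreal s < rearr f x}"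
      unfolding superlevel_rearr[OF assms(1) s] lev ..
    finally show "ennreal s < (SUP n. rearr (F n) x) \<longleftrightarrow> ennreal s < rearr f x" by simp
  qed
  have mono: "incseq (\<lambda>n. rearr (F n) x)"
  proof (rule incseq_SucI)
    fix n
    have "emeasure lborel {y. ennreal t < F n y} \<le> emeasure lborel {y. ennreal t < F (Suc n) y}" for t
      by (intro emeasure_mono) (auto intro: less_le_trans[OF _ inc])
    from rball_mono[OF this] show "rearr (F n) x \<le> rearr (F (Suc n)) x"
      unfolding rearr_def by (intro SUP_subset_mono) auto
  qed
  show "(\<lambda>n. rearr (F n) x) \<longlonglongrightarrow> rearr f x" using LIMSEQ_SUP[OF mono] unfolding eq .
  show "rearr (F n) x \<le> rearr f x" unfolding eq[symmetric] by (rule SUP_upper) simp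
qed

section \<open>Approximation of Levy laws\<close>

lemma borel_prob_return: "borel_prob (return borel (c :: 'a::euclidean_space))"
  by (intro borel_prob.intro borel_prob_axioms.intro prob_space_return) auto

text \<open>A factor \<open>V\<close> of \<open>A\<close> exhibits the Gaussian law as a linear
  image of the standard one. If \<open>det A = 0\<close>, the symmetrized matrix is 0 and the second
  law is the point mass at 0, which dominates everything.\<close>

lemma gaussian_part_dominated:
  fixes A :: "real ^ 'n ^ 'n"
  assumes sym: "transpose A = A" and psd: "\<And>x. 0 \<le> (A *v x) \<bullet> x" and t: "0 \<le> t"
  shows "\<exists>\<gamma> \<gamma>'. rearrangement_dominated \<gamma> \<gamma>' \<and>
    (\<forall>\<xi>. cfun \<gamma> \<xi> = exp (- of_real (t / 2 * ((A *v \<xi>) \<bullet> \<xi>)))) \<and>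
    (\<forall>\<xi>. cfun \<gamma>' \<xi> = exp (- of_real (t / 2 * ((symmetrized_matrix A *v \<xi>) \<bullet> \<xi>))))"
proof -
  obtain V :: "real ^ 'n ^ 'n" where V: "A = V ** transpose V"
    using psd_factorization[OF sym psd] by blast
  define f where "f x = sqrt t *\<^sub>R (V *v x)" for x
  have lin: "linear f" unfolding f_def by (rule linearI) (simp_all add: matrix_vector_right_distrib scaleR_add_right matrix_vector_mult_scaleR)
  note [measurable] = borel_measurable_linear[OF lin]
  have \<gamma>: "borel_prob (distr gauss borel f)" by (rule borel_prob_distr_gauss) measurable
  have cf: "cfun (distr gauss borel f) \<xi> = exp (- of_real (t / 2 * ((A *v \<xi>) \<bullet> \<xi>)))" for \<xi>
  proof -
    have adj: "\<xi> \<bullet> (V *v x) = (transpose V *v \<xi>) \<bullet> x" for x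
      by (simp add: dot_lmul_matrix[symmetric] transpose_matrix_vector)
    have "cfun (distr gauss borel f) \<xi> = cfun gauss (sqrt t *\<^sub>R (transpose V *v \<xi>))"
      by (rule cfun_distr_linear[OF borel_prob_gauss]) (simp_all add: f_def adj)
    also have "(norm (sqrt t *\<^sub>R (transpose V *v \<xi>)))\<^sup>2 = t * ((A *v \<xi>) \<bullet> \<xi>)"
    proof -
      have "(norm (sqrt t *\<^sub>R (transpose V *v \<xi>)))\<^sup>2 = t * ((transpose V *v \<xi>) \<bullet> (transpose V *v \<xi>))"
        using t by (simp add: power_mult_distrib power2_norm_eq_inner)
      also have "(transpose V *v \<xi>) \<bullet> (transpose V *v \<xi>) = \<xi> \<bullet> (V *v (transpose V *v \<xi>))"
        by (rule adj[symmetric])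
      also have "V *v (transpose V *v \<xi>) = A *v \<xi>" by (simp only: matrix_vector_mul_assoc V)
      also have "\<xi> \<bullet> (A *v \<xi>) = (A *v \<xi>) \<bullet> \<xi>" by (rule inner_commute)
      finally show ?thesis .
    qed
    then have "cfun gauss (sqrt t *\<^sub>R (transpose V *v \<xi>)) = exp (- of_real (t / 2 * ((A *v \<xi>) \<bullet> \<xi>)))"
      unfolding cfun_gauss by (simp del: of_real_power)
    finally show ?thesis .
  qed
  have sm: "(symmetrized_matrix A *v \<xi>) \<bullet> \<xi> = root CARD('n) (det A) * (norm \<xi>)\<^sup>2" for \<xi>
    by (simp add: symmetrized_matrix_def scaleR_matrix_vector_assoc[symmetric] power2_norm_eq_inner)
  show ?thesis
  proof (cases "t = 0 \<or> det A = 0")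
    case True
    then have "cfun (return borel 0) \<xi> = exp (- of_real (t / 2 * ((symmetrized_matrix A *v \<xi>) \<bullet> \<xi>)))" for \<xi> :: "real ^ 'n"
      by (auto simp: cfun_return sm)
    then show ?thesis using rearrangement_dominated_return[OF \<gamma>] cf by blast
  next
    case False
    then have t: "0 < t" and "det A \<noteq> 0" using t by auto
    then have dV: "det V \<noteq> 0" and dA: "det A = (det V)\<^sup>2" by (auto simp: V det_mul power2_eq_square)
    obtain W :: "real ^ 'n ^ 'n" where W: "W ** V = mat 1"
      using dV by (metis invertible_det_nz invertible_def)
    define h where "h x = (1 / sqrt t) *\<^sub>R (W *v x)" for x
    have lin_h: "linear h" unfolding h_def by (rule linearI) (simp_all add: matrix_vector_right_distrib scaleR_add_right matrix_vector_mult_scaleR)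
    have inv: "h (f x) = x" for x
      using t by (simp add: h_def f_def matrix_vector_mult_scaleR matrix_vector_mul_assoc W)
    have "matrix f = matrix ((*\<^sub>R) (sqrt t) \<circ> (*v) V)" by (simp add: f_def[abs_def] o_def)
    also have "\<dots> = matrix ((*\<^sub>R) (sqrt t) :: real ^ 'n \<Rightarrow> real ^ 'n) ** V"
      by (subst matrix_compose) (auto simp: linear_iff scaleR_add_right matrix_vector_right_distrib matrix_vector_mult_scaleR)
    finally have df: "det (matrix f) = sqrt t ^ CARD('n) * det V" by (simp add: det_mul det_matrix_scaleR)
    \<comment> \<open>The dilation with the same volume factor as \<open>f\<close>. As
      \<open>det A\<close> is the square of \<open>det V\<close>, the number
      \<open>c\<^sup>2\<close> is \<open>t\<close> times the diagonal entry of the symmetrized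
      matrix.\<close>
    define c where "c = sqrt t * root CARD('n) \<bar>det V\<bar>"
    have c: "0 < c" "c ^ CARD('n) = \<bar>det (matrix f)\<bar>"
      using t dV by (simp_all add: c_def power_mult_distrib df abs_mult power_abs)
    have dom: "rearrangement_dominated (distr gauss borel f) (small_gauss c)"
      using c t dV by (intro rearrangement_dominated_gauss[OF lin lin_h inv]) (auto simp: df)
    have c2: "c\<^sup>2 = t * root CARD('n) (det A)"
      using t by (simp add: c_def power_mult_distrib dA real_root_power[symmetric])
    have "cfun (small_gauss c) \<xi> = exp (- of_real (t / 2 * ((symmetrized_matrix A *v \<xi>) \<bullet> \<xi>)))" for \<xi> :: "real ^ 'n"
    proof -
      have "cfun (small_gauss c) \<xi> = cfun gauss (c *\<^sub>R \<xi>)"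
        by (rule cfun_distr_linear[OF borel_prob_gauss]) simp_all
      then show ?thesis unfolding cfun_gauss sm using c2 by (simp add: power_mult_distrib mult.assoc del: of_real_power)
    qed
    then show ?thesis using dom cf by blast
  qed
qed

text \<open>For finite intensity \<open>\<phi>\<close>, the logarithm of the characteristic function
  of the compound Poisson process at time 1, without compensation of small jumps.\<close>

definition jump_symbol :: "('a::euclidean_space \<Rightarrow> ennreal) \<Rightarrow> 'a \<Rightarrow> complex" where
  "jump_symbol \<phi> \<xi> = (LINT y|density lborel \<phi>. exp (\<i> * of_real (\<xi> \<bullet> y)) - 1)"

lemma cfun_density_normalized:
  fixes \<phi> :: "'a::euclidean_space \<Rightarrow> ennreal"
  assumes [measurable]: "\<phi> \<in> borel_measurable borel" and int: "(\<integral>\<^sup>+ x. \<phi> x \<partial>lborel) = ennreal l" and l: "0 < l"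
  shows "borel_prob (density lborel (\<lambda>x. \<phi> x * ennreal (1 / l)))"
    and "of_real l * (cfun (density lborel (\<lambda>x. \<phi> x * ennreal (1 / l))) \<xi> - 1) = jump_symbol \<phi> \<xi>"
proof -
  let ?P = "density lborel (\<lambda>x. \<phi> x * ennreal (1 / l))"
  have one: "(\<integral>\<^sup>+ x. \<phi> x * ennreal (1 / l) \<partial>lborel) = 1"
    using l by (simp add: nn_integral_multc int ennreal_mult[symmetric])
  then show P: "borel_prob ?P"
    by (intro borel_prob.intro borel_prob_axioms.intro prob_spaceI) (simp_all add: emeasure_density)
  have em: "emeasure (density lborel \<phi>) UNIV = ennreal l" by (simp add: emeasure_density int)
  interpret fin: finite_measure "density lborel \<phi>"
    by (rule finite_measureI) (simp add: em)
  have eq: "?P = density (density lborel \<phi>) (\<lambda>_. ennreal (1 / l))"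
    by (subst density_density_eq) simp_all
  have int': "integrable (density lborel \<phi>) (\<lambda>y. exp (\<i> * complex_of_real (\<xi> \<bullet> y)))"
    by (rule fin.integrable_const_bound[where B=1]) auto
  have "of_real l * cfun ?P \<xi> = (LINT y|density lborel \<phi>. exp (\<i> * of_real (\<xi> \<bullet> y)))"
    unfolding cfun_def eq using l by (subst integral_density) (simp_all add: scaleR_conv_of_real)
  then show "of_real l * (cfun ?P \<xi> - 1) = jump_symbol \<phi> \<xi>"
    unfolding jump_symbol_def using int' l
    by (simp add: right_diff_distrib measure_def em scaleR_conv_of_real)
qed

lemma conv_power_dominated:
  assumes "rearrangement_dominated \<rho> \<rho>'"
  shows "\<exists>\<kappa> \<kappa>'. rearrangement_dominated \<kappa> \<kappa>' \<and> (\<forall>\<xi>. cfun \<kappa> \<xi> = cfun \<rho> \<xi> ^ k) \<and> (\<forall>\<xi>. cfun \<kappa>' \<xi> = cfun \<rho>' \<xi> ^ k)"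
proof (induction k)
  case 0
  show ?case
    using rearrangement_dominated_return[OF borel_prob_return[of 0]] by (intro exI[of _ "return borel 0"]) (simp add: cfun_return)
next
  case (Suc k)
  then obtain \<kappa> \<kappa>' where *: "rearrangement_dominated \<kappa> \<kappa>'" "\<And>\<xi>. cfun \<kappa> \<xi> = cfun \<rho> \<xi> ^ k" "\<And>\<xi>. cfun \<kappa>' \<xi> = cfun \<rho>' \<xi> ^ k"
    by blast
  then have pr: "borel_prob \<kappa>" "borel_prob \<kappa>'" "borel_prob \<rho>" "borel_prob \<rho>'"
    using assms by (auto simp: rearrangement_dominated_def)
  have "rearrangement_dominated (conv \<rho> \<kappa>) (conv \<rho>' \<kappa>')" by (rule rearrangement_dominated_conv[OF assms *(1)])
  moreover have "cfun (conv \<rho> \<kappa>) \<xi> = cfun \<rho> \<xi> ^ Suc k" "cfun (conv \<rho>' \<kappa>') \<xi> = cfun \<rho>' \<xi> ^ Suc k" for \<xi>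
    using * pr by (simp_all add: cfun_conv)
  ultimately show ?case by blast
qed

text \<open>The law is the \<open>k\<close>-fold convolution of a single step that jumps with
  probability \<open>t * l / k\<close>, at most 1 by assumption, according to the normalized
  intensity. The norm bounds say that the base is a characteristic function; they are exported for
  the comparison with the exponential.\<close>

lemma jump_part_dominated:
  fixes \<phi> \<psi> :: "real ^ 'n \<Rightarrow> ennreal"
  assumes [measurable]: "\<phi> \<in> borel_measurable borel" "\<psi> \<in> borel_measurable borel"
    and lev: "\<And>s. 0 \<le> s \<Longrightarrow> {x. ennreal s < \<psi> x} = rball (emeasure lborel {x. ennreal s < \<phi> x})"
    and int: "(\<integral>\<^sup>+ x. \<phi> x \<partial>lborel) = ennreal l" and l: "0 \<le> l" and t: "0 \<le> t" "t * l \<le> real k" and k: "0 < k"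
  shows "\<exists>\<rho> \<rho>'. rearrangement_dominated \<rho> \<rho>' \<and>
    (\<forall>\<xi>. norm (1 + of_real (t / k) * jump_symbol \<phi> \<xi>) \<le> 1) \<and> (\<forall>\<xi>. norm (1 + of_real (t / k) * jump_symbol \<psi> \<xi>) \<le> 1) \<and>
    (\<forall>\<xi>. cfun \<rho> \<xi> = (1 + of_real (t / k) * jump_symbol \<phi> \<xi>) ^ k) \<and>
    (\<forall>\<xi>. cfun \<rho>' \<xi> = (1 + of_real (t / k) * jump_symbol \<psi> \<xi>) ^ k)"
proof -
  have int': "(\<integral>\<^sup>+ x. \<psi> x \<partial>lborel) = ennreal l"
    using nn_integral_rearrangement[OF assms(1,2) lev] int by simp
  have "\<exists>\<rho> \<rho>'. rearrangement_dominated \<rho> \<rho>' \<and>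
     (\<forall>\<xi>. cfun \<rho> \<xi> = 1 + of_real (t / k) * jump_symbol \<phi> \<xi>) \<and> (\<forall>\<xi>. cfun \<rho>' \<xi> = 1 + of_real (t / k) * jump_symbol \<psi> \<xi>)"
  proof (cases "l = 0")
    case True
    have zero: "jump_symbol f \<xi> = 0" if [measurable]: "f \<in> borel_measurable borel" and "(\<integral>\<^sup>+ x. f x \<partial>lborel) = ennreal l" for f :: "real ^ 'n \<Rightarrow> ennreal" and \<xi>
    proof -
      have "AE x in lborel. f x = 0" using that True by (simp add: nn_integral_0_iff_AE)
      then have "AE x in density lborel f. False" by (subst AE_density) auto
      then have "AE x in density lborel f. exp (\<i> * complex_of_real (\<xi> \<bullet> x)) - 1 = 0" by (rule AE_mp) simp
      then show ?thesis unfolding jump_symbol_def by (rule integral_eq_zero_AE)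
    qed
    from rearrangement_dominated_return[OF borel_prob_return[of 0]] show ?thesis
      by (intro exI[of _ "return borel 0"]) (simp add: cfun_return zero int int')
  next
    case False
    then have l: "0 < l" using l by simp
    let ?P = "density lborel (\<lambda>x. \<phi> x * ennreal (1 / l))" and ?P' = "density lborel (\<lambda>x. \<psi> x * ennreal (1 / l))"
    have sc: "{x. ennreal s < f x * ennreal (1 / l)} = {x. ennreal (s * l) < f x}" if s: "0 \<le> s" for f :: "real ^ 'n \<Rightarrow> ennreal" and s
    proof -
      have "ennreal s < a * ennreal (1 / l) \<longleftrightarrow> ennreal (s * l) < a" for a
        using l s by (cases a) (auto simp: ennreal_mult[symmetric] ennreal_less_iff field_simps ennreal_top_mult)
      then show ?thesis by simp
    qed
    have dom: "rearrangement_dominated ?P ?P'"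
    proof (rule rearrangement_dominated_density)
      show "{x. ennreal s < \<psi> x * ennreal (1 / l)} = rball (emeasure lborel {x. ennreal s < \<phi> x * ennreal (1 / l)})" if "0 \<le> s" for s
        unfolding sc[OF that] using l that by (intro lev) simp
      show "(\<integral>\<^sup>+ x. \<phi> x * ennreal (1 / l) \<partial>lborel) = 1"
        using l by (simp add: nn_integral_multc int ennreal_mult[symmetric])
    qed measurable
    define p where "p = t * l / k"
    have p: "0 \<le> p" "p \<le> 1" using t k l by (auto simp: p_def)
    have cf: "cfun (jump_mixture p (density lborel (\<lambda>x. f x * ennreal (1 / l)))) \<xi> = 1 + of_real (t / k) * jump_symbol f \<xi>"
      if f: "f \<in> borel_measurable borel" "(\<integral>\<^sup>+ x. f x \<partial>lborel) = ennreal l" for f :: "real ^ 'n \<Rightarrow> ennreal" and \<xi>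
      unfolding cfun_jump_mixture[OF cfun_density_normalized(1)[OF f l] p] cfun_density_normalized(2)[OF f l, symmetric]
      by (simp add: p_def)
    show ?thesis
      using rearrangement_dominated_jump_mixture[OF dom p] cf[OF assms(1) int] cf[OF assms(2) int'] by blast
  qed
  then obtain \<rho> \<rho>' where dom: "rearrangement_dominated \<rho> \<rho>'"
    and cf: "\<And>\<xi>. cfun \<rho> \<xi> = 1 + of_real (t / k) * jump_symbol \<phi> \<xi>" "\<And>\<xi>. cfun \<rho>' \<xi> = 1 + of_real (t / k) * jump_symbol \<psi> \<xi>" by blast
  have le: "norm (cfun \<rho> \<xi>) \<le> 1" "norm (cfun \<rho>' \<xi>) \<le> 1" for \<xi>
    using dom borel_prob.norm_cfun_le by (auto simp: rearrangement_dominated_def)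
  show ?thesis using conv_power_dominated[OF dom, of k] le unfolding cf by blast
qed

text \<open>Expanding the square of \<open>norm (1 + w)\<close> shows \<open>Re w \<le> 0\<close>,
  so \<open>1 + w\<close> and \<open>exp w\<close> both lie in the unit disc. Their powers then
  differ by at most \<open>k\<close> times their difference, which is quadratic in
  \<open>w\<close>.\<close>

lemma norm_power_minus_exp_le:
  fixes w :: complex
  assumes 1: "norm (1 + w) \<le> 1" and w: "norm w \<le> 1"
  shows "norm ((1 + w) ^ k - exp (of_nat k * w)) \<le> k * (exp 1 * (norm w)\<^sup>2)"
proof -
  have "(norm (1 + w))\<^sup>2 = 1 + 2 * Re w + (norm w)\<^sup>2"
    unfolding cmod_power2 by (simp add: power2_eq_square algebra_simps)
  moreover have "(norm (1 + w))\<^sup>2 \<le> 1" using 1 by (simp add: abs_square_le_1)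
  ultimately have "2 * Re w \<le> - (norm w)\<^sup>2" by linarith
  then have "Re w \<le> 0" using zero_le_power2[of "norm w"] by linarith
  then have e1: "norm (exp w) \<le> 1" by simp
  have "norm ((1 + w) ^ k - exp w ^ k) \<le> k * norm (1 + w - exp w)"
    by (rule norm_power_diff[OF 1 e1])
  also have "norm (1 + w - exp w) \<le> exp 1 * (norm w)\<^sup>2"
  proof -
    have "norm (1 + w - exp w) = norm (exp w - (\<Sum>i\<le>1. w ^ i / fact i))"
      by (simp add: numeral_eq_Suc norm_minus_commute)
    also have "\<dots> \<le> exp \<bar>Re w\<bar> * (norm w) ^ (Suc 1) / fact 1"
      by (rule Taylor_exp)
    also have "\<dots> = exp \<bar>Re w\<bar> * (norm w)\<^sup>2" by (simp add: power2_eq_square)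
    also have "\<dots> \<le> exp 1 * (norm w)\<^sup>2"
      using abs_Re_le_cmod[of w] w by (intro mult_right_mono) auto
    finally show ?thesis .
  qed
  finally show ?thesis by (simp add: exp_of_nat_mult mult_left_mono)
qed

section \<open>Truncation of the Levy measure\<close>

abbreviation levy_weight :: "'a::real_normed_vector \<Rightarrow> real" where
  "levy_weight y \<equiv> (norm y)\<^sup>2 / (1 + (norm y)\<^sup>2)"

definition levy_kernel :: "'a::euclidean_space \<Rightarrow> 'a \<Rightarrow> complex" where
  "levy_kernel \<xi> y = 1 + \<i> * of_real ((\<xi> \<bullet> y) * indicator (ball 0 1) y) - exp (\<i> * of_real (\<xi> \<bullet> y))"

lemma levy_kernel_measurable [measurable]: "levy_kernel \<xi> \<in> borel_measurable borel"
proof -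
  have [measurable]: "ball (0::'a) 1 \<in> sets borel" by (rule sets_ball_borel)
  show ?thesis unfolding levy_kernel_def[abs_def] by measurable
qed

text \<open>Inside the unit ball the kernel is a Taylor remainder, and the weight is at least half
  the squared norm. Outside, the kernel is at most 2 and the weight at least one half, which gives
  the constant 4.\<close>

lemma norm_levy_kernel_le: "norm (levy_kernel \<xi> y) \<le> ((norm \<xi>)\<^sup>2 + 4) * levy_weight y"
proof (cases "norm y < 1")
  case True
  have "norm (levy_kernel \<xi> y) = norm (iexp (\<xi> \<bullet> y) - (\<Sum>k\<le>1. (\<i> * complex_of_real (\<xi> \<bullet> y)) ^ k / fact k))"
    using True by (simp add: levy_kernel_def numeral_eq_Suc norm_minus_commute)
  also have "\<dots> \<le> \<bar>\<xi> \<bullet> y\<bar> ^ Suc 1 / fact (Suc 1)" by (rule iexp_approx1)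
  also have "\<dots> = \<bar>\<xi> \<bullet> y\<bar>\<^sup>2 / 2" by (simp add: power2_eq_square)
  also have "\<dots> \<le> (norm \<xi> * norm y)\<^sup>2 / 2"
    using Cauchy_Schwarz_ineq2[of \<xi> y] by (intro divide_right_mono power_mono) auto
  also have "\<dots> = (norm \<xi>)\<^sup>2 * ((norm y)\<^sup>2 / 2)" by (simp add: power_mult_distrib)
  also have "\<dots> \<le> ((norm \<xi>)\<^sup>2 + 4) * levy_weight y"
  proof (intro mult_mono divide_left_mono)
    show "1 + (norm y)\<^sup>2 \<le> 2" using True power_mono[of "norm y" 1 2] by simp
  qed (auto intro: add_pos_nonneg)
  finally show ?thesis .
next
  case False
  have "norm (levy_kernel \<xi> y) \<le> norm (1 :: complex) + norm (iexp (\<xi> \<bullet> y))"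
    using False by (simp add: levy_kernel_def norm_triangle_le_diff)
  also have "\<dots> = 2" by simp
  also have "2 \<le> 4 * levy_weight y"
    using False power_mono[of 1 "norm y" 2] by (simp add: field_simps add_pos_nonneg)
  also have "\<dots> \<le> ((norm \<xi>)\<^sup>2 + 4) * levy_weight y" by (intro mult_right_mono) auto
  finally show ?thesis .
qed

lemma AE_levy_density_finite:
  fixes \<phi> :: "'a::euclidean_space \<Rightarrow> ennreal"
  assumes [measurable]: "\<phi> \<in> borel_measurable borel" and fin: "(\<integral>\<^sup>+ y. \<phi> y * ennreal (levy_weight y) \<partial>lborel) < \<top>"
  shows "AE y in lborel. \<phi> y < \<top>"
proof -
  have key: "a < \<top>" if "a * ennreal w \<noteq> \<infinity>" "0 < w" for a w
    using that by (cases a) (auto simp: ennreal_top_mult)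
  have "AE y in lborel. \<phi> y * ennreal (levy_weight y) \<noteq> \<infinity>"
    using fin by (intro nn_integral_PInf_AE) auto
  moreover have "AE y in lborel. y \<noteq> (0::'a)" by (rule AE_lborel_singleton)
  ultimately show ?thesis
  proof eventually_elim
    case (elim y)
    show ?case by (rule key[OF elim(1)]) (use elim(2) in \<open>simp add: add_pos_nonneg\<close>)
  qed
qed

lemma integral_density_enn2real:
  fixes F :: "'a::euclidean_space \<Rightarrow> 'b::{banach, second_countable_topology}"
  assumes [measurable]: "\<phi> \<in> borel_measurable borel" "F \<in> borel_measurable borel" and fin: "AE y in lborel. \<phi> y < \<top>"
  shows "(LINT y|density lborel \<phi>. F y) = (LINT y|lborel. enn2real (\<phi> y) *\<^sub>R F y)"
proof -
  have "density lborel \<phi> = density lborel (\<lambda>y. ennreal (enn2real (\<phi> y)))"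
    by (rule density_cong) (use fin in \<open>auto elim!: eventually_mono\<close>)
  then show ?thesis by (simp add: integral_density)
qed

text \<open>The limit is taken with the compensator inside the integral: \<open>jump_symbol\<close>
  and the compensating drift need not converge separately when the truncation is removed.\<close>

lemma levy_kernel_integral_tendsto:
  fixes \<phi> :: "'a::euclidean_space \<Rightarrow> ennreal" and \<Phi> :: "nat \<Rightarrow> 'a \<Rightarrow> ennreal"
  assumes \<phi>[measurable]: "\<phi> \<in> borel_measurable borel" "\<And>n. \<Phi> n \<in> borel_measurable borel"
    and fin: "(\<integral>\<^sup>+ y. \<phi> y * ennreal (levy_weight y) \<partial>lborel) < \<top>"
    and le: "\<And>n y. \<Phi> n y \<le> \<phi> y" and lim: "AE y in lborel. (\<lambda>n. \<Phi> n y) \<longlonglongrightarrow> \<phi> y"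
  shows "(\<lambda>n. LINT y|density lborel (\<Phi> n). levy_kernel \<xi> y) \<longlonglongrightarrow> (LINT y|density lborel \<phi>. levy_kernel \<xi> y)"
proof -
  have fphi: "AE y in lborel. \<phi> y < \<top>" by (rule AE_levy_density_finite[OF \<phi>(1) fin])
  then have fPhi: "AE y in lborel. \<Phi> n y < \<top>" for n
    by eventually_elim (rule le_less_trans[OF le])
  have int: "integrable lborel (\<lambda>y. enn2real (\<phi> y) * (((norm \<xi>)\<^sup>2 + 4) * levy_weight y))"
  proof (rule integrableI_bounded)
    have "(\<integral>\<^sup>+ y. ennreal (norm (enn2real (\<phi> y) * (((norm \<xi>)\<^sup>2 + 4) * levy_weight y))) \<partial>lborel) =
      (\<integral>\<^sup>+ y. ennreal ((norm \<xi>)\<^sup>2 + 4) * (\<phi> y * ennreal (levy_weight y)) \<partial>lborel)"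
    proof (rule nn_integral_cong_AE, use fphi in eventually_elim)
      fix y assume "\<phi> y < \<top>"
      then have "\<phi> y = ennreal (enn2real (\<phi> y))" by simp
      then have "ennreal ((norm \<xi>)\<^sup>2 + 4) * (\<phi> y * ennreal (levy_weight y)) = ennreal ((norm \<xi>)\<^sup>2 + 4) * (ennreal (enn2real (\<phi> y)) * ennreal (levy_weight y))"
        by (simp only:)
      also have "\<dots> = ennreal (((norm \<xi>)\<^sup>2 + 4) * (enn2real (\<phi> y) * levy_weight y))"
        by (subst ennreal_mult, simp, simp, subst ennreal_mult, simp_all)
      finally show "ennreal (norm (enn2real (\<phi> y) * (((norm \<xi>)\<^sup>2 + 4) * levy_weight y))) = ennreal ((norm \<xi>)\<^sup>2 + 4) * (\<phi> y * ennreal (levy_weight y))"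
        by (simp add: abs_mult ac_simps)
    qed
    also have "\<dots> = ennreal ((norm \<xi>)\<^sup>2 + 4) * (\<integral>\<^sup>+ y. \<phi> y * ennreal (levy_weight y) \<partial>lborel)"
      by (rule nn_integral_cmult) measurable
    also have "\<dots> < \<infinity>" using fin by (simp add: ennreal_mult_less_top del: ennreal_plus)
    finally show "(\<integral>\<^sup>+ y. ennreal (norm (enn2real (\<phi> y) * (((norm \<xi>)\<^sup>2 + 4) * levy_weight y))) \<partial>lborel) < \<infinity>" .
  qed measurable
  show ?thesis
    unfolding integral_density_enn2real[OF \<phi>(1) levy_kernel_measurable fphi] integral_density_enn2real[OF \<phi>(2) levy_kernel_measurable fPhi]
  proof (rule integral_dominated_convergence[OF _ _ int])
    show "AE y in lborel. (\<lambda>n. enn2real (\<Phi> n y) *\<^sub>R levy_kernel \<xi> y) \<longlonglongrightarrow> enn2real (\<phi> y) *\<^sub>R levy_kernel \<xi> y"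
      using fphi lim by eventually_elim (intro tendsto_intros tendsto_enn2real, auto)
    show "AE y in lborel. norm (enn2real (\<Phi> n y) *\<^sub>R levy_kernel \<xi> y) \<le> enn2real (\<phi> y) * (((norm \<xi>)\<^sup>2 + 4) * levy_weight y)" for n
      using fphi
    proof eventually_elim
      case (elim y)
      have "norm (enn2real (\<Phi> n y) *\<^sub>R levy_kernel \<xi> y) = enn2real (\<Phi> n y) * norm (levy_kernel \<xi> y)" by simp
      also have "\<dots> \<le> enn2real (\<phi> y) * (((norm \<xi>)\<^sup>2 + 4) * levy_weight y)"
        by (intro mult_mono enn2real_mono le norm_levy_kernel_le elim) auto
      finally show ?case .
    qed
  qed measurable
qed

text \<open>The compensator of the jumps of size below 1, collected into a vector. It may diverge as
  the truncation is removed.\<close>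

definition small_jump_drift :: "('a::euclidean_space \<Rightarrow> ennreal) \<Rightarrow> 'a" where
  "small_jump_drift \<phi> = (LINT y|density lborel \<phi>. indicator (ball 0 1) y *\<^sub>R y)"

lemma levy_kernel_integral_finite:
  fixes \<phi> :: "'a::euclidean_space \<Rightarrow> ennreal"
  assumes [measurable]: "\<phi> \<in> borel_measurable borel" and fin: "(\<integral>\<^sup>+ y. \<phi> y \<partial>lborel) < \<top>"
  shows "(LINT y|density lborel \<phi>. levy_kernel \<xi> y) = \<i> * of_real (\<xi> \<bullet> small_jump_drift \<phi>) - jump_symbol \<phi> \<xi>"
proof -
  have [measurable]: "ball (0::'a) 1 \<in> sets borel" by (rule sets_ball_borel)
  interpret finite_measure "density lborel \<phi>"
    using fin by (intro finite_measureI) (simp add: emeasure_density less_top)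
  have i1: "integrable (density lborel \<phi>) (\<lambda>y. indicator (ball 0 1) y *\<^sub>R y)"
    by (rule integrable_const_bound[where B=1]) (auto split: split_indicator)
  have i2: "integrable (density lborel \<phi>) (\<lambda>y. iexp (\<xi> \<bullet> y) - 1)"
    by (rule integrable_const_bound[where B=2]) (auto intro!: order_trans[OF norm_triangle_ineq4])
  have "(LINT y|density lborel \<phi>. levy_kernel \<xi> y) =
    (LINT y|density lborel \<phi>. \<i> * of_real (\<xi> \<bullet> (indicator (ball 0 1) y *\<^sub>R y)) - (iexp (\<xi> \<bullet> y) - 1))"
    by (intro Bochner_Integration.integral_cong) (auto simp: levy_kernel_def)
  also have "\<dots> = (LINT y|density lborel \<phi>. \<i> * of_real (\<xi> \<bullet> (indicator (ball 0 1) y *\<^sub>R y))) - jump_symbol \<phi> \<xi>"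
    unfolding jump_symbol_def
    by (intro Bochner_Integration.integral_diff i2 integrable_mult_right integrable_of_real integrable_inner_right i1)
  also have "(LINT y|density lborel \<phi>. \<i> * of_real (\<xi> \<bullet> (indicator (ball 0 1) y *\<^sub>R y))) = \<i> * of_real (\<xi> \<bullet> small_jump_drift \<phi>)"
    by (simp only: integral_mult_right_zero integral_complex_of_real integral_inner_right[OF i1] small_jump_drift_def)
  finally show ?thesis .
qed

text \<open>Reflection reverses the sign of the integral. Rearranged densities therefore need no
  compensating drift, in agreement with the drift 0 of the symmetrization.\<close>

lemma small_jump_drift_symmetric:
  fixes \<phi> :: "'a::euclidean_space \<Rightarrow> ennreal"
  assumes \<phi>[measurable]: "\<phi> \<in> borel_measurable borel" and fin: "(\<integral>\<^sup>+ y. \<phi> y \<partial>lborel) < \<top>" and sym: "\<And>y. \<phi> (- y) = \<phi> y"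
  shows "small_jump_drift \<phi> = 0"
proof -
  have [measurable]: "ball (0::'a) 1 \<in> sets borel" by (rule sets_ball_borel)
  have "AE y in lborel. \<phi> y \<noteq> \<infinity>" using fin by (intro nn_integral_PInf_AE) auto
  then have AE: "AE y in lborel. \<phi> y < \<top>" by eventually_elim (simp add: less_top)
  let ?F = "\<lambda>y. enn2real (\<phi> y) *\<^sub>R indicator (ball 0 1) y *\<^sub>R y"
  have eq: "small_jump_drift \<phi> = (LINT y|lborel. ?F y)"
    unfolding small_jump_drift_def by (rule integral_density_enn2real[OF \<phi> _ AE]) measurable
  also have "\<dots> = (LINT y|distr lborel borel uminus. ?F y)" by (simp add: lborel_distr_uminus')
  also have "\<dots> = (LINT y|lborel. ?F (- y))" by (rule integral_distr) measurable
  also have "\<dots> = (LINT y|lborel. - ?F y)" by (intro Bochner_Integration.integral_cong) (auto simp: sym indicator_def)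
  also have "\<dots> = - small_jump_drift \<phi>" unfolding eq by simp
  finally have "small_jump_drift \<phi> + small_jump_drift \<phi> = 0" by (simp add: eq_neg_iff_add_eq_0)
  then show ?thesis by (simp flip: scaleR_2)
qed

lemma levy_exponent_eq:
  "levy_exponent b A \<nu> \<xi> = - \<i> * of_real (b \<bullet> \<xi>) + of_real (1 / 2 * ((A *v \<xi>) \<bullet> \<xi>)) + (LINT y|\<nu>. levy_kernel \<xi> y)"
  by (simp add: levy_exponent_def levy_kernel_def)

lemma norm_jump_symbol_le:
  fixes \<phi> :: "'a::euclidean_space \<Rightarrow> ennreal"
  assumes [measurable]: "\<phi> \<in> borel_measurable borel" and int: "(\<integral>\<^sup>+ y. \<phi> y \<partial>lborel) = ennreal l" and l: "0 \<le> l"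
  shows "norm (jump_symbol \<phi> \<xi>) \<le> 2 * l"
proof -
  have em: "emeasure (density lborel \<phi>) UNIV = ennreal l" by (simp add: emeasure_density int)
  interpret finite_measure "density lborel \<phi>" by (rule finite_measureI) (simp add: em)
  have le: "norm (iexp (\<xi> \<bullet> y) - 1) \<le> 2" for y
    by (rule order_trans[OF norm_triangle_ineq4]) simp
  have "norm (jump_symbol \<phi> \<xi>) \<le> (LINT y|density lborel \<phi>. norm (iexp (\<xi> \<bullet> y) - 1))"
    unfolding jump_symbol_def by (rule integral_norm_bound)
  also have "\<dots> \<le> (LINT y|density lborel \<phi>. 2)"
    by (rule integral_mono) (auto intro!: integrable_const_bound[where B=2] simp: le)
  also have "\<dots> = 2 * l" using l by (simp add: measure_def em)
  finally show ?thesis .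
qed

text \<open>The power differs from the exponential by at most a constant times
  \<open>(t * l n)\<^sup>2 / k n\<close>, so \<open>k n\<close> has to outgrow that square; the
  factor \<open>Suc n\<close> makes the error vanish, and the summand 1 helps to keep the argument
  of the power estimate inside the unit disc. What remains is the exponent of the truncated
  triple.\<close>

lemma levy_cf_tendsto:
  fixes \<phi> :: "real ^ 'n \<Rightarrow> ennreal" and \<Phi> :: "nat \<Rightarrow> real ^ 'n \<Rightarrow> ennreal"
  assumes \<phi>: "\<phi> \<in> borel_measurable borel" "\<And>n. \<Phi> n \<in> borel_measurable borel"
    and fin: "(\<integral>\<^sup>+ y. \<phi> y * ennreal (levy_weight y) \<partial>lborel) < \<top>"
    and le: "\<And>n y. \<Phi> n y \<le> \<phi> y" and lim: "AE y in lborel. (\<lambda>n. \<Phi> n y) \<longlonglongrightarrow> \<phi> y"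
    and int: "\<And>n. (\<integral>\<^sup>+ y. \<Phi> n y \<partial>lborel) = ennreal (l n)" and l: "\<And>n. 0 \<le> l n" and t: "0 \<le> t"
    and k: "\<And>n. 0 < k n" "\<And>n. 4 * (t * l n + 1)\<^sup>2 * real (Suc n) \<le> real (k n)"
    and norm1: "\<And>n. norm (1 + of_real (t / k n) * jump_symbol (\<Phi> n) \<xi>) \<le> 1"
    and psd: "0 \<le> (A *v \<xi>) \<bullet> \<xi>"
  shows "(\<lambda>n. exp (\<i> * of_real (\<xi> \<bullet> (t *\<^sub>R (b - small_jump_drift (\<Phi> n))))) *
      (exp (- of_real (t / 2 * ((A *v \<xi>) \<bullet> \<xi>))) * (1 + of_real (t / k n) * jump_symbol (\<Phi> n) \<xi>) ^ k n))
    \<longlonglongrightarrow> exp (- of_real t * levy_exponent b A (density lborel \<phi>) \<xi>)"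
proof -
  define J where "J n = jump_symbol (\<Phi> n) \<xi>" for n
  define w where "w n = of_real (t / k n) * J n" for n
  define p where "p n = exp (\<i> * of_real (\<xi> \<bullet> (t *\<^sub>R (b - small_jump_drift (\<Phi> n))))) * exp (- complex_of_real (t / 2 * ((A *v \<xi>) \<bullet> \<xi>)))" for n
  define I where "I n = (LINT y|density lborel (\<Phi> n). levy_kernel \<xi> y)" for n
  have I: "I n = \<i> * of_real (\<xi> \<bullet> small_jump_drift (\<Phi> n)) - J n" for n
    unfolding I_def J_def by (rule levy_kernel_integral_finite) (simp_all add: \<phi> int)
  define \<Psi> where "\<Psi> n = - \<i> * of_real (b \<bullet> \<xi>) + of_real (1 / 2 * ((A *v \<xi>) \<bullet> \<xi>)) + I n" for n
  have kw: "of_nat (k n) * w n = of_real t * J n" for n using k(1)[of n] by (simp add: w_def)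
  \<comment> \<open>The drift subtracted in \<open>p n\<close> is exactly the compensator contained
    in \<open>I n\<close>, so the product is the characteristic function of the truncated,
    compensated triple.\<close>
  have main: "p n * exp (of_nat (k n) * w n) = exp (- of_real t * \<Psi> n)" for n
    unfolding kw p_def \<Psi>_def I
    by (simp add: exp_add[symmetric] inner_diff_right inner_commute[of b \<xi>] algebra_simps)
  have "(\<lambda>n. exp (- of_real t * \<Psi> n)) \<longlonglongrightarrow> exp (- of_real t * levy_exponent b A (density lborel \<phi>) \<xi>)"
    unfolding levy_exponent_eq \<Psi>_def I_def
    by (intro tendsto_intros levy_kernel_integral_tendsto[OF \<phi> fin le lim])
  moreover have "(\<lambda>n. p n * (1 + w n) ^ k n - exp (- of_real t * \<Psi> n)) \<longlonglongrightarrow> 0"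
  proof (rule Lim_null_comparison)
    show "\<forall>\<^sub>F n in sequentially. norm (p n * (1 + w n) ^ k n - exp (- of_real t * \<Psi> n)) \<le> exp 1 * (1 / real (Suc n))"
    proof (intro always_eventually allI)
      fix n
      define a where "a = t * l n"
      have a: "0 \<le> a" using t l by (simp add: a_def)
      have kpos: "0 < real (k n)" using k(1)[of n] by simp
      have k2: "4 * (a + 1)\<^sup>2 * real (Suc n) \<le> real (k n)" using k(2)[of n] by (simp add: a_def)
      have "norm (J n) \<le> 2 * l n" unfolding J_def by (rule norm_jump_symbol_le[OF \<phi>(2) int l])
      moreover have "norm (complex_of_real (t / k n)) = t / k n" using t kpos by (simp only: norm_of_real) simp
      ultimately have "norm (w n) \<le> t / k n * (2 * l n)"
        unfolding w_def norm_mult using t kpos by (simp only: mult_left_mono divide_nonneg_pos)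
      then have w: "norm (w n) \<le> 2 * a / k n" by (simp add: a_def mult.left_commute)
      have "2 * a \<le> 4 * (a + 1)\<^sup>2" using a by (simp add: power2_eq_square algebra_simps)
      also have "\<dots> \<le> 4 * (a + 1)\<^sup>2 * real (Suc n)"
        using mult_left_mono[of 1 "real (Suc n)" "4 * (a + 1)\<^sup>2"] by simp
      also have "\<dots> \<le> real (k n)" by (rule k2)
      finally have "2 * a / k n \<le> 1" using kpos by simp
      then have w1: "norm (w n) \<le> 1" using w by linarith
      have pn: "norm (p n) \<le> 1" using t psd by (simp add: p_def norm_mult)
      have "norm (p n * (1 + w n) ^ k n - exp (- of_real t * \<Psi> n)) = norm (p n) * norm ((1 + w n) ^ k n - exp (of_nat (k n) * w n))"
        unfolding main[symmetric] by (simp add: norm_mult[symmetric] right_diff_distrib)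
      also have "\<dots> \<le> 1 * (k n * (exp 1 * (norm (w n))\<^sup>2))"
        using norm1[of n] w1 pn by (intro mult_mono norm_power_minus_exp_le) (auto simp: w_def J_def)
      also have "\<dots> \<le> k n * (exp 1 * (2 * a / k n)\<^sup>2)"
        using w by (simp add: mult_left_mono power_mono)
      also have "\<dots> = exp 1 * (4 * a\<^sup>2 / k n)" using kpos by (simp add: power2_eq_square field_simps)
      also have "\<dots> \<le> exp 1 * (1 / real (Suc n))"
      proof (rule mult_left_mono)
        have "4 * a\<^sup>2 * real (Suc n) \<le> 4 * (a + 1)\<^sup>2 * real (Suc n)"
          using a by (intro mult_right_mono) (auto simp: power_mono)
        also have "\<dots> \<le> real (k n)" by (rule k2)
        finally show "4 * a\<^sup>2 / k n \<le> 1 / real (Suc n)" using kpos by (simp add: field_simps)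
      qed simp
      finally show "norm (p n * (1 + w n) ^ k n - exp (- of_real t * \<Psi> n)) \<le> exp 1 * (1 / real (Suc n))" .
    qed
    show "(\<lambda>n. exp 1 * (1 / real (Suc n))) \<longlonglongrightarrow> 0"
      using LIMSEQ_inverse_real_of_nat by (intro tendsto_mult_right_zero) (simp add: inverse_eq_divide)
  qed
  ultimately have "(\<lambda>n. p n * (1 + w n) ^ k n) \<longlonglongrightarrow> exp (- of_real t * levy_exponent b A (density lborel \<phi>) \<xi>)"
    by (rule Lim_transform)
  then show ?thesis by (simp only: p_def w_def J_def mult.assoc)
qed

theorem levy_rearrangement_dominated:
  fixes \<mu> \<mu>' \<nu> :: "(real ^ 'n) measure"
  assumes triple: "levy_triple b A \<nu>" and ac: "absolutely_continuous lborel \<nu>"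
    and levy': "levy_measure (symmetrized_levy_measure \<nu>)" and t: "0 \<le> t"
    and \<mu>: "borel_prob \<mu>" and \<mu>': "borel_prob \<mu>'"
    and cf: "\<And>\<xi>. cfun \<mu> \<xi> = exp (- of_real t * levy_exponent b A \<nu> \<xi>)"
    and cf': "\<And>\<xi>. cfun \<mu>' \<xi> = exp (- of_real t * levy_exponent 0 (symmetrized_matrix A) (symmetrized_levy_measure \<nu>) \<xi>)"
  shows "rearrangement_dominated \<mu> \<mu>'"
proof -
  have sym: "transpose A = A" and psd: "\<And>\<xi>. 0 \<le> (A *v \<xi>) \<bullet> \<xi>" and levy: "levy_measure \<nu>"
    using triple by (auto simp: levy_triple_def)
  define \<phi> where "\<phi> = RN_deriv lborel \<nu>"
  define \<psi> where "\<psi> = rearr \<phi>"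
  have \<phi>m[measurable]: "\<phi> \<in> borel_measurable borel" unfolding \<phi>_def using borel_measurable_RN_deriv[of lborel \<nu>] by simp
  have \<psi>m[measurable]: "\<psi> \<in> borel_measurable borel" unfolding \<psi>_def by (rule rearr_measurable)
  have \<nu>: "density lborel \<phi> = \<nu>"
    unfolding \<phi>_def using levy ac by (intro sigma_finite_measure.density_RN_deriv sigma_finite_lborel) (auto simp: levy_measure_def)
  have \<nu>': "symmetrized_levy_measure \<nu> = density lborel \<psi>"
    unfolding symmetrized_levy_measure_def \<phi>_def[symmetric] \<psi>_def by (simp add: decreasing_rearrangement_eq_rearr)
  have fin: "(\<integral>\<^sup>+ y. f y * ennreal (levy_weight y) \<partial>lborel) < \<top>"
    if "levy_measure (density lborel f)" and [measurable]: "f \<in> borel_measurable borel" for f :: "real ^ 'n \<Rightarrow> ennreal"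
    using that(1) unfolding levy_measure_def by (subst (asm) nn_integral_density) auto
  have fin\<phi>: "(\<integral>\<^sup>+ y. \<phi> y * ennreal (levy_weight y) \<partial>lborel) < \<top>"
    using levy by (intro fin) (simp_all add: \<nu>)
  have fin\<psi>: "(\<integral>\<^sup>+ y. \<psi> y * ennreal (levy_weight y) \<partial>lborel) < \<top>"
    using levy' by (intro fin) (simp_all add: \<nu>'[symmetric])
  \<comment> \<open>Away from the origin the Levy weight is bounded below, so cutting out small
    jumps leaves a finite intensity.\<close>
  define \<Phi> where "\<Phi> n y = \<phi> y * indicator {y. 1 / real (Suc n) < norm y} y" for n y
  \<comment> \<open>The truncated density is rearranged; truncating the rearranged density instead
    would not relate the two jump laws by rearrangement for each \<open>n\<close>.\<close>
  define \<Psi> where "\<Psi> n = rearr (\<Phi> n)" for n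
  have \<Phi>m[measurable]: "\<Phi> n \<in> borel_measurable borel" for n unfolding \<Phi>_def by measurable
  have \<Psi>m[measurable]: "\<Psi> n \<in> borel_measurable borel" for n unfolding \<Psi>_def by (rule rearr_measurable)
  have le: "\<Phi> n y \<le> \<phi> y" for n y by (simp add: \<Phi>_def split: split_indicator)
  have inc: "\<Phi> n y \<le> \<Phi> (Suc n) y" for n y
  proof -
    have "1 / real (Suc (Suc n)) \<le> 1 / real (Suc n)" by (intro divide_left_mono) auto
    then show ?thesis by (auto simp: \<Phi>_def split: split_indicator)
  qed
  have lim0: "(\<lambda>n. \<Phi> n y) \<longlonglongrightarrow> \<phi> y" if "y \<noteq> 0" for y
  proof (rule tendsto_eventually)
    have "(\<lambda>n. 1 / real (Suc n)) \<longlonglongrightarrow> 0" using LIMSEQ_inverse_real_of_nat by (simp add: inverse_eq_divide)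
    then have "\<forall>\<^sub>F n in sequentially. 1 / real (Suc n) < norm y" using that by (intro order_tendstoD(2)) auto
    then show "\<forall>\<^sub>F n in sequentially. \<Phi> n y = \<phi> y" by eventually_elim (simp add: \<Phi>_def)
  qed
  have AE0: "AE y in lborel. y \<noteq> (0 :: real ^ 'n)" by (rule AE_lborel_singleton)
  have lim: "AE y in lborel. (\<lambda>n. \<Phi> n y) \<longlonglongrightarrow> \<phi> y" using AE0 by eventually_elim (rule lim0)
  have sup: "AE y in lborel. (SUP n. \<Phi> n y) = \<phi> y"
    using AE0
  proof eventually_elim
    case (elim y)
    have "(\<lambda>n. \<Phi> n y) \<longlonglongrightarrow> (SUP n. \<Phi> n y)" by (intro LIMSEQ_SUP incseq_SucI inc)
    from LIMSEQ_unique[OF this lim0[OF elim]] show ?case .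
  qed
  have \<Psi>lim: "(\<lambda>n. \<Psi> n y) \<longlonglongrightarrow> \<psi> y" and \<Psi>le: "\<Psi> n y \<le> \<psi> y" for n y
    unfolding \<Psi>_def \<psi>_def using rearr_mono_limit[OF \<phi>m \<Phi>m inc sup] by blast+
  have lev: "{x. ennreal s < \<Psi> n x} = rball (emeasure lborel {x. ennreal s < \<Phi> n x})" if "0 \<le> s" for s n
    unfolding \<Psi>_def by (rule superlevel_rearr[OF \<Phi>m that])
  have "(\<integral>\<^sup>+ y. \<Phi> n y \<partial>lborel) < \<top>" for n
  proof -
    \<comment> \<open>Where \<open>norm y\<close> exceeds \<open>1 / real (Suc n)\<close>, the Levy
      weight is at least \<open>1 / C\<close>.\<close>
    define C where "C = 1 + (real (Suc n))\<^sup>2"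
    have C: "0 < C" by (simp add: C_def add_pos_nonneg)
    have "(\<integral>\<^sup>+ y. \<Phi> n y \<partial>lborel) \<le> (\<integral>\<^sup>+ y. ennreal C * (\<phi> y * ennreal (levy_weight y)) \<partial>lborel)"
    proof (rule nn_integral_mono)
      fix y :: "real ^ 'n"
      show "\<Phi> n y \<le> ennreal C * (\<phi> y * ennreal (levy_weight y))"
      proof (cases "1 / real (Suc n) < norm y")
        case True
        then have "1 \<le> norm y * real (Suc n)" by (simp add: field_simps)
        then have "1 \<le> (norm y * real (Suc n))\<^sup>2" by (rule one_le_power)
        then have "1 \<le> (norm y)\<^sup>2 * (real (Suc n))\<^sup>2" by (simp only: power_mult_distrib)
        then have "1 + (norm y)\<^sup>2 \<le> C * (norm y)\<^sup>2" by (simp add: C_def algebra_simps del: of_nat_Suc)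
        then have "1 \<le> C * levy_weight y" by (simp add: field_simps add_pos_nonneg)
        then have "\<phi> y * 1 \<le> \<phi> y * ennreal (C * levy_weight y)"
          by (intro mult_left_mono) (simp_all add: ennreal_ge_1)
        also have "ennreal (C * levy_weight y) = ennreal C * ennreal (levy_weight y)" using C by (intro ennreal_mult) auto
        finally show ?thesis using True by (simp add: \<Phi>_def ac_simps)
      qed (simp add: \<Phi>_def)
    qed
    also have "\<dots> = ennreal C * (\<integral>\<^sup>+ y. \<phi> y * ennreal (levy_weight y) \<partial>lborel)"
      by (rule nn_integral_cmult) measurable
    also have "\<dots> < \<top>" using fin\<phi> by (simp add: ennreal_mult_less_top)
    finally show ?thesis .
  qed
  then have int: "(\<integral>\<^sup>+ y. \<Phi> n y \<partial>lborel) = ennreal (enn2real (\<integral>\<^sup>+ y. \<Phi> n y \<partial>lborel))" for n by simp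
  define l where "l n = enn2real (\<integral>\<^sup>+ y. \<Phi> n y \<partial>lborel)" for n
  have int: "(\<integral>\<^sup>+ y. \<Phi> n y \<partial>lborel) = ennreal (l n)" and l: "0 \<le> l n" for n
    unfolding l_def using int by simp_all
  have int': "(\<integral>\<^sup>+ y. \<Psi> n y \<partial>lborel) = ennreal (l n)" for n
    using nn_integral_rearrangement[OF \<Phi>m \<Psi>m lev] int by simp
  \<comment> \<open>Large enough for the error bound in \<open>levy_cf_tendsto\<close>, and then
    also above \<open>t * l n\<close>, so that the jump probability \<open>t * l n / k n\<close> is
    at most 1.\<close>
  define k where "k n = Suc (nat \<lceil>4 * (t * l n + 1)\<^sup>2 * real (Suc n)\<rceil>)" for n
  have k: "0 < k n" "4 * (t * l n + 1)\<^sup>2 * real (Suc n) \<le> real (k n)" for n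
    unfolding k_def by (simp, linarith)
  have tk: "t * l n \<le> real (k n)" for n
  proof -
    have "0 \<le> t * l n" using t l by simp
    moreover have "4 * (t * l n + 1)\<^sup>2 = 4 * (t * l n)\<^sup>2 + 8 * (t * l n) + 4" by (simp add: power2_eq_square algebra_simps)
    ultimately have "t * l n \<le> 4 * (t * l n + 1)\<^sup>2" using zero_le_power2[of "t * l n"] by linarith
    also have "\<dots> \<le> 4 * (t * l n + 1)\<^sup>2 * real (Suc n)"
      using mult_left_mono[of 1 "real (Suc n)" "4 * (t * l n + 1)\<^sup>2"] by simp
    finally show ?thesis using k(2)[of n] by linarith
  qed
  obtain \<gamma> \<gamma>' where \<gamma>: "rearrangement_dominated \<gamma> \<gamma>'"
    "\<And>\<xi>. cfun \<gamma> \<xi> = exp (- of_real (t / 2 * ((A *v \<xi>) \<bullet> \<xi>)))"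
    "\<And>\<xi>. cfun \<gamma>' \<xi> = exp (- of_real (t / 2 * ((symmetrized_matrix A *v \<xi>) \<bullet> \<xi>)))"
    using gaussian_part_dominated[OF sym psd t] by blast
  have "\<forall>n. \<exists>\<rho> \<rho>'. rearrangement_dominated \<rho> \<rho>' \<and>
    (\<forall>\<xi>. norm (1 + of_real (t / k n) * jump_symbol (\<Phi> n) \<xi>) \<le> 1) \<and> (\<forall>\<xi>. norm (1 + of_real (t / k n) * jump_symbol (\<Psi> n) \<xi>) \<le> 1) \<and>
    (\<forall>\<xi>. cfun \<rho> \<xi> = (1 + of_real (t / k n) * jump_symbol (\<Phi> n) \<xi>) ^ k n) \<and>
    (\<forall>\<xi>. cfun \<rho>' \<xi> = (1 + of_real (t / k n) * jump_symbol (\<Psi> n) \<xi>) ^ k n)"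
    by (intro allI jump_part_dominated[OF \<Phi>m \<Psi>m lev int l t tk k(1)])
  then obtain \<rho> where "\<forall>n. \<exists>\<rho>'. rearrangement_dominated (\<rho> n) \<rho>' \<and>
    (\<forall>\<xi>. norm (1 + of_real (t / k n) * jump_symbol (\<Phi> n) \<xi>) \<le> 1) \<and> (\<forall>\<xi>. norm (1 + of_real (t / k n) * jump_symbol (\<Psi> n) \<xi>) \<le> 1) \<and>
    (\<forall>\<xi>. cfun (\<rho> n) \<xi> = (1 + of_real (t / k n) * jump_symbol (\<Phi> n) \<xi>) ^ k n) \<and>
    (\<forall>\<xi>. cfun \<rho>' \<xi> = (1 + of_real (t / k n) * jump_symbol (\<Psi> n) \<xi>) ^ k n)"
    by (drule_tac choice) (erule exE)
  then obtain \<rho>' where "\<forall>n. rearrangement_dominated (\<rho> n) (\<rho>' n) \<and>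
    (\<forall>\<xi>. norm (1 + of_real (t / k n) * jump_symbol (\<Phi> n) \<xi>) \<le> 1) \<and> (\<forall>\<xi>. norm (1 + of_real (t / k n) * jump_symbol (\<Psi> n) \<xi>) \<le> 1) \<and>
    (\<forall>\<xi>. cfun (\<rho> n) \<xi> = (1 + of_real (t / k n) * jump_symbol (\<Phi> n) \<xi>) ^ k n) \<and>
    (\<forall>\<xi>. cfun (\<rho>' n) \<xi> = (1 + of_real (t / k n) * jump_symbol (\<Psi> n) \<xi>) ^ k n)"
    by (drule_tac choice) (erule exE)
  then have \<rho>: "rearrangement_dominated (\<rho> n) (\<rho>' n)"
    and n1: "norm (1 + of_real (t / k n) * jump_symbol (\<Phi> n) \<xi>) \<le> 1" "norm (1 + of_real (t / k n) * jump_symbol (\<Psi> n) \<xi>) \<le> 1"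
    and cf\<rho>: "cfun (\<rho> n) \<xi> = (1 + of_real (t / k n) * jump_symbol (\<Phi> n) \<xi>) ^ k n"
      "cfun (\<rho>' n) \<xi> = (1 + of_real (t / k n) * jump_symbol (\<Psi> n) \<xi>) ^ k n" for n \<xi>
    by blast+
  have pr: "borel_prob \<gamma>" "borel_prob \<gamma>'" "borel_prob (\<rho> n)" "borel_prob (\<rho>' n)" for n
    using \<gamma>(1) \<rho> by (auto simp: rearrangement_dominated_def)
  define c where "c n = t *\<^sub>R (b - small_jump_drift (\<Phi> n))" for n
  have drift: "small_jump_drift (\<Psi> n) = 0" for n
  proof (rule small_jump_drift_symmetric)
    show "\<Psi> n (- y) = \<Psi> n y" for y
      unfolding \<Psi>_def using radially_decreasingD[OF radially_decreasing_rearr, of y "- y" "\<Phi> n"]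
        radially_decreasingD[OF radially_decreasing_rearr, of "- y" y "\<Phi> n"] by (intro antisym) auto
  qed (simp_all add: int')
  show ?thesis
  proof (rule rearrangement_dominated_limit[OF _ \<mu> \<mu>'])
    \<comment> \<open>Drift, Gaussian part and jumps are paired factor by factor. The shift by
      \<open>c n\<close>, which contains the compensator, is dominated by no shift at all, whatever
      its size.\<close>
    show "rearrangement_dominated (conv (return borel (c n)) (conv \<gamma> (\<rho> n))) (conv (return borel 0) (conv \<gamma>' (\<rho>' n)))" for n
      by (intro rearrangement_dominated_conv rearrangement_dominated_return borel_prob_return \<gamma>(1) \<rho>)
    fix \<xi> :: "real ^ 'n"
    have "cfun (conv (return borel (c n)) (conv \<gamma> (\<rho> n))) \<xi> =
      exp (\<i> * of_real (\<xi> \<bullet> (t *\<^sub>R (b - small_jump_drift (\<Phi> n))))) *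
      (exp (- of_real (t / 2 * ((A *v \<xi>) \<bullet> \<xi>))) * (1 + of_real (t / k n) * jump_symbol (\<Phi> n) \<xi>) ^ k n)" for n
      by (simp only: cfun_conv borel_prob_conv borel_prob_return pr cfun_return \<gamma>(2) cf\<rho> c_def)
    then show "(\<lambda>n. cfun (conv (return borel (c n)) (conv \<gamma> (\<rho> n))) \<xi>) \<longlonglongrightarrow> cfun \<mu> \<xi>"
      using levy_cf_tendsto[OF \<phi>m \<Phi>m fin\<phi> le lim int l t k n1(1) psd, of \<xi> b] by (simp only: cf \<nu>)
    have "cfun (conv (return borel 0) (conv \<gamma>' (\<rho>' n))) \<xi> =
      exp (\<i> * of_real (\<xi> \<bullet> (t *\<^sub>R (0 - small_jump_drift (\<Psi> n))))) *
      (exp (- of_real (t / 2 * ((symmetrized_matrix A *v \<xi>) \<bullet> \<xi>))) * (1 + of_real (t / k n) * jump_symbol (\<Psi> n) \<xi>) ^ k n)" for n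
      by (simp add: cfun_conv borel_prob_conv borel_prob_return pr cfun_return \<gamma>(3) cf\<rho> drift)
    moreover have "0 \<le> (symmetrized_matrix A *v \<xi>) \<bullet> \<xi>"
    proof -
      obtain V :: "real ^ 'n ^ 'n" where "A = V ** transpose V" using psd_factorization[OF sym psd] by blast
      then have "0 \<le> det A" by (simp add: det_mul)
      then show ?thesis by (simp add: symmetrized_matrix_def scaleR_matrix_vector_assoc[symmetric])
    qed
    ultimately show "(\<lambda>n. cfun (conv (return borel 0) (conv \<gamma>' (\<rho>' n))) \<xi>) \<longlonglongrightarrow> cfun \<mu>' \<xi>"
      using levy_cf_tendsto[OF \<psi>m \<Psi>m fin\<psi> \<Psi>le _ int' l t k n1(2), of "symmetrized_matrix A" \<xi> 0] \<Psi>lim by (simp only: cf' \<nu>') auto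
  qed
qed

section \<open>Expectations along a path\<close>

lemma Liminf_mult_ennreal:
  fixes a b :: "nat \<Rightarrow> ennreal"
  shows "liminf a * liminf b \<le> liminf (\<lambda>n. a n * b n)"
proof -
  have inc: "(INF m\<in>{i..}. x m) \<le> (INF m\<in>{n..}. x m)" if "i \<le> n" for x :: "nat \<Rightarrow> ennreal" and i n
    using that by (intro INF_superset_mono) auto
  have "liminf a * liminf b = (SUP j. SUP i. (INF m\<in>{i..}. a m) * (INF m\<in>{j..}. b m))"
    unfolding liminf_SUP_INF by (simp only: SUP_mult_right_ennreal SUP_mult_left_ennreal)
  also have "\<dots> \<le> liminf (\<lambda>n. a n * b n)"
  proof (intro SUP_least)
    fix j i
    have "(INF m\<in>{i..}. a m) * (INF m\<in>{j..}. b m) \<le> (INF m\<in>{max i j..}. a m) * (INF m\<in>{max i j..}. b m)"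
      by (intro mult_mono inc) auto
    also have "\<dots> \<le> (INF m\<in>{max i j..}. a m * b m)"
      by (intro INF_greatest mult_mono INF_lower) auto
    also have "\<dots> \<le> liminf (\<lambda>n. a n * b n)" unfolding liminf_SUP_INF by (rule SUP_upper) simp
    finally show "(INF m\<in>{i..}. a m) * (INF m\<in>{j..}. b m) \<le> liminf (\<lambda>n. a n * b n)" .
  qed
  finally show ?thesis .
qed

lemma lower_semicont_mult:
  assumes "lower_semicont f" "lower_semicont g"
  shows "lower_semicont (\<lambda>x. f x * g x)"
  unfolding lower_semicont_def
proof (intro allI impI)
  fix x and u :: "nat \<Rightarrow> 'a" assume u: "u \<longlonglongrightarrow> x"
  have "f x * g x \<le> liminf (\<lambda>n. f (u n)) * liminf (\<lambda>n. g (u n))"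
    by (intro mult_mono lower_semicontD[OF assms(1) u] lower_semicontD[OF assms(2) u]) auto
  also have "\<dots> \<le> liminf (\<lambda>n. f (u n) * g (u n))" by (rule Liminf_mult_ennreal)
  finally show "f x * g x \<le> liminf (\<lambda>n. f (u n) * g (u n))" .
qed

lemma lower_semicont_ennreal:
  fixes f :: "'a::topological_space \<Rightarrow> real"
  assumes "continuous_on UNIV f"
  shows "lower_semicont (\<lambda>x. ennreal (f x))"
  unfolding lower_semicont_def
proof (intro allI impI)
  fix x and u :: "nat \<Rightarrow> 'a" assume "u \<longlonglongrightarrow> x"
  then have "(\<lambda>n. ennreal (f (u n))) \<longlonglongrightarrow> ennreal (f x)"
    using assms by (intro tendsto_ennrealI continuous_on_tendsto_compose[of UNIV f u x]) auto
  then have "liminf (\<lambda>n. ennreal (f (u n))) = ennreal (f x)" by (rule lim_imp_Liminf[rotated]) simp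
  then show "ennreal (f x) \<le> liminf (\<lambda>n. ennreal (f (u n)))" by simp
qed

lemma lower_semicont_indicator:
  assumes "open D"
  shows "lower_semicont (indicator D)"
  unfolding lower_semicont_def
proof (intro allI impI)
  fix x and u :: "nat \<Rightarrow> 'a" assume u: "u \<longlonglongrightarrow> x"
  show "indicator D x \<le> liminf (\<lambda>n. indicator D (u n) :: ennreal)"
  proof (cases "x \<in> D")
    case True
    from topological_tendstoD[OF u assms True] show ?thesis
      by (intro Liminf_bounded) (auto elim!: eventually_mono simp: True)
  qed simp
qed

lemma (in borel_finite) lower_semicont_shift_avg:
  assumes g: "lower_semicont g" and [measurable]: "g \<in> borel_measurable borel"
  shows "lower_semicont (shift_avg \<mu> g)"
  unfolding lower_semicont_def
proof (intro allI impI)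
  fix x and u :: "nat \<Rightarrow> 'a" assume u: "u \<longlonglongrightarrow> x"
  have "shift_avg \<mu> g x \<le> (\<integral>\<^sup>+ v. liminf (\<lambda>n. g (u n + v)) \<partial>\<mu>)"
    unfolding shift_avg_def by (intro nn_integral_mono lower_semicontD[OF g] tendsto_add u tendsto_const)
  also have "\<dots> \<le> liminf (\<lambda>n. shift_avg \<mu> g (u n))"
    unfolding shift_avg_def by (rule nn_integral_liminf) measurable
  finally show "shift_avg \<mu> g x \<le> liminf (\<lambda>n. shift_avg \<mu> g (u n))" .
qed

lemma lower_semicont_eventually:
  fixes f :: "'a::first_countable_topology \<Rightarrow> ennreal"
  assumes "lower_semicont f" "s < f x"
  shows "\<forall>\<^sub>F y in nhds x. s < f y"
  unfolding eventually_nhds_iff_sequentially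
proof (intro allI impI)
  fix u assume "u \<longlonglongrightarrow> x"
  then have "s < liminf (\<lambda>n. f (u n))" using assms(2) lower_semicontD[OF assms(1)] less_le_trans by blast
  then show "\<forall>\<^sub>F n in sequentially. s < f (u n)" by (rule less_LiminfD)
qed

section \<open>Iterated averages\<close>

text \<open>The last increment is integrated out first, and the result becomes the terminal function
  of a path with one step less. This accumulator \<open>h\<close> is what the inductions generalize
  over.\<close>

primrec path_avg :: "(nat \<Rightarrow> 'a::euclidean_space measure) \<Rightarrow> (nat \<Rightarrow> 'a \<Rightarrow> ennreal) \<Rightarrow> nat \<Rightarrow> ('a \<Rightarrow> ennreal) \<Rightarrow> 'a \<Rightarrow> ennreal" where
  "path_avg \<mu> F 0 h = h"
| "path_avg \<mu> F (Suc m) h = path_avg \<mu> F m (shift_avg (\<mu> m) (\<lambda>y. F m y * h y))"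

lemma sum_lessThan_measurable:
  fixes k m :: nat
  assumes "k \<le> m"
  shows "(\<lambda>d. \<Sum>j<k. d j) \<in> borel_measurable (PiM {..<m} (\<lambda>_. borel :: 'a::euclidean_space measure))"
proof (rule borel_measurable_sum)
  fix j assume "j \<in> {..<k}"
  then show "(\<lambda>d. d j) \<in> borel_measurable (PiM {..<m} (\<lambda>_. borel :: 'a measure))"
    using assms by (intro measurable_component_singleton) simp
qed

text \<open>Only the last factor and the terminal function see the last coordinate, so the integral
  over it produces \<open>shift_avg\<close> at the position reached before.\<close>

lemma nn_integral_path:
  fixes \<mu> :: "nat \<Rightarrow> 'a::euclidean_space measure"
  assumes \<mu>: "\<And>i. borel_prob (\<mu> i)" and F: "\<And>i. i < m \<Longrightarrow> F i \<in> borel_measurable borel"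
    and h: "h \<in> borel_measurable borel"
  shows "(\<integral>\<^sup>+ d. (\<Prod>i<m. F i (x + (\<Sum>j<Suc i. d j))) * h (x + (\<Sum>j<m. d j)) \<partial>PiM {..<m} \<mu>) = path_avg \<mu> F m h x"
  using F h
proof (induction m arbitrary: h)
  case 0
  then show ?case by (simp add: nn_integral_empty PiM_empty)
next
  case (Suc m)
  interpret product_sigma_finite \<mu>
  proof (rule product_sigma_finite.intro)
    show "sigma_finite_measure (\<mu> i)" for i
      using borel_prob_finite[OF \<mu>, of i] by (simp add: borel_finite_def finite_measure.axioms)
  qed
  interpret \<mu>m: borel_prob "\<mu> m" by (rule \<mu>)
  have sets: "sets (PiM {..<Suc m} \<mu>) = sets (PiM {..<Suc m} (\<lambda>_. borel))"
    by (intro sets_PiM_cong) (simp_all add: borel_prob.sets_eq_borel[OF \<mu>])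
  note [measurable] = Suc.prems(1)[OF lessI] Suc.prems(2)
  let ?g = "\<lambda>d. (\<Prod>i<Suc m. F i (x + (\<Sum>j<Suc i. d j))) * h (x + (\<Sum>j<Suc m. d j))"
  have "?g \<in> borel_measurable (PiM {..<Suc m} (\<lambda>_. borel))"
    by (intro borel_measurable_times_ennreal borel_measurable_prod_ennreal measurable_compose[OF _ Suc.prems(1)]
        measurable_compose[OF _ Suc.prems(2)] borel_measurable_add borel_measurable_const sum_lessThan_measurable) auto
  then have g: "?g \<in> borel_measurable (PiM (insert m {..<m}) \<mu>)"
    unfolding lessThan_Suc[symmetric] by (simp only: measurable_cong_sets[OF sets refl])
  have "(\<integral>\<^sup>+ d. ?g d \<partial>PiM {..<Suc m} \<mu>) = (\<integral>\<^sup>+ d. (\<integral>\<^sup>+ u. ?g (d(m := u)) \<partial>\<mu> m) \<partial>PiM {..<m} \<mu>)"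
    unfolding lessThan_Suc[of m] by (rule product_nn_integral_insert[OF _ _ g[unfolded lessThan_Suc[of m]]]) auto
  also have "\<dots> = (\<integral>\<^sup>+ d. (\<Prod>i<m. F i (x + (\<Sum>j<Suc i. d j))) * shift_avg (\<mu> m) (\<lambda>y. F m y * h y) (x + (\<Sum>j<m. d j)) \<partial>PiM {..<m} \<mu>)"
  proof (rule nn_integral_cong)
    fix d :: "nat \<Rightarrow> 'a"
    have s: "(\<Sum>j<k. (d(m := u)) j) = (\<Sum>j<k. d j)" if "k \<le> m" for u k
      using that by (intro sum.cong) auto
    have "?g (d(m := u)) = (\<Prod>i<m. F i (x + (\<Sum>j<Suc i. d j))) * (F m (x + (\<Sum>j<m. d j) + u) * h (x + (\<Sum>j<m. d j) + u))" for u
    proof -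
      have "(\<Prod>i<m. F i (x + (\<Sum>j<Suc i. (d(m := u)) j))) = (\<Prod>i<m. F i (x + (\<Sum>j<Suc i. d j)))"
        by (intro prod.cong refl) (subst s, auto)
      then show ?thesis by (simp only: prod.lessThan_Suc sum.lessThan_Suc[of _ m] s[OF order_refl] fun_upd_same add.assoc mult.assoc)
    qed
    then show "(\<integral>\<^sup>+ u. ?g (d(m := u)) \<partial>\<mu> m) = (\<Prod>i<m. F i (x + (\<Sum>j<Suc i. d j))) * shift_avg (\<mu> m) (\<lambda>y. F m y * h y) (x + (\<Sum>j<m. d j))"
      unfolding shift_avg_def by (simp only:) (rule nn_integral_cmult, measurable)
  qed
  also have "\<dots> = path_avg \<mu> F m (shift_avg (\<mu> m) (\<lambda>y. F m y * h y)) x"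
    by (rule Suc.IH) (auto intro: Suc.prems)
  finally show ?case by simp
qed

text \<open>Continuity of the weights and openness of the domains enter through lower semicontinuity
  of \<open>h\<close>. It is carried through all steps because at the end an inequality between
  integrals must be turned into one at the starting point.\<close>

lemma path_avg_le:
  fixes \<mu> \<mu>' :: "nat \<Rightarrow> 'a::euclidean_space measure" and f :: "nat \<Rightarrow> 'a \<Rightarrow> real"
  assumes dom: "\<And>i. rearrangement_dominated (\<mu> i) (\<mu>' i)"
    and f: "\<And>i. i < m \<Longrightarrow> continuous_on UNIV (f i)" and D: "\<And>i. i < m \<Longrightarrow> open (D i)"
    and h: "h \<in> borel_measurable borel" "lower_semicont h" "weakly_majorized h H" "radially_decreasing H"
  shows "path_avg \<mu> (\<lambda>i x. ennreal (f i x) * indicator (D i) x) m h x \<le>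
    path_avg \<mu>' (\<lambda>i x. rearr (\<lambda>y. ennreal (f i y)) x * indicator (rball (emeasure lborel (D i))) x) m H 0"
  using f D h
proof (induction m arbitrary: h H)
  case 0
  then show ?case by (simp add: weakly_majorized_pointwise lower_semicont_eventually)
next
  case (Suc m)
  have fin: "borel_finite (\<mu> m)" "borel_finite (\<mu>' m)" and sd: "symm_dominated (\<mu> m) (\<mu>' m)" and uni: "unimodal (\<mu>' m)"
    using dom[of m] by (auto simp: rearrangement_dominated_def intro: borel_prob_finite)
  let ?f = "\<lambda>y. ennreal (f m y)" and ?B = "rball (emeasure lborel (D m)) :: 'a set"
  have [measurable]: "f m \<in> borel_measurable borel" using Suc.prems(1) by (simp add: borel_measurable_continuous_onI)
  have [measurable]: "D m \<in> sets borel" using Suc.prems(2) by auto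
  note [measurable] = Suc.prems(3) radially_decreasing_measurable[OF Suc.prems(6)]
  have g: "(\<lambda>y. ?f y * indicator (D m) y * h y) \<in> borel_measurable borel" by measurable
  have lsc: "lower_semicont (\<lambda>y. ?f y * indicator (D m) y * h y)"
    using Suc.prems by (intro lower_semicont_mult lower_semicont_ennreal lower_semicont_indicator) auto
  have maj: "weakly_majorized (\<lambda>y. ?f y * indicator (D m) y * h y) (\<lambda>y. rearr ?f y * indicator ?B y * H y)"
    by (rule weakly_majorized_mult[OF Suc.prems(5)]) (measurable, rule superlevel_rearr, measurable)
  have rd: "radially_decreasing (\<lambda>y. rearr ?f y * indicator ?B y * H y)"
    unfolding radially_decreasing_def
    by (intro allI impI mult_mono radially_decreasingD[OF radially_decreasing_rearr]
        radially_decreasingD[OF radially_decreasing_rball] radially_decreasingD[OF Suc.prems(6)]) auto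
  show ?case
    unfolding path_avg.simps
  proof (rule Suc.IH)
    show "shift_avg (\<mu> m) (\<lambda>y. ?f y * indicator (D m) y * h y) \<in> borel_measurable borel"
      by (rule borel_finite.shift_avg_measurable[OF fin(1) g])
    show "lower_semicont (shift_avg (\<mu> m) (\<lambda>y. ?f y * indicator (D m) y * h y))"
      by (rule borel_finite.lower_semicont_shift_avg[OF fin(1) lsc g])
    show "weakly_majorized (shift_avg (\<mu> m) (\<lambda>y. ?f y * indicator (D m) y * h y))
      (shift_avg (\<mu>' m) (\<lambda>y. rearr ?f y * indicator ?B y * H y))"
      by (rule weakly_majorized_shift_avg[OF fin sd uni g maj rd])
    show "radially_decreasing (shift_avg (\<mu>' m) (\<lambda>y. rearr ?f y * indicator ?B y * H y))"
      by (rule radially_decreasing_shift_avg[OF fin(2) uni rd])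
  qed (use Suc.prems in auto)
qed

section \<open>Increments of a Levy process\<close>

definition increment_law :: "'w measure \<Rightarrow> (real \<Rightarrow> 'w \<Rightarrow> 'a::euclidean_space) \<Rightarrow> real \<Rightarrow> 'a measure" where
  "increment_law M X s = distr M borel (\<lambda>\<omega>. X s \<omega> - X 0 \<omega>)"

lemma borel_prob_increment_law:
  assumes X: "levy_process_from z M X" and s: "0 \<le> s"
  shows "borel_prob (increment_law M X s)"
proof -
  interpret prob_space M using X by (simp add: levy_process_from_def)
  have [measurable]: "X s \<in> borel_measurable M" "X 0 \<in> borel_measurable M" using X s by (auto simp: levy_process_from_def)
  show ?thesis unfolding increment_law_def borel_prob_def borel_prob_axioms_def by (auto intro: prob_space_distr)
qed

lemma cfun_increment_law:
  assumes X: "levy_process_with_triple z M X b A \<nu>" and s: "0 \<le> s"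
  shows "cfun (increment_law M X s) \<xi> = exp (- of_real s * levy_exponent b A \<nu> \<xi>)"
proof -
  have L: "levy_process_from z M X" using X by (simp add: levy_process_with_triple_def)
  have [measurable]: "X s \<in> borel_measurable M" "X 0 \<in> borel_measurable M" using L s by (auto simp: levy_process_from_def)
  have z: "AE \<omega> in M. X 0 \<omega> = z" using L by (simp add: levy_process_from_def)
  have "cfun (increment_law M X s) \<xi> = (LINT \<omega>|M. exp (\<i> * of_real (\<xi> \<bullet> (X s \<omega> - X 0 \<omega>))))"
    unfolding cfun_def increment_law_def by (rule integral_distr) measurable
  also have "\<dots> = (LINT \<omega>|M. exp (- \<i> * of_real (\<xi> \<bullet> z)) * exp (\<i> * of_real (\<xi> \<bullet> X s \<omega>)))"
  proof (rule integral_cong_AE)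
    show "AE \<omega> in M. exp (\<i> * of_real (\<xi> \<bullet> (X s \<omega> - X 0 \<omega>))) = exp (- \<i> * of_real (\<xi> \<bullet> z)) * exp (\<i> * of_real (\<xi> \<bullet> X s \<omega>))"
      using z by eventually_elim (simp add: exp_add[symmetric] inner_diff_right algebra_simps)
  qed measurable
  also have "\<dots> = exp (- \<i> * of_real (\<xi> \<bullet> z)) * exp (- of_real s * levy_exponent b A \<nu> \<xi> + \<i> * of_real (\<xi> \<bullet> z))"
    using X s by (simp add: levy_process_with_triple_def)
  also have "\<dots> = exp (- of_real s * levy_exponent b A \<nu> \<xi>)" by (simp add: exp_add[symmetric])
  finally show ?thesis .
qed

text \<open>Independence and stationarity make the joint law of the increments a product of
  increment laws, and adding the start \<open>z\<close> to their telescoping sums recovers the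
  sampled positions.\<close>

lemma nn_integral_levy_process:
  assumes X: "levy_process_from z M X" and \<tau>: "\<tau> 0 = 0" "\<And>i. \<tau> i \<le> \<tau> (Suc i)"
    and F: "\<And>i. i < m \<Longrightarrow> F i \<in> borel_measurable borel"
  shows "(\<integral>\<^sup>+ \<omega>. (\<Prod>i<m. F i (X (\<tau> (Suc i)) \<omega>)) \<partial>M) =
    path_avg (\<lambda>i. increment_law M X (\<tau> (Suc i) - \<tau> i)) F m (\<lambda>_. 1) z"
proof (cases "m = 0")
  \<comment> \<open>Split off because the product description of independence used below requires a
    nonempty index set.\<close>
  case True
  interpret prob_space M using X by (simp add: levy_process_from_def)
  show ?thesis using True by (simp add: emeasure_space_1)
next
  case False
  interpret prob_space M using X by (simp add: levy_process_from_def)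
  have \<tau>0: "0 \<le> \<tau> i" for i by (induction i) (use \<tau> in \<open>auto intro: order_trans\<close>)
  have Xm[measurable]: "X s \<in> borel_measurable M" if "0 \<le> s" for s using X that by (auto simp: levy_process_from_def)
  have z: "AE \<omega> in M. X 0 \<omega> = z" using X by (simp add: levy_process_from_def)
  let ?\<mu> = "\<lambda>i. increment_law M X (\<tau> (Suc i) - \<tau> i)"
  let ?D = "\<lambda>i \<omega>. X (\<tau> (Suc i)) \<omega> - X (\<tau> i) \<omega>"
  have ind: "indep_vars (\<lambda>_. borel) ?D {..<m}"
    using X \<tau> by (simp add: levy_process_from_def)
  have rv: "random_variable borel (?D i)" for i using \<tau>0 by measurable
  have law: "distr M borel (?D i) = ?\<mu> i" for i
  proof -
    have st: "distr M borel (\<lambda>\<omega>. X (r + s) \<omega> - X r \<omega>) = distr M borel (\<lambda>\<omega>. X s \<omega> - X 0 \<omega>)" if "0 \<le> r" "0 \<le> s" for r s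
      using X that by (simp add: levy_process_from_def)
    show ?thesis using st[of "\<tau> i" "\<tau> (Suc i) - \<tau> i"] \<tau>0 \<tau>(2)[of i] by (simp add: increment_law_def)
  qed
  have ne: "{..<m} \<noteq> {}" using False by auto
  have joint: "distr M (PiM {..<m} (\<lambda>_. borel)) (\<lambda>\<omega>. \<lambda>i\<in>{..<m}. ?D i \<omega>) = PiM {..<m} ?\<mu>"
    using indep_vars_iff_distr_eq_PiM[OF ne, where M'="\<lambda>_. borel" and X="?D"] rv ind by (simp add: law)
  let ?g = "\<lambda>d. (\<Prod>i<m. F i (z + (\<Sum>j<Suc i. d j))) * 1"
  have g[measurable]: "?g \<in> borel_measurable (PiM {..<m} (\<lambda>_. borel))"
    by (intro borel_measurable_times_ennreal borel_measurable_prod_ennreal measurable_compose[OF _ F]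
        borel_measurable_add borel_measurable_const sum_lessThan_measurable) auto
  have "(\<integral>\<^sup>+ \<omega>. (\<Prod>i<m. F i (X (\<tau> (Suc i)) \<omega>)) \<partial>M) = (\<integral>\<^sup>+ \<omega>. ?g (\<lambda>i\<in>{..<m}. ?D i \<omega>) \<partial>M)"
  proof (rule nn_integral_cong_AE)
    show "AE \<omega> in M. (\<Prod>i<m. F i (X (\<tau> (Suc i)) \<omega>)) = ?g (\<lambda>i\<in>{..<m}. ?D i \<omega>)"
      using z
    proof eventually_elim
      case (elim \<omega>)
      have e: "z + (\<Sum>j<Suc i. (\<lambda>i\<in>{..<m}. ?D i \<omega>) j) = X (\<tau> (Suc i)) \<omega>" if "i < m" for i
      proof -
        have "(\<Sum>j<Suc i. (\<lambda>i\<in>{..<m}. ?D i \<omega>) j) = (\<Sum>j<Suc i. ?D j \<omega>)" using that by (intro sum.cong) auto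
        also have "\<dots> = X (\<tau> (Suc i)) \<omega> - X (\<tau> 0) \<omega>" by (rule sum_lessThan_telescope)
        finally show ?thesis using elim \<tau>(1) by simp
      qed
      show ?case unfolding mult_1_right by (intro prod.cong refl) (simp only: e lessThan_iff)
    qed
  qed
  also have "\<dots> = (\<integral>\<^sup>+ d. ?g d \<partial>distr M (PiM {..<m} (\<lambda>_. borel)) (\<lambda>\<omega>. \<lambda>i\<in>{..<m}. ?D i \<omega>))"
  proof (rule nn_integral_distr[symmetric])
    show "(\<lambda>\<omega>. \<lambda>i\<in>{..<m}. ?D i \<omega>) \<in> measurable M (PiM {..<m} (\<lambda>_. borel))" by (rule measurable_restrict, rule rv)
    show "?g \<in> borel_measurable (distr M (PiM {..<m} (\<lambda>_. borel)) (\<lambda>\<omega>. \<lambda>i\<in>{..<m}. ?D i \<omega>))"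
      unfolding measurable_distr_eq1 by (rule g)
  qed
  also have "\<dots> = path_avg ?\<mu> F m (\<lambda>_. 1) z"
    unfolding joint by (rule nn_integral_path[OF borel_prob_increment_law[OF X] F]) (simp_all add: \<tau>(2))
  finally show ?thesis .
qed

theorem theorem1p1:
  fixes M :: "'w measure" and X :: "real \<Rightarrow> 'w \<Rightarrow> real ^ 'n"
    and N :: "'v measure" and Y :: "real \<Rightarrow> 'v \<Rightarrow> real ^ 'n"
    and b z :: "real ^ 'n" and A :: "real ^ 'n ^ 'n" and \<nu> :: "(real ^ 'n) measure"
    and m :: nat and f :: "nat \<Rightarrow> real ^ 'n \<Rightarrow> real" and D :: "nat \<Rightarrow> (real ^ 'n) set"
    and t :: "nat \<Rightarrow> real"
  assumes "levy_process_with_triple z M X b A \<nu>"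
    and "absolutely_continuous lborel \<nu>"
    and "levy_symmetrization_from 0 N Y b A \<nu>"
    and "\<And>i. i \<in> {1..m} \<Longrightarrow> continuous_on UNIV (f i)"
    and "\<And>i x. i \<in> {1..m} \<Longrightarrow> 0 \<le> f i x"
    and "\<And>i. i \<in> {1..m} \<Longrightarrow> domain (D i)"
    and "\<And>i. i \<in> {1..m} \<Longrightarrow> 0 \<le> t i"
    and "mono_on {1..m} t"
  shows "(\<integral>\<^sup>+ \<omega>. (\<Prod>i=1..m. ennreal (f i (X (t i) \<omega>)) * indicator (D i) (X (t i) \<omega>)) \<partial>M)
    \<le> (\<integral>\<^sup>+ \<omega>. (\<Prod>i=1..m. decreasing_rearrangement (\<lambda>x. ennreal (f i x)) (Y (t i) \<omega>)
          * indicator (ball_rearrangement (D i)) (Y (t i) \<omega>)) \<partial>N)"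
proof -
  let ?F = "\<lambda>i x. ennreal (f (Suc i) x) * indicator (D (Suc i)) x"
  let ?F' = "\<lambda>i x. rearr (\<lambda>y. ennreal (f (Suc i) y)) x * indicator (rball (emeasure lborel (D (Suc i)))) x"
  have X: "levy_process_from z M X" and triple: "levy_triple b A \<nu>"
    using assms(1) by (auto simp: levy_process_with_triple_def)
  have Y': "levy_process_with_triple 0 N Y 0 (symmetrized_matrix A) (symmetrized_levy_measure \<nu>)"
    using assms(3) by (simp add: levy_symmetrization_from_def)
  \<comment> \<open>That the rearranged density defines a Levy measure is part of the assumption
    that \<open>Y\<close> is a process with the symmetrized triple.\<close>
  then have Y: "levy_process_from 0 N Y" and levy': "levy_measure (symmetrized_levy_measure \<nu>)"
    by (auto simp: levy_process_with_triple_def levy_triple_def)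
  have cont: "continuous_on UNIV (f (Suc i))" and dom: "domain (D (Suc i))" if "i < m" for i
    using assms(4,6) that by auto
  have meas: "f (Suc i) \<in> borel_measurable borel" "D (Suc i) \<in> sets borel" if "i < m" for i
    using cont[OF that] dom[OF that] by (auto simp: domain_def borel_measurable_continuous_onI)
  \<comment> \<open>Puts time 0 in front of the given times and stays constant after the last one,
    so that the sequence is monotone on all natural numbers.\<close>
  define \<tau> where "\<tau> i = (if i = 0 \<or> m = 0 then 0 else t (min i m))" for i
  have \<tau>: "\<tau> (Suc i) = t (Suc i)" if "i < m" for i using that by (auto simp: \<tau>_def)
  have \<tau>_mono: "\<tau> i \<le> \<tau> (Suc i)" for i
  proof (cases "i = 0 \<or> m = 0")
    case True then show ?thesis using assms(7) by (auto simp: \<tau>_def)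
  next
    case False
    then have "t (min i m) \<le> t (min (Suc i) m)" by (intro mono_onD[OF assms(8)]) auto
    then show ?thesis using False by (simp add: \<tau>_def)
  qed
  have \<tau>0: "\<tau> 0 = 0" by (simp add: \<tau>_def)
  have inc: "0 \<le> \<tau> (Suc i) - \<tau> i" for i using \<tau>_mono[of i] by simp
  have "(\<integral>\<^sup>+ \<omega>. (\<Prod>i=1..m. ennreal (f i (X (t i) \<omega>)) * indicator (D i) (X (t i) \<omega>)) \<partial>M)
    = (\<integral>\<^sup>+ \<omega>. (\<Prod>i<m. ?F i (X (\<tau> (Suc i)) \<omega>)) \<partial>M)"
    by (simp add: prod.atLeast1_atMost_eq \<tau>)
  also have "\<dots> = path_avg (\<lambda>i. increment_law M X (\<tau> (Suc i) - \<tau> i)) ?F m (\<lambda>_. 1) z"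
  proof (rule nn_integral_levy_process[OF X \<tau>0 \<tau>_mono])
    fix i assume "i < m"
    note [measurable] = meas[OF this]
    show "?F i \<in> borel_measurable borel" by measurable
  qed
  also have "\<dots> \<le> path_avg (\<lambda>i. increment_law N Y (\<tau> (Suc i) - \<tau> i)) ?F' m (\<lambda>_. 1) 0"
  proof (rule path_avg_le)
    show "rearrangement_dominated (increment_law M X (\<tau> (Suc i) - \<tau> i)) (increment_law N Y (\<tau> (Suc i) - \<tau> i))" for i
      by (rule levy_rearrangement_dominated[OF triple assms(2) levy' inc borel_prob_increment_law[OF X inc]
          borel_prob_increment_law[OF Y inc] cfun_increment_law[OF assms(1) inc] cfun_increment_law[OF Y' inc]])
    show "lower_semicont (\<lambda>_. 1 :: ennreal)" by (simp add: lower_semicont_def Liminf_const)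
    show "radially_decreasing (\<lambda>_. 1 :: ennreal)" by (simp add: radially_decreasing_def)
  qed (use cont dom in \<open>auto simp: domain_def weakly_majorized_one\<close>)
  also have "\<dots> = (\<integral>\<^sup>+ \<omega>. (\<Prod>i<m. ?F' i (Y (\<tau> (Suc i)) \<omega>)) \<partial>N)"
    by (rule nn_integral_levy_process[OF Y \<tau>0 \<tau>_mono, symmetric]) measurable
  also have "\<dots> = (\<integral>\<^sup>+ \<omega>. (\<Prod>i=1..m. decreasing_rearrangement (\<lambda>x. ennreal (f i x)) (Y (t i) \<omega>)
          * indicator (ball_rearrangement (D i)) (Y (t i) \<omega>)) \<partial>N)"
  proof -
    have "decreasing_rearrangement (\<lambda>x. ennreal (f (Suc i) x)) = rearr (\<lambda>x. ennreal (f (Suc i) x))"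
      "ball_rearrangement (D (Suc i)) = rball (emeasure lborel (D (Suc i)))" if "i < m" for i
      using meas[OF that] dom[OF that] by (auto intro!: decreasing_rearrangement_eq_rearr ball_rearrangement_eq simp: domain_def)
    then show ?thesis by (simp add: prod.atLeast1_atMost_eq \<tau>)
  qed
  finally show ?thesis .
qed

end
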